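(* Let $s>\frac12$. For every $a>\frac12$, the Kuznetsov-Ma breather $$B(t,x)=e^{it}\left[1-\sqrt2\,\beta\,\frac{\beta^2\cos(\alpha t)+i\alpha\sin(\alpha t)}{\alpha\cosh(\beta x)-\sqrt2\,\beta\cos(\alpha t)}\right],\qquad \alpha=(8a(2a-1))^{1/2},\quad \beta=(2(2a-1))^{1/2},$$ a solution of the focusing cubic nonlinear Schrödinger equation $i\partial_tu+\partial_x^2u+|u|^2u=0$ on $\mathbb{R}$, is unstable under small $H^s$ perturbations; that is, $B$ is not orbitally stable in $H^s(\mathbb{R})$ (in the sense defined in the context).
   Context: Consider perturbations $u(t,x)=e^{it}(1+w(t,x))$ of the Stokes wave $e^{it}$ in $i\partial_tu+\partial_x^2u+|u|^2u=0$; then $w$ satisfies $$i\partial_tw+\partial_x^2w+2\operatorname{Re}w=G[w],\qquad G[w]=-\big(2|w|^2+w^2+|w|^2w\big). \tag{$*$}$$ For $s>\frac12$, $( * )$ is locally well-posed in $H^s(\mathbb{R})$: for each $t_0\in\mathbb{R}$ and $w_0\in H^s(\mathbb{R})$ there is a unique maximal solution $w$, continuous in time with values in $H^s$, with $w(t_0)=w_0$, where solutions are understood in the integral (Duhamel) sense. Definition (orbital stability). Fix $s>\frac12$ and $t_0\in\mathbb{R}$. A globally defined solution $U=e^{it}(1+W)$ of $i\partial_tu+\partial_x^2u+|u|^2u=0$ is orbitally stable in $H^s$ if there are constants $C_0,\varepsilon_0>0$ such that for any $0<\varepsilon<\varepsilon_0$ and any $w_0\in H^s(\mathbb{R})$: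 if $\|w_0-W(t_0)\|_{H^s}<\varepsilon$, then there exists $x_0(t)\in\mathbb{R}$ ($t\in\mathbb{R}$) such that $$\sup_{t\in\mathbb{R}}\|w(t)-W(t,\cdot-x_0(t))\|_{H^s}<C_0\,\varepsilon,$$ where $w(t)$ is the solution of $( * )$ with $w(t_0)=w_0$. This condition requires $w$ to be globally defined. If the condition is not satisfied, $U$ is called unstable. For $U=B$ one has $W(t,x)=-\sqrt2\,\beta\,\frac{\beta^2\cos(\alpha t)+i\alpha\sin(\alpha t)}{\alpha\cosh(\beta x)-\sqrt2\,\beta\cos(\alpha t)}$. *)

theory Defs
  imports "HOL-Analysis.Analysis"
begin

section \<open>Fourier transform on $L^2(\mathbb{R})$ and the Sobolev spaces $H^s(\mathbb{R})$\<close>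

text \<open>Elements of $L^2$ and $H^s$ are represented by functions; all notions below are invariant
  under modification on null sets.\<close>

definition L2_space :: "(real \<Rightarrow> complex) set" where
  "L2_space = {f. f \<in> borel_measurable lborel \<and> integrable lborel (\<lambda>x. (cmod (f x))\<^sup>2)}"

text \<open>\<open>has_fourier f g\<close>: the class of \<open>g\<close> is the Plancherel transform of \<open>f\<close>, i.e. the $L^2$-limit
  as $R \to \infty$ of $\int_{-R}^{R} e^{-ix\xi} f(x)\,dx$.\<close>

definition has_fourier :: "(real \<Rightarrow> complex) \<Rightarrow> (real \<Rightarrow> complex) \<Rightarrow> bool" where
  "has_fourier f g \<longleftrightarrow> f \<in> L2_space \<and> g \<in> L2_space \<and>
     ((\<lambda>R. \<integral>\<^sup>+\<xi>. ennreal ((cmod (g \<xi> - (LINT x:{-R..R}|lborel. cis (-(x * \<xi>)) * f x)))\<^sup>2) \<partial>lborel)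
        \<longlongrightarrow> 0) at_top"

definition fourier :: "(real \<Rightarrow> complex) \<Rightarrow> real \<Rightarrow> complex" where
  "fourier f = (SOME g. has_fourier f g)"

text \<open>For $s \ge 0$ this is the usual space; the restriction to $L^2$ is no loss there.\<close>

definition Hs :: "real \<Rightarrow> (real \<Rightarrow> complex) set" where
  "Hs s = {f \<in> L2_space. integrable lborel (\<lambda>\<xi>. (1 + \<xi>\<^sup>2) powr s * (cmod (fourier f \<xi>))\<^sup>2)}"

definition Hs_norm :: "real \<Rightarrow> (real \<Rightarrow> complex) \<Rightarrow> real" where
  "Hs_norm s f = sqrt (1 / (2 * pi) * (LINT \<xi>|lborel. (1 + \<xi>\<^sup>2) powr s * (cmod (fourier f \<xi>))\<^sup>2))"

text \<open>The $H^s$-valued oriented Riemann integral $v = \int_a^b h(\tau)\,d\tau$: convergence of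
  Riemann sums in the $H^s$ norm as the mesh tends to $0$.\<close>

definition has_Hs_integral ::
  "real \<Rightarrow> (real \<Rightarrow> real \<Rightarrow> complex) \<Rightarrow> real \<Rightarrow> real \<Rightarrow> (real \<Rightarrow> complex) \<Rightarrow> bool" where
  "has_Hs_integral s h a b v \<longleftrightarrow>
     (\<forall>\<tau>\<in>closed_segment a b. h \<tau> \<in> Hs s) \<and> v \<in> Hs s \<and>
     (\<forall>e>0. \<exists>d>0. \<forall>p. p tagged_division_of (closed_segment a b) \<and> (\<lambda>\<tau>. ball \<tau> d) fine p \<longrightarrow>
        Hs_norm s (\<lambda>x. (\<Sum>(\<tau>, K)\<in>p. of_real (sgn (b - a) * measure lborel K) * h \<tau> x) - v x) < e)"

section \<open>Perturbations of the Stokes wave\<close>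

text \<open>The free group $e^{it\partial_x^2}$, with Fourier multiplier $e^{-it\xi^2}$.\<close>

definition free_schrodinger :: "real \<Rightarrow> (real \<Rightarrow> complex) \<Rightarrow> real \<Rightarrow> complex" where
  "free_schrodinger t f = (SOME g. has_fourier g (\<lambda>\<xi>. cis (-(t * \<xi>\<^sup>2)) * fourier f \<xi>))"

definition G :: "complex \<Rightarrow> complex" where
  "G z = - (2 * (of_real (cmod z))\<^sup>2 + z\<^sup>2 + (of_real (cmod z))\<^sup>2 * z)"

text \<open>$H^s$ solutions of $i w_t + w_{xx} + 2\,\mathrm{Re}\,w = G[w]$ on an open time interval \<open>I\<close>,
  with $w(t_0) = w_0$, in the Duhamel sense
  $w(t) = e^{i(t-t_0)\partial_x^2} w_0
     - i\int_{t_0}^t e^{i(t-\tau)\partial_x^2}\,(G[w] - 2\,\mathrm{Re}\,w)(\tau)\,d\tau$.\<close>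

definition pert_solution ::
  "real \<Rightarrow> real \<Rightarrow> (real \<Rightarrow> complex) \<Rightarrow> real set \<Rightarrow> (real \<Rightarrow> real \<Rightarrow> complex) \<Rightarrow> bool" where
  "pert_solution s t0 w0 I w \<longleftrightarrow>
     open I \<and> is_interval I \<and> t0 \<in> I \<and>
     (\<forall>t\<in>I. w t \<in> Hs s) \<and>
     (\<forall>t\<in>I. ((\<lambda>\<tau>. Hs_norm s (\<lambda>x. w \<tau> x - w t x)) \<longlongrightarrow> 0) (at t within I)) \<and>
     (AE x in lborel. w t0 x = w0 x) \<and>
     (\<forall>t\<in>I. \<exists>v.
        has_Hs_integral s
          (\<lambda>\<tau>. free_schrodinger (t - \<tau>) (\<lambda>x. G (w \<tau> x) - 2 * of_real (Re (w \<tau> x)))) t0 t v \<and>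
        (AE x in lborel. w t x = free_schrodinger (t - t0) w0 x - \<i> * v x))"

definition maximal_pert_solution ::
  "real \<Rightarrow> real \<Rightarrow> (real \<Rightarrow> complex) \<Rightarrow> real set \<Rightarrow> (real \<Rightarrow> real \<Rightarrow> complex) \<Rightarrow> bool" where
  "maximal_pert_solution s t0 w0 I w \<longleftrightarrow>
     pert_solution s t0 w0 I w \<and>
     \<not> (\<exists>J v. I \<subset> J \<and> pert_solution s t0 w0 J v \<and>
              (\<forall>t\<in>I. AE x in lborel. v t x = w t x))"

text \<open>The $W$ with $U(t,x) = e^{it}(1 + W(t,x))$.\<close>

definition pert_of :: "(real \<Rightarrow> real \<Rightarrow> complex) \<Rightarrow> real \<Rightarrow> real \<Rightarrow> complex" where
  "pert_of U t x = cis (- t) * U t x - 1"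

definition global_Hs_solution :: "real \<Rightarrow> real \<Rightarrow> (real \<Rightarrow> real \<Rightarrow> complex) \<Rightarrow> bool" where
  "global_Hs_solution s t0 U \<longleftrightarrow> pert_solution s t0 (pert_of U t0) UNIV (pert_of U)"

text \<open>To be applied to \<open>U\<close> with \<open>global_Hs_solution s t0 U\<close>. Maximal solutions exist and are
  unique up to null sets by local well-posedness for $s > 1/2$, so the quantifier over \<open>(I, w)\<close>
  refers to the solution with datum \<open>w0\<close>; \<open>I = UNIV\<close> says that it is global. The supremum is taken
  in the extended reals since the norms may be unbounded in time.\<close>

definition orbitally_stable :: "real \<Rightarrow> real \<Rightarrow> (real \<Rightarrow> real \<Rightarrow> complex) \<Rightarrow> bool" where
  "orbitally_stable s t0 U \<longleftrightarrow>
     (\<exists>C0>0. \<exists>\<epsilon>0>0. \<forall>\<epsilon>. 0 < \<epsilon> \<and> \<epsilon> < \<epsilon>0 \<longrightarrow>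
        (\<forall>w0\<in>Hs s. Hs_norm s (\<lambda>x. w0 x - pert_of U t0 x) < \<epsilon> \<longrightarrow>
          (\<forall>I w. maximal_pert_solution s t0 w0 I w \<longrightarrow>
             I = UNIV \<and>
             (\<exists>x0 :: real \<Rightarrow> real.
                (SUP t. ereal (Hs_norm s (\<lambda>x. w t x - pert_of U t (x - x0 t)))) < ereal (C0 * \<epsilon>)))))"

section \<open>The Kuznetsov--Ma breather\<close>

definition classical_NLS_solution :: "(real \<Rightarrow> real \<Rightarrow> complex) \<Rightarrow> bool" where
  "classical_NLS_solution u \<longleftrightarrow>
     (\<exists>ut ux uxx. \<forall>t x.
        ((\<lambda>\<tau>. u \<tau> x) has_vector_derivative ut t x) (at t) \<and>
        ((\<lambda>y. u t y) has_vector_derivative ux t x) (at x) \<and>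
        ((\<lambda>y. ux t y) has_vector_derivative uxx t x) (at x) \<and>
        \<i> * ut t x + uxx t x + (of_real (cmod (u t x)))\<^sup>2 * u t x = 0)"

definition KM_breather :: "real \<Rightarrow> real \<Rightarrow> real \<Rightarrow> complex" where
  "KM_breather a t x =
     (let \<alpha> = sqrt (8 * a * (2 * a - 1)); \<beta> = sqrt (2 * (2 * a - 1)) in
      cis t * (1 - of_real (sqrt 2 * \<beta>) *
        (of_real (\<beta>\<^sup>2 * cos (\<alpha> * t)) + \<i> * of_real (\<alpha> * sin (\<alpha> * t))) /
        of_real (\<alpha> * cosh (\<beta> * x) - sqrt 2 * \<beta> * cos (\<alpha> * t))))"

end

theory Submission
  imports Defs "HOL-Probability.Probability"
begin

text \<open>The breather is unstable because breathers of nearby frequencies drift out of phase. The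
Kuznetsov--Ma breathers form a one-parameter family, which is parametrised here by the frequency
\<open>w\<close> of the oscillation: the perturbation of the Stokes wave is
\<open>breather w t x = amp w t / (cosh (width w * x) - osc w t)\<close>, periodic in \<open>t\<close> with period \<open>2 * pi / w\<close>.
Orbital stability compares two solutions at the same time, modulo a translation in space only. For
\<open>v = w * (1 + 1 / (2 * n))\<close> and \<open>T = 2 * pi * n / w\<close> the phase \<open>w * T\<close> is an even multiple of \<open>pi\<close> and
\<open>v * T\<close> an odd one. At that time both perturbations are real valued, that of frequency \<open>w\<close> is
negative everywhere and that of frequency \<open>v\<close> is positive everywhere. Hence no translate of the first
is closer in \<open>L2\<close> to the second than the \<open>L2\<close> norm of the second, which has a lower bound independent of
\<open>n\<close> (\<open>breather_antiphase\<close>). But at any fixed time the two perturbations converge to each other in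
every Sobolev norm as \<open>n\<close> tends to infinity (\<open>breather_tendsto_Hs\<close>), so no constant \<open>C0\<close> can work
(\<open>breather_not_orbitally_stable\<close>).

The longer part of the argument shows that a breather is a global solution in the Duhamel sense
for an arbitrary Sobolev exponent (\<open>breather_pert_solution\<close>). Everything happens on the Fourier side and rests on one algebraic
fact: with \<open>P = 1 / (cosh (b * x) - c)\<close>, the second derivative of \<open>P ^ k\<close> in \<open>x\<close> is a combination of
\<open>P ^ k\<close>, \<open>P ^ (k + 1)\<close> and \<open>P ^ (k + 2)\<close>, and the derivative of \<open>P ^ k\<close> in \<open>c\<close> is \<open>k * P ^ (k + 1)\<close>. The
first fact bounds \<open>(1 + \<xi>\<^sup>2)\<close> times the transform of a power by transforms of higher powers, so that
all of them decay faster than any power of \<open>\<xi>\<close> (\<open>profile_ft_decay\<close>); the second makes them Lipschitz in \<open>c\<close>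
with the same decay. Since the nonlinearity is also a combination of \<open>P\<close>, \<open>P ^ 2\<close> and \<open>P ^ 3\<close>, the equation becomes an
ordinary differential equation in time for each frequency \<open>\<xi>\<close> (\<open>amp_evolution\<close>), and the
error of a Riemann sum in Duhamel's formula is estimated separately at each \<open>\<xi>\<close>
(\<open>pert_solution_from_fourier\<close>).

The free group is defined by choosing a function with a prescribed Fourier transform, where the
transform is an \<open>L2\<close> limit of truncated integrals. Three facts about this transform are therefore
proved first: it is unique up to null sets, it agrees with the Fourier integral on functions that are integrable and square
integrable, and every bounded continuous integrable function is the transform of some
square integrable function (\<open>ex_inverse_fourier\<close>). They follow from Plancherel's identity, which is obtained by averaging against
Gaussians.\<close>

section \<open>The Fourier integral of integrable functions\<close>

text \<open>The pointwise Fourier integral. Unlike \<open>fourier\<close>, it is a canonical representative, which makes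
  pointwise estimates in \<open>\<xi>\<close> meaningful.\<close>

definition ft :: "(real \<Rightarrow> complex) \<Rightarrow> real \<Rightarrow> complex" where
  "ft f \<xi> = (LINT x|lborel. cis (-(x * \<xi>)) * f x)"

lemma measurable_cis [measurable]: "cis \<in> borel_measurable borel"
  by (intro borel_measurable_continuous_onI continuous_intros)

lemma measurable_cnj [measurable]: "cnj \<in> borel_measurable borel"
  by (intro borel_measurable_continuous_onI continuous_intros)

lemma integrable_cis_mult:
  assumes "integrable lborel f" and [measurable]: "g \<in> borel_measurable borel"
  shows "integrable lborel (\<lambda>x. cis (g x) * f x)"
  using borel_measurable_integrable[OF assms(1)]
  by (intro Bochner_Integration.integrable_bound[OF assms(1)]) (auto simp: norm_mult)

lemma cmod_ft_le:
  "cmod (ft f \<xi>) \<le> (LINT x|lborel. cmod (f x))"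
proof -
  have "cmod (ft f \<xi>) \<le> (LINT x|lborel. cmod (cis (-(x * \<xi>)) * f x))"
    unfolding ft_def by (rule integral_norm_bound)
  then show ?thesis by (simp add: norm_mult)
qed

lemma continuous_ft:
  assumes "integrable lborel f"
  shows "continuous_on A (ft f)"
proof -
  have "isCont (ft f) \<xi>" for \<xi>
    unfolding continuous_at_sequentially o_def
  proof (intro allI impI)
    fix X :: "nat \<Rightarrow> real" assume X: "X \<longlonglongrightarrow> \<xi>"
    note [measurable] = borel_measurable_integrable[OF assms]
    show "(\<lambda>n. ft f (X n)) \<longlonglongrightarrow> ft f \<xi>"
      unfolding ft_def
    proof (rule integral_dominated_convergence)
      show "integrable lborel (\<lambda>x. cmod (f x))" using assms by simp
      show "AE x in lborel. (\<lambda>n. cis (-(x * X n)) * f x) \<longlonglongrightarrow> cis (-(x * \<xi>)) * f x"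
        using X by (intro AE_I2 tendsto_intros) 
    qed (auto simp: norm_mult)
  qed
  then show ?thesis by (simp add: continuous_at_imp_continuous_on)
qed

lemma measurable_ft:
  assumes "integrable lborel f"
  shows "ft f \<in> borel_measurable borel"
  by (intro borel_measurable_continuous_onI continuous_ft assms)

text \<open>Fubini's theorem: both sides are the double integral of \<open>cis (-(x * \<xi>)) * f x * g \<xi>\<close>.\<close>

lemma ft_mult_formula:
  assumes f: "integrable lborel f" and g: "integrable lborel g"
  shows "(LINT \<xi>|lborel. ft f \<xi> * g \<xi>) = (LINT x|lborel. f x * ft g x)"
proof -
  note [measurable] = borel_measurable_integrable[OF f] borel_measurable_integrable[OF g]
  have "integrable (lborel \<Otimes>\<^sub>M lborel) (\<lambda>(x, \<xi>). cis (-(x * \<xi>)) * f x * g \<xi>)"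
  proof (rule lborel_pair.Fubini_integrable)
    show "(\<lambda>(x, \<xi>). cis (-(x * \<xi>)) * f x * g \<xi>) \<in> borel_measurable (lborel \<Otimes>\<^sub>M lborel)"
      by measurable
    show "integrable lborel (\<lambda>x. LINT y|lborel. norm (case (x, y) of (x, \<xi>) \<Rightarrow> cis (-(x * \<xi>)) * f x * g \<xi>))"
      using f by (simp add: norm_mult)
    show "AE x in lborel. integrable lborel (\<lambda>y. case (x, y) of (x, \<xi>) \<Rightarrow> cis (-(x * \<xi>)) * f x * g \<xi>)"
    proof (rule AE_I2)
      fix x
      show "integrable lborel (\<lambda>y. case (x, y) of (x, \<xi>) \<Rightarrow> cis (-(x * \<xi>)) * f x * g \<xi>)"
        using integrable_mult_right[OF integrable_cis_mult[OF g, of "\<lambda>y. -(x*y)"], of "f x"]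
        by (simp add: mult_ac)
    qed
  qed
  then have "(LINT y|lborel. LINT x|lborel. cis (-(x * y)) * f x * g y)
      = (LINT x|lborel. LINT y|lborel. cis (-(x * y)) * f x * g y)"
    by (rule lborel_pair.Fubini_integral)
  moreover have "(LINT x|lborel. cis (-(x * y)) * f x * g y) = ft f y * g y" for y
    unfolding ft_def by simp
  moreover have "(LINT y|lborel. cis (-(x * y)) * f x * g y) = f x * ft g x" for x
  proof -
    have "(LINT y|lborel. cis (-(x * y)) * f x * g y) = (LINT y|lborel. f x * (cis (-(y * x)) * g y))"
      by (intro Bochner_Integration.integral_cong) (auto simp: mult_ac)
    then show ?thesis unfolding ft_def by simp
  qed
  ultimately show ?thesis by (simp only:)
qed

lemma ft_cis_mult: "ft (\<lambda>\<xi>. cis (x * \<xi>) * g \<xi>) y = ft g (y - x)"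
  unfolding ft_def
  by (intro Bochner_Integration.integral_cong) (auto simp: cis_mult algebra_simps simp flip: mult.assoc)

lemma ft_shift: "ft (\<lambda>x. f (x - y)) \<xi> = cis (- (y * \<xi>)) * ft f \<xi>"
proof -
  have "ft (\<lambda>x. f (x - y)) \<xi> = (LINT x|lborel. cis (- ((y + 1 * x) * \<xi>)) * f (y + 1 * x - y))"
    unfolding ft_def by (subst lborel_integral_real_affine[of 1 _ y]) auto
  also have "\<dots> = (LINT x|lborel. cis (- (y * \<xi>)) * (cis (- (x * \<xi>)) * f x))"
    by (intro Bochner_Integration.integral_cong refl) (simp add: cis_mult algebra_simps flip: mult.assoc)
  finally show ?thesis unfolding ft_def by simp
qed

lemma ft_lincomb:
  assumes "integrable lborel f" "integrable lborel g"
  shows "ft (\<lambda>x. a * f x + b * g x) \<xi> = a * ft f \<xi> + b * ft g \<xi>"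
proof -
  have "ft (\<lambda>x. a * f x + b * g x) \<xi> = (LINT x|lborel. a * (cis (-(x * \<xi>)) * f x) + b * (cis (-(x * \<xi>)) * g x))"
    unfolding ft_def by (simp add: algebra_simps)
  also have "\<dots> = a * ft f \<xi> + b * ft g \<xi>"
    unfolding ft_def using integrable_cis_mult[OF assms(1), of "\<lambda>x. -(x*\<xi>)"] integrable_cis_mult[OF assms(2), of "\<lambda>x. -(x*\<xi>)"]
    by (subst Bochner_Integration.integral_add) auto
  finally show ?thesis .
qed

lemma norm_integral_le_nn_integral:
  fixes f :: "'a \<Rightarrow> 'b::{banach, second_countable_topology}"
  shows "ennreal (norm (LINT x|M. f x)) \<le> (\<integral>\<^sup>+x. ennreal (norm (f x)) \<partial>M)"
  by (cases "integrable M f") (auto simp: integral_norm_bound_ennreal not_integrable_integral_eq)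

section \<open>Gaussian means and the Plancherel identity\<close>

lemma integrable_gaussian:
  assumes "\<delta> > 0"
  shows "integrable lborel (\<lambda>\<xi>. exp (-(\<delta> * \<xi>)\<^sup>2 / 2) :: real)"
proof -
  have "integrable lborel (\<lambda>x. sqrt (2 * pi) * std_normal_density (0 + \<delta> * x))"
    using assms by (intro integrable_mult_right lborel_integrable_real_affine) auto
  then show ?thesis by (simp add: std_normal_density_def)
qed

lemma ft_gaussian:
  assumes "\<delta> > 0"
  shows "ft (\<lambda>\<xi>. of_real (exp (-(\<delta> * \<xi>)\<^sup>2 / 2))) z
     = of_real (2 * pi / \<delta> * std_normal_density (z / \<delta>))"
proof -
  have std: "(LINT u|lborel. of_real (std_normal_density u) * cis (t * u)) = complex_of_real (exp (-(t^2)/2))" for t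
  proof -
    have "char std_normal_distribution t = complex_of_real (exp (-(t^2)/2))"
      by (simp add: char_std_normal_distribution)
    moreover have "char std_normal_distribution t = (LINT u|lborel. of_real (std_normal_density u) * cis (t * u))"
      unfolding char_def
      by (subst integral_density) (auto simp: scaleR_conv_of_real cis_conv_exp)
    ultimately show ?thesis by simp
  qed
  have "ft (\<lambda>\<xi>. of_real (exp (-(\<delta> * \<xi>)\<^sup>2 / 2))) z
     = (LINT \<xi>|lborel. cis (-(\<xi> * z)) * of_real (exp (-(\<delta> * \<xi>)\<^sup>2 / 2)))"
    by (simp add: ft_def)
  also have "\<dots> = \<bar>1/\<delta>\<bar> *\<^sub>R (LINT u|lborel. cis (-((0 + (1/\<delta>) * u) * z)) * of_real (exp (-(\<delta> * (0 + (1/\<delta>) * u))\<^sup>2 / 2)))"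
    using assms by (intro lborel_integral_real_affine) auto
  also have "(LINT u|lborel. cis (-((0 + (1/\<delta>) * u) * z)) * of_real (exp (-(\<delta> * (0 + (1/\<delta>) * u))\<^sup>2 / 2)))
    = (LINT u|lborel. of_real (sqrt (2*pi)) * (of_real (std_normal_density u) * cis ((- z/\<delta>) * u)))"
    using assms by (intro Bochner_Integration.integral_cong) (auto simp: std_normal_density_def mult_ac)
  also have "\<dots> = of_real (sqrt (2*pi)) * complex_of_real (exp (-((- z/\<delta>)^2)/2))"
    by (subst integral_mult_right_zero) (simp only: std)
  finally have e: "ft (\<lambda>\<xi>. of_real (exp (-(\<delta> * \<xi>)\<^sup>2 / 2))) z
      = \<bar>1/\<delta>\<bar> *\<^sub>R (of_real (sqrt (2*pi)) * complex_of_real (exp (-((- z/\<delta>)^2)/2)))" .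
  have s: "2 * pi / sqrt (2*pi) = sqrt (2*pi)" by (simp add: real_div_sqrt)
  have "\<bar>1/\<delta>\<bar> * (sqrt (2*pi) * exp (-((- z/\<delta>)^2)/2)) = 2 * pi / \<delta> * std_normal_density (z / \<delta>)"
    using assms by (subst s[symmetric]) (simp add: std_normal_density_def field_simps)
  then show ?thesis unfolding e scaleR_conv_of_real by (metis of_real_mult)
qed

text \<open>The source of all \<open>L2\<close> information on \<open>ft\<close>. The Gaussian weight makes the left side absolutely
  convergent, so the multiplication formula can be applied twice: once to move one transform off
  \<open>f\<close>, and once to evaluate the transform of the remaining factor. The transform of the
  weight is a Gaussian of width \<open>\<delta>\<close> and mass \<open>2 * pi\<close>, which turns the right side into a local average
  of the autocorrelation of \<open>f\<close>.\<close>

lemma gaussian_mean_ft_sq: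
  assumes f: "integrable lborel f" and d: "\<delta> > 0"
  shows "(LINT \<xi>|lborel. of_real ((cmod (ft f \<xi>))\<^sup>2 * exp (-(\<delta> * \<xi>)\<^sup>2 / 2)))
    = of_real (2 * pi) * (LINT x|lborel. f x * (LINT u|lborel. cnj (f (x + \<delta> * u)) * of_real (std_normal_density u)))"
proof -
  note [measurable] = borel_measurable_integrable[OF f] measurable_ft[OF f]
  define w where "w \<xi> = complex_of_real (exp (-(\<delta> * \<xi>)\<^sup>2 / 2))" for \<xi>
  have w: "integrable lborel w" unfolding w_def using integrable_gaussian[OF d] by simp
  note [measurable] = borel_measurable_integrable[OF w]
  have cw: "cnj (w \<xi>) = w \<xi>" for \<xi> by (simp add: w_def)
  have g: "integrable lborel (\<lambda>\<xi>. cnj (ft f \<xi>) * w \<xi>)"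
  proof (rule Bochner_Integration.integrable_bound)
    show "integrable lborel (\<lambda>\<xi>. (LINT x|lborel. cmod (f x)) * cmod (w \<xi>))" using w by auto
    show "AE x in lborel. cmod (cnj (ft f x) * w x) \<le> norm ((LINT x|lborel. cmod (f x)) * cmod (w x))"
      using cmod_ft_le[of f] by (auto simp: norm_mult intro!: mult_right_mono intro: order_trans[OF _ abs_ge_self])
  qed measurable
  have "(LINT \<xi>|lborel. of_real ((cmod (ft f \<xi>))\<^sup>2 * exp (-(\<delta> * \<xi>)\<^sup>2 / 2)))
      = (LINT \<xi>|lborel. ft f \<xi> * (cnj (ft f \<xi>) * w \<xi>))"
    by (intro Bochner_Integration.integral_cong refl)
       (simp only: w_def of_real_mult complex_norm_square mult.assoc)
  also have "\<dots> = (LINT x|lborel. f x * ft (\<lambda>\<xi>. cnj (ft f \<xi>) * w \<xi>) x)"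
    by (rule ft_mult_formula[OF f g])
  also have "\<dots> = (LINT x|lborel. of_real (2 * pi) * (f x * (LINT u|lborel. cnj (f (x + \<delta> * u)) * of_real (std_normal_density u))))"
  proof (intro Bochner_Integration.integral_cong refl)
    fix x
    have "ft (\<lambda>\<xi>. cnj (ft f \<xi>) * w \<xi>) x = (LINT \<xi>|lborel. cnj (ft f \<xi> * (cis (x * \<xi>) * w \<xi>)))"
      unfolding ft_def[of "\<lambda>\<xi>. cnj (ft f \<xi>) * w \<xi>"]
      by (intro Bochner_Integration.integral_cong refl) (simp add: cis_cnj cw mult_ac)
    also have "\<dots> = cnj (LINT \<xi>|lborel. ft f \<xi> * (cis (x * \<xi>) * w \<xi>))"
      by (rule Bochner_Integration.integral_cnj)
    also have "(LINT \<xi>|lborel. ft f \<xi> * (cis (x * \<xi>) * w \<xi>)) = (LINT y|lborel. f y * ft (\<lambda>\<xi>. cis (x * \<xi>) * w \<xi>) y)"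
      by (intro ft_mult_formula f integrable_cis_mult w) auto
    also have "\<dots> = (LINT y|lborel. f y * of_real (2 * pi / \<delta> * std_normal_density ((y - x) / \<delta>)))"
      unfolding ft_cis_mult unfolding w_def ft_gaussian[OF d] ..
    also have "\<dots> = \<bar>\<delta>\<bar> *\<^sub>R (LINT u|lborel. f (x + \<delta> * u) * of_real (2 * pi / \<delta> * std_normal_density ((x + \<delta> * u - x) / \<delta>)))"
      using d by (intro lborel_integral_real_affine) auto
    also have "\<dots> = (LINT u|lborel. \<bar>\<delta>\<bar> *\<^sub>R (f (x + \<delta> * u) * of_real (2 * pi / \<delta> * std_normal_density ((x + \<delta> * u - x) / \<delta>))))"
      by (rule integral_scaleR_right[symmetric])
    also have "\<dots> = (LINT u|lborel. of_real (2 * pi) * (f (x + \<delta> * u) * of_real (std_normal_density u)))"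
      using d by (intro Bochner_Integration.integral_cong refl) (simp add: scaleR_conv_of_real field_simps)
    also have "\<dots> = of_real (2 * pi) * (LINT u|lborel. f (x + \<delta> * u) * of_real (std_normal_density u))"
      by (rule integral_mult_right_zero)
    also have "cnj \<dots> = of_real (2 * pi) * (LINT u|lborel. cnj (f (x + \<delta> * u) * of_real (std_normal_density u)))"
      by (subst Bochner_Integration.integral_cnj) simp
    finally show "f x * ft (\<lambda>\<xi>. cnj (ft f \<xi>) * w \<xi>) x = of_real (2 * pi) * (f x * (LINT u|lborel. cnj (f (x + \<delta> * u)) * of_real (std_normal_density u)))"
      by simp
  qed
  also have "\<dots> = of_real (2 * pi) * (LINT x|lborel. f x * (LINT u|lborel. cnj (f (x + \<delta> * u)) * of_real (std_normal_density u)))"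
    by (rule integral_mult_right_zero)
  finally show ?thesis .
qed

text \<open>An extended real, so that it can be used before square integrability is known, and so that
  the convergence in \<open>has_fourier\<close> is convergence of \<open>l2sq\<close> to \<open>0\<close>.\<close>

definition l2sq :: "(real \<Rightarrow> complex) \<Rightarrow> ennreal" where
  "l2sq f = (\<integral>\<^sup>+x. ennreal ((cmod (f x))\<^sup>2) \<partial>lborel)"

text \<open>In the Gaussian average of the autocorrelation, \<open>2 * \<bar>f x\<bar> * \<bar>f (x + \<delta> * u)\<bar>\<close> is at most the sum of the two
  squares, and each of these integrates to \<open>l2sq f\<close> whatever the shift is.\<close>

lemma gaussian_mean_ft_sq_le:
  assumes f: "integrable lborel f" and d: "\<delta> > 0"
  shows "(\<integral>\<^sup>+\<xi>. ennreal ((cmod (ft f \<xi>))\<^sup>2 * exp (-(\<delta> * \<xi>)\<^sup>2 / 2)) \<partial>lborel) \<le> 2 * pi * l2sq f"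
proof -
  note [measurable] = borel_measurable_integrable[OF f] measurable_ft[OF f]
  let ?B = "LINT x|lborel. cmod (f x)"
  have i: "integrable lborel (\<lambda>\<xi>. (cmod (ft f \<xi>))\<^sup>2 * exp (-(\<delta> * \<xi>)\<^sup>2 / 2))"
  proof (rule Bochner_Integration.integrable_bound)
    show "integrable lborel (\<lambda>\<xi>. ?B\<^sup>2 * exp (-(\<delta> * \<xi>)\<^sup>2 / 2))" using integrable_gaussian[OF d] by auto
    show "AE x in lborel. norm ((cmod (ft f x))\<^sup>2 * exp (-(\<delta> * x)\<^sup>2 / 2)) \<le> norm (?B\<^sup>2 * exp (-(\<delta> * x)\<^sup>2 / 2))"
      using cmod_ft_le[of f] by (auto simp: norm_mult intro!: mult_right_mono power_mono)
  qed measurable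
  have shift: "(\<integral>\<^sup>+x. ennreal ((cmod (f (x + \<delta> * u)))\<^sup>2) \<partial>lborel) = l2sq f" for u
    unfolding l2sq_def
    using nn_integral_real_affine[where f="\<lambda>x. ennreal ((cmod (f x))\<^sup>2)" and c=1 and t="\<delta>*u"]
    by (simp add: add.commute)
  have "(\<integral>\<^sup>+\<xi>. ennreal ((cmod (ft f \<xi>))\<^sup>2 * exp (-(\<delta> * \<xi>)\<^sup>2 / 2)) \<partial>lborel)
      = ennreal (LINT \<xi>|lborel. (cmod (ft f \<xi>))\<^sup>2 * exp (-(\<delta> * \<xi>)\<^sup>2 / 2))"
    by (intro nn_integral_eq_integral i) auto
  also have "\<dots> = ennreal (cmod (LINT \<xi>|lborel. of_real ((cmod (ft f \<xi>))\<^sup>2 * exp (-(\<delta> * \<xi>)\<^sup>2 / 2))))"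
    by (simp del: of_real_mult add: integral_nonneg_AE)
  also have "\<dots> = ennreal (2 * pi * cmod (LINT x|lborel. f x * (LINT u|lborel. cnj (f (x + \<delta> * u)) * of_real (std_normal_density u))))"
    unfolding gaussian_mean_ft_sq[OF assms] by (simp add: norm_mult)
  also have "\<dots> = 2 * pi * ennreal (cmod (LINT x|lborel. f x * (LINT u|lborel. cnj (f (x + \<delta> * u)) * of_real (std_normal_density u))))"
    by (simp add: ennreal_mult)
  also have "\<dots> \<le> 2 * pi * l2sq f"
  proof (rule mult_left_mono)
    have "ennreal (cmod (LINT x|lborel. f x * (LINT u|lborel. cnj (f (x + \<delta> * u)) * of_real (std_normal_density u))))
       \<le> (\<integral>\<^sup>+x. ennreal (cmod (f x * (LINT u|lborel. cnj (f (x + \<delta> * u)) * of_real (std_normal_density u)))) \<partial>lborel)"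
      by (rule norm_integral_le_nn_integral)
    also have "\<dots> \<le> (\<integral>\<^sup>+x. \<integral>\<^sup>+u. ennreal (cmod (f x)) * ennreal (cmod (f (x + \<delta> * u)) * std_normal_density u) \<partial>lborel \<partial>lborel)"
    proof (rule nn_integral_mono)
      fix x
      have "ennreal (cmod (f x * (LINT u|lborel. cnj (f (x + \<delta> * u)) * of_real (std_normal_density u))))
        = ennreal (cmod (f x)) * ennreal (cmod (LINT u|lborel. cnj (f (x + \<delta> * u)) * of_real (std_normal_density u)))"
        by (simp add: norm_mult ennreal_mult)
      also have "\<dots> \<le> ennreal (cmod (f x)) * (\<integral>\<^sup>+u. ennreal (cmod (cnj (f (x + \<delta> * u)) * of_real (std_normal_density u))) \<partial>lborel)"
        by (intro mult_left_mono norm_integral_le_nn_integral) auto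
      also have "\<dots> = ennreal (cmod (f x)) * (\<integral>\<^sup>+u. ennreal (cmod (f (x + \<delta> * u)) * std_normal_density u) \<partial>lborel)"
        by (simp add: norm_mult)
      also have "\<dots> = (\<integral>\<^sup>+u. ennreal (cmod (f x)) * ennreal (cmod (f (x + \<delta> * u)) * std_normal_density u) \<partial>lborel)"
        by (rule nn_integral_cmult[symmetric]) measurable
      finally show "ennreal (cmod (f x * (LINT u|lborel. cnj (f (x + \<delta> * u)) * of_real (std_normal_density u))))
        \<le> (\<integral>\<^sup>+u. ennreal (cmod (f x)) * ennreal (cmod (f (x + \<delta> * u)) * std_normal_density u) \<partial>lborel)" .
    qed
    also have "\<dots> \<le> (\<integral>\<^sup>+x. \<integral>\<^sup>+u. ennreal (std_normal_density u / 2) * (ennreal ((cmod (f x))\<^sup>2) + ennreal ((cmod (f (x + \<delta> * u)))\<^sup>2)) \<partial>lborel \<partial>lborel)"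
    proof (intro nn_integral_mono)
      fix x u
      have "cmod (f x) * cmod (f (x + \<delta> * u)) \<le> ((cmod (f x))\<^sup>2 + (cmod (f (x + \<delta> * u)))\<^sup>2) / 2"
        using sum_squares_bound[of "cmod (f x)" "cmod (f (x + \<delta> * u))"] by (simp add: field_simps)
      from mult_right_mono[OF this, of "std_normal_density u"]
      have "cmod (f x) * (cmod (f (x + \<delta> * u)) * std_normal_density u) \<le> std_normal_density u / 2 * ((cmod (f x))\<^sup>2 + (cmod (f (x + \<delta> * u)))\<^sup>2)"
        by (simp add: mult_ac)
      then have "ennreal (cmod (f x) * (cmod (f (x + \<delta> * u)) * std_normal_density u))
        \<le> ennreal (std_normal_density u / 2 * ((cmod (f x))\<^sup>2 + (cmod (f (x + \<delta> * u)))\<^sup>2))"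
        by (rule ennreal_leI)
      then show "ennreal (cmod (f x)) * ennreal (cmod (f (x + \<delta> * u)) * std_normal_density u)
        \<le> ennreal (std_normal_density u / 2) * (ennreal ((cmod (f x))\<^sup>2) + ennreal ((cmod (f (x + \<delta> * u)))\<^sup>2))"
        by (subst (asm) ennreal_mult, simp, simp, subst (asm) ennreal_mult, simp, simp, subst (asm) ennreal_plus) simp_all
    qed
    also have "\<dots> = (\<integral>\<^sup>+u. \<integral>\<^sup>+x. ennreal (std_normal_density u / 2) * (ennreal ((cmod (f x))\<^sup>2) + ennreal ((cmod (f (x + \<delta> * u)))\<^sup>2)) \<partial>lborel \<partial>lborel)"
      by (rule lborel_pair.Fubini'[symmetric]) measurable
    also have "\<dots> = (\<integral>\<^sup>+u. ennreal (std_normal_density u / 2) * (l2sq f + l2sq f) \<partial>lborel)"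
      by (simp add: nn_integral_cmult nn_integral_add shift flip: l2sq_def)
    also have "\<dots> = (\<integral>\<^sup>+u. ennreal (std_normal_density u / 2) \<partial>lborel) * (l2sq f + l2sq f)"
      by (rule nn_integral_multc) measurable
    also have "(\<integral>\<^sup>+u. ennreal (std_normal_density u / 2) \<partial>lborel) = ennreal (1/2)"
      by (subst nn_integral_eq_integral) auto
    also have "ennreal (1/2) * (l2sq f + l2sq f) = l2sq f"
    proof -
      have "ennreal (1/2) * (l2sq f + l2sq f) = (ennreal (1/2) + ennreal (1/2)) * l2sq f"
        by (simp only: distrib_left distrib_right)
      also have "ennreal (1/2) + ennreal (1/2) = 1" by (subst ennreal_plus[symmetric]) auto
      finally show ?thesis by simp
    qed
    finally show "ennreal (cmod (LINT x|lborel. f x * (LINT u|lborel. cnj (f (x + \<delta> * u)) * of_real (std_normal_density u))))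
       \<le> l2sq f" .
  qed auto
  finally show ?thesis .
qed

text \<open>Fatou's lemma as the Gaussian weight tends to \<open>1\<close>. This half of the Plancherel identity is
  what controls the transforms of truncated functions, which are discontinuous.\<close>

lemma l2sq_ft_le:
  assumes f: "integrable lborel f"
  shows "l2sq (ft f) \<le> 2 * pi * l2sq f"
proof -
  note [measurable] = borel_measurable_integrable[OF f] measurable_ft[OF f]
  define d where "d n = 1 / real (Suc n)" for n
  have d: "d n > 0" "d \<longlonglongrightarrow> 0" for n
    using LIMSEQ_inverse_real_of_nat by (auto simp: d_def[abs_def] inverse_eq_divide)
  let ?h = "\<lambda>n \<xi>. ennreal ((cmod (ft f \<xi>))\<^sup>2 * exp (-(d n * \<xi>)\<^sup>2 / 2))"
  have lim: "(\<lambda>n. ?h n \<xi>) \<longlonglongrightarrow> ennreal ((cmod (ft f \<xi>))\<^sup>2)" for \<xi>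
  proof -
    have "(\<lambda>n. (cmod (ft f \<xi>))\<^sup>2 * exp (-(d n * \<xi>)\<^sup>2 / 2)) \<longlonglongrightarrow> (cmod (ft f \<xi>))\<^sup>2 * exp (-(0 * \<xi>)\<^sup>2 / 2)"
      by (intro tendsto_intros d) auto
    then show ?thesis by (simp add: tendsto_ennrealI)
  qed
  have "l2sq (ft f) = (\<integral>\<^sup>+\<xi>. liminf (\<lambda>n. ?h n \<xi>) \<partial>lborel)"
    unfolding l2sq_def using lim_imp_Liminf[OF _ lim] by simp
  also have "\<dots> \<le> liminf (\<lambda>n. integral\<^sup>N lborel (?h n))"
    by (intro nn_integral_liminf) measurable
  also have "\<dots> \<le> liminf (\<lambda>n. 2 * pi * l2sq f)"
    by (intro Liminf_mono always_eventually allI gaussian_mean_ft_sq_le f d)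
  also have "\<dots> = 2 * pi * l2sq f" by (simp add: Liminf_const)
  finally show ?thesis .
qed

lemma l2sq_eq_integral:
  assumes "integrable lborel (\<lambda>x. (cmod (f x))\<^sup>2)"
  shows "l2sq f = ennreal (LINT x|lborel. (cmod (f x))\<^sup>2)"
  unfolding l2sq_def by (intro nn_integral_eq_integral assms) auto

lemma L2_space_iff:
  "f \<in> L2_space \<longleftrightarrow> f \<in> borel_measurable borel \<and> l2sq f < \<infinity>"
  by (auto simp: L2_space_def l2sq_def integrable_iff_bounded)

lemma integrable_bounded_imp_L2:
  assumes f: "integrable lborel f" and B: "\<And>x. cmod (f x) \<le> B"
  shows "f \<in> L2_space"
proof -
  note [measurable] = borel_measurable_integrable[OF f]
  have "integrable lborel (\<lambda>x. (cmod (f x))\<^sup>2)"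
  proof (rule Bochner_Integration.integrable_bound)
    show "integrable lborel (\<lambda>x. B * cmod (f x))" using f by simp
    show "AE x in lborel. norm ((cmod (f x))\<^sup>2) \<le> norm (B * cmod (f x))"
      using B order_trans[OF norm_ge_zero B] 
      by (auto simp: power2_eq_square norm_mult intro!: mult_right_mono)
  qed measurable
  then show ?thesis by (simp add: L2_space_def)
qed

lemma ft_in_L2:
  assumes f: "integrable lborel f" and f2: "f \<in> L2_space"
  shows "ft f \<in> L2_space"
proof -
  have "l2sq f < \<infinity>" using f2 by (simp add: L2_space_iff)
  then have "2 * pi * l2sq f < \<infinity>" by (simp add: ennreal_mult_less_top)
  then show ?thesis
    using order_le_less_trans[OF l2sq_ft_le[OF f]] measurable_ft[OF f] by (simp add: L2_space_iff)
qed

text \<open>Boundedness and continuity let the Gaussian average of \<open>f\<close> around \<open>x\<close> converge to \<open>f x\<close> by dominated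
  convergence, so the identity is the limit of \<open>gaussian_mean_ft_sq\<close> as the Gaussian weight tends to \<open>1\<close>.\<close>

lemma plancherel:
  assumes f: "integrable lborel f" and cont: "continuous_on UNIV f" and B: "\<And>x. cmod (f x) \<le> B"
  shows "(LINT \<xi>|lborel. (cmod (ft f \<xi>))\<^sup>2) = 2 * pi * (LINT x|lborel. (cmod (f x))\<^sup>2)"
proof -
  note [measurable] = borel_measurable_integrable[OF f] measurable_ft[OF f]
  define d where "d n = 1 / real (Suc n)" for n
  have d: "d n > 0" "d \<longlonglongrightarrow> 0" for n
    using LIMSEQ_inverse_real_of_nat by (auto simp: d_def[abs_def] inverse_eq_divide)
  have f2: "f \<in> L2_space" by (rule integrable_bounded_imp_L2[OF f B])
  have i1: "integrable lborel (\<lambda>\<xi>. (cmod (ft f \<xi>))\<^sup>2)"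
    using ft_in_L2[OF f f2] by (simp add: L2_space_def)
  let ?l = "\<lambda>n. LINT \<xi>|lborel. of_real ((cmod (ft f \<xi>))\<^sup>2 * exp (-(d n * \<xi>)\<^sup>2 / 2)) :: complex"
  let ?F = "\<lambda>n x. (LINT u|lborel. cnj (f (x + d n * u)) * complex_of_real (std_normal_density u))"
  have B0: "0 \<le> B" using order_trans[OF norm_ge_zero B] .
  have l1: "?l \<longlonglongrightarrow> (LINT \<xi>|lborel. of_real ((cmod (ft f \<xi>))\<^sup>2))"
  proof (rule integral_dominated_convergence)
    show "integrable lborel (\<lambda>\<xi>. (cmod (ft f \<xi>))\<^sup>2)" by (rule i1)
    show "AE \<xi> in lborel. (\<lambda>n. complex_of_real ((cmod (ft f \<xi>))\<^sup>2 * exp (-(d n * \<xi>)\<^sup>2 / 2))) \<longlonglongrightarrow> of_real ((cmod (ft f \<xi>))\<^sup>2)"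
    proof (rule AE_I2)
      fix \<xi>
      have "(\<lambda>n. complex_of_real ((cmod (ft f \<xi>))\<^sup>2 * exp (-(d n * \<xi>)\<^sup>2 / 2))) \<longlonglongrightarrow> of_real ((cmod (ft f \<xi>))\<^sup>2 * exp (-(0 * \<xi>)\<^sup>2 / 2))"
        by (intro tendsto_intros d) auto
      then show "(\<lambda>n. complex_of_real ((cmod (ft f \<xi>))\<^sup>2 * exp (-(d n * \<xi>)\<^sup>2 / 2))) \<longlonglongrightarrow> of_real ((cmod (ft f \<xi>))\<^sup>2)"
        by simp
    qed
    show "AE \<xi> in lborel. cmod (complex_of_real ((cmod (ft f \<xi>))\<^sup>2 * exp (-(d n * \<xi>)\<^sup>2 / 2))) \<le> (cmod (ft f \<xi>))\<^sup>2" for n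
      by (auto simp: norm_mult norm_power intro!: mult_left_le)
  qed measurable
  have F1: "(\<lambda>n. ?F n x) \<longlonglongrightarrow> cnj (f x)" for x
  proof -
    have "(\<lambda>n. ?F n x) \<longlonglongrightarrow> (LINT u|lborel. cnj (f x) * complex_of_real (std_normal_density u))"
    proof (rule integral_dominated_convergence)
      show "integrable lborel (\<lambda>u. B * std_normal_density u)" by auto
      show "AE u in lborel. (\<lambda>n. cnj (f (x + d n * u)) * complex_of_real (std_normal_density u)) \<longlonglongrightarrow> cnj (f x) * complex_of_real (std_normal_density u)"
      proof (rule AE_I2)
        fix u
        have "(\<lambda>n. x + d n * u) \<longlonglongrightarrow> x + 0 * u" by (intro tendsto_intros d)
        then have "(\<lambda>n. f (x + d n * u)) \<longlonglongrightarrow> f x"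
          using continuous_on_tendsto_compose[OF cont, of "\<lambda>n. x + d n * u" x sequentially] by simp
        then show "(\<lambda>n. cnj (f (x + d n * u)) * complex_of_real (std_normal_density u)) \<longlonglongrightarrow> cnj (f x) * complex_of_real (std_normal_density u)"
          by (intro tendsto_intros)
      qed
      show "AE u in lborel. cmod (cnj (f (x + d n * u)) * complex_of_real (std_normal_density u)) \<le> B * std_normal_density u" for n
        using B by (auto simp: norm_mult intro!: mult_right_mono)
    qed measurable
    then show ?thesis by simp
  qed
  have Fb: "cmod (?F n x) \<le> B" for n x
  proof -
    have "cmod (?F n x) \<le> (LINT u|lborel. cmod (cnj (f (x + d n * u)) * complex_of_real (std_normal_density u)))"
      by (rule integral_norm_bound)
    also have "\<dots> \<le> (LINT u|lborel. B * std_normal_density u)"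
      using B B0 by (intro Bochner_Integration.integral_mono') (auto simp: norm_mult intro!: mult_right_mono)
    finally have "cmod (?F n x) \<le> (LINT u|lborel. B * std_normal_density u)" .
    then show ?thesis by simp
  qed
  have l2: "(\<lambda>n. LINT x|lborel. f x * ?F n x) \<longlonglongrightarrow> (LINT x|lborel. f x * cnj (f x))"
  proof (rule integral_dominated_convergence)
    show "integrable lborel (\<lambda>x. B * cmod (f x))" using f by simp
    show "AE x in lborel. (\<lambda>n. f x * ?F n x) \<longlonglongrightarrow> f x * cnj (f x)"
      by (intro AE_I2 tendsto_intros F1)
    show "AE x in lborel. cmod (f x * ?F n x) \<le> B * cmod (f x)" for n
      using mult_left_mono[OF Fb] by (intro AE_I2) (simp only: norm_mult mult.commute[of B] norm_ge_zero)
  qed measurable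
  have "?l \<longlonglongrightarrow> of_real (2 * pi) * (LINT x|lborel. f x * cnj (f x))"
    unfolding gaussian_mean_ft_sq[OF f d(1)] by (intro tendsto_intros l2)
  then have "(LINT \<xi>|lborel. complex_of_real ((cmod (ft f \<xi>))\<^sup>2)) = of_real (2 * pi) * (LINT x|lborel. f x * cnj (f x))"
    using l1 by (rule LIMSEQ_unique[symmetric])
  also have "(LINT x|lborel. f x * cnj (f x)) = (LINT x|lborel. complex_of_real ((cmod (f x))\<^sup>2))"
    by (simp only: complex_norm_square)
  finally have "complex_of_real (LINT \<xi>|lborel. (cmod (ft f \<xi>))\<^sup>2) = of_real (2 * pi * (LINT x|lborel. (cmod (f x))\<^sup>2))"
    by (simp only: integral_of_real of_real_mult integral_complex_of_real)
  then show ?thesis by (simp only: of_real_eq_iff)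
qed

section \<open>The Fourier transform on square integrable functions\<close>

lemma l2sq_lincomb_le:
  assumes [measurable]: "f \<in> borel_measurable borel" "g \<in> borel_measurable borel"
  shows "l2sq (\<lambda>x. a * f x + b * g x) \<le> ennreal (2 * (cmod a)\<^sup>2) * l2sq f + ennreal (2 * (cmod b)\<^sup>2) * l2sq g"
proof -
  have "l2sq (\<lambda>x. a * f x + b * g x) \<le> (\<integral>\<^sup>+x. ennreal (2 * (cmod a)\<^sup>2) * ennreal ((cmod (f x))\<^sup>2) + ennreal (2 * (cmod b)\<^sup>2) * ennreal ((cmod (g x))\<^sup>2) \<partial>lborel)"
    unfolding l2sq_def
  proof (rule nn_integral_mono)
    fix x
    have "(cmod (a * f x + b * g x))\<^sup>2 \<le> (cmod a * cmod (f x) + cmod b * cmod (g x))\<^sup>2"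
      by (intro power_mono order_trans[OF norm_triangle_ineq]) (auto simp: norm_mult)
    also have "\<dots> \<le> 2 * (cmod a)\<^sup>2 * (cmod (f x))\<^sup>2 + 2 * (cmod b)\<^sup>2 * (cmod (g x))\<^sup>2"
      using sum_squares_bound[of "cmod a * cmod (f x)" "cmod b * cmod (g x)"]
      by (simp add: power2_sum power_mult_distrib)
    finally show "ennreal ((cmod (a * f x + b * g x))\<^sup>2) \<le> ennreal (2 * (cmod a)\<^sup>2) * ennreal ((cmod (f x))\<^sup>2) + ennreal (2 * (cmod b)\<^sup>2) * ennreal ((cmod (g x))\<^sup>2)"
      by (subst ennreal_mult[symmetric], simp, simp, subst ennreal_mult[symmetric], simp, simp,
          subst ennreal_plus[symmetric], simp, simp, intro ennreal_leI) simp
  qed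
  also have "\<dots> = ennreal (2 * (cmod a)\<^sup>2) * l2sq f + ennreal (2 * (cmod b)\<^sup>2) * l2sq g"
    unfolding l2sq_def by (simp add: nn_integral_add nn_integral_cmult)
  finally show ?thesis .
qed

lemma L2_space_lincomb:
  assumes "f \<in> L2_space" "g \<in> L2_space"
  shows "(\<lambda>x. a * f x + b * g x) \<in> L2_space"
proof -
  have [measurable]: "f \<in> borel_measurable borel" "g \<in> borel_measurable borel"
    and "l2sq f < \<infinity>" "l2sq g < \<infinity>" using assms by (auto simp: L2_space_iff)
  then have "ennreal (2 * (cmod a)\<^sup>2) * l2sq f + ennreal (2 * (cmod b)\<^sup>2) * l2sq g < \<infinity>"
    by (simp add: ennreal_mult_less_top)
  from order_le_less_trans[OF l2sq_lincomb_le this] show ?thesis by (simp add: L2_space_iff)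
qed

text \<open>Truncation by multiplication, so that the truncated integral in \<open>has_fourier\<close> is the Fourier integral of
  an integrable function.\<close>

abbreviation cutoff :: "real \<Rightarrow> (real \<Rightarrow> complex) \<Rightarrow> real \<Rightarrow> complex" where
  "cutoff R f \<equiv> (\<lambda>x. indicator {-R..R} x * f x)"

lemma truncated_transform_eq:
  "(LINT x:{-R..R}|lborel. cis (-(x * \<xi>)) * f x) = ft (cutoff R f) \<xi>"
  unfolding set_lebesgue_integral_def ft_def
  by (intro Bochner_Integration.integral_cong) (auto simp: indicator_def)

lemma has_fourier_iff:
  "has_fourier f g \<longleftrightarrow> f \<in> L2_space \<and> g \<in> L2_space \<and>
     ((\<lambda>R. l2sq (\<lambda>\<xi>. g \<xi> - ft (cutoff R f) \<xi>)) \<longlongrightarrow> 0) at_top"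
  unfolding has_fourier_def truncated_transform_eq l2sq_def ..

lemma ennreal_squeeze_0:
  fixes f g :: "'a \<Rightarrow> ennreal"
  assumes "(g \<longlongrightarrow> 0) F" "\<And>x. f x \<le> g x"
  shows "(f \<longlongrightarrow> 0) F"
  by (rule tendsto_sandwich[OF _ _ tendsto_const assms(1)]) (simp_all add: assms(2))

lemma has_fourierD:
  assumes "has_fourier f g"
  shows "((\<lambda>R. l2sq (\<lambda>\<xi>. g \<xi> - ft (cutoff R f) \<xi>)) \<longlongrightarrow> 0) at_top"
  using assms by (simp add: has_fourier_iff)

lemma integrable_cutoff:
  assumes "f \<in> L2_space"
  shows "integrable lborel (cutoff R f)"
proof (rule Bochner_Integration.integrable_bound)
  have [measurable]: "f \<in> borel_measurable borel" using assms by (simp add: L2_space_iff)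
  show "cutoff R f \<in> borel_measurable lborel" by simp
  show "integrable lborel (\<lambda>x. indicator {-R..R} x + (cmod (f x))\<^sup>2)"
    using assms by (intro Bochner_Integration.integrable_add integrable_real_indicator)
      (auto simp: L2_space_def emeasure_lborel_Icc_eq)
  have "y \<le> 1 + y\<^sup>2" for y :: real
    using sum_squares_bound[of 1 y] by (simp add: power2_eq_square) (smt (verit) zero_le_square)
  then show "AE x in lborel. cmod (cutoff R f x) \<le> norm (indicator {-R..R} x + (cmod (f x))\<^sup>2)"
    by (auto simp: indicator_def norm_mult)
qed

lemma l2sq_cutoff_le: "l2sq (cutoff R f) \<le> l2sq f"
  unfolding l2sq_def by (intro nn_integral_mono) (auto simp: indicator_def)

lemma cutoff_in_L2:
  assumes "f \<in> L2_space"
  shows "cutoff R f \<in> L2_space"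
  using assms order_le_less_trans[OF l2sq_cutoff_le] by (auto simp: L2_space_iff)

text \<open>Two limits of the same truncated integrals in \<open>L2\<close> are at distance \<open>0\<close>.\<close>

lemma has_fourier_unique:
  assumes "has_fourier f g" "has_fourier f h"
  shows "AE \<xi> in lborel. g \<xi> = h \<xi>"
proof -
  let ?T = "\<lambda>R. ft (cutoff R f)"
  have [measurable]: "g \<in> borel_measurable borel" "h \<in> borel_measurable borel" "f \<in> borel_measurable borel"
    and f: "f \<in> L2_space" using assms by (auto simp: has_fourier_iff L2_space_iff)
  have [measurable]: "?T R \<in> borel_measurable borel" for R
    by (intro measurable_ft integrable_cutoff f)
  have "l2sq (\<lambda>\<xi>. g \<xi> - h \<xi>) \<le> 2 * l2sq (\<lambda>\<xi>. g \<xi> - ?T R \<xi>) + 2 * l2sq (\<lambda>\<xi>. h \<xi> - ?T R \<xi>)" for R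
    using l2sq_lincomb_le[of "\<lambda>\<xi>. g \<xi> - ?T R \<xi>" "\<lambda>\<xi>. h \<xi> - ?T R \<xi>" 1 "-1"] by simp
  moreover have "((\<lambda>R. 2 * l2sq (\<lambda>\<xi>. g \<xi> - ?T R \<xi>) + 2 * l2sq (\<lambda>\<xi>. h \<xi> - ?T R \<xi>)) \<longlongrightarrow> 2 * 0 + 2 * 0) at_top"
    by (intro tendsto_add ennreal_tendsto_cmult has_fourierD assms) simp_all
  ultimately have "l2sq (\<lambda>\<xi>. g \<xi> - h \<xi>) \<le> 2 * 0 + 2 * 0"
    by (intro tendsto_lowerbound[where F="at_top :: real filter"]) auto
  then have "(\<integral>\<^sup>+\<xi>. ennreal ((cmod (g \<xi> - h \<xi>))\<^sup>2) \<partial>lborel) = 0" by (simp add: l2sq_def)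
  then show ?thesis by (subst (asm) nn_integral_0_iff_AE) (auto simp: ennreal_eq_0_iff)
qed

lemma has_fourier_fourier: "has_fourier f g \<Longrightarrow> has_fourier f (fourier f)"
  unfolding fourier_def by (rule someI[of "has_fourier f"])

lemma has_fourier_AE_fourier: "has_fourier f g \<Longrightarrow> AE \<xi> in lborel. fourier f \<xi> = g \<xi>"
  by (rule has_fourier_unique[OF has_fourier_fourier])

lemma has_fourier_cong_AE:
  assumes "has_fourier f g" "AE \<xi> in lborel. g \<xi> = h \<xi>" and [measurable]: "h \<in> borel_measurable borel"
  shows "has_fourier f h"
proof -
  have e: "l2sq (\<lambda>\<xi>. h \<xi> - k \<xi>) = l2sq (\<lambda>\<xi>. g \<xi> - k \<xi>)" for k
    unfolding l2sq_def using assms(2) by (intro nn_integral_cong_AE) auto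
  have "l2sq h = l2sq g" using e[of "\<lambda>_. 0"] by simp
  then show ?thesis using assms(1) unfolding has_fourier_iff e by (simp add: L2_space_iff)
qed

lemma has_fourier_lincomb:
  assumes "has_fourier f1 g1" "has_fourier f2 g2"
  shows "has_fourier (\<lambda>x. a * f1 x + b * f2 x) (\<lambda>\<xi>. a * g1 \<xi> + b * g2 \<xi>)"
proof -
  have L: "f1 \<in> L2_space" "f2 \<in> L2_space" "g1 \<in> L2_space" "g2 \<in> L2_space"
    using assms by (auto simp: has_fourier_iff)
  then have [measurable]: "g1 \<in> borel_measurable borel" "g2 \<in> borel_measurable borel" by (auto simp: L2_space_iff)
  have [measurable]: "ft (cutoff R f1) \<in> borel_measurable borel" "ft (cutoff R f2) \<in> borel_measurable borel" for R
    by (intro measurable_ft integrable_cutoff L)+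
  let ?u = "\<lambda>R. ennreal (2 * (cmod a)\<^sup>2) * l2sq (\<lambda>\<xi>. g1 \<xi> - ft (cutoff R f1) \<xi>) + ennreal (2 * (cmod b)\<^sup>2) * l2sq (\<lambda>\<xi>. g2 \<xi> - ft (cutoff R f2) \<xi>)"
  have "cutoff R (\<lambda>x. a * f1 x + b * f2 x) = (\<lambda>x. a * cutoff R f1 x + b * cutoff R f2 x)" for R
    by (auto simp: algebra_simps)
  then have "ft (cutoff R (\<lambda>x. a * f1 x + b * f2 x)) \<xi> = a * ft (cutoff R f1) \<xi> + b * ft (cutoff R f2) \<xi>" for R \<xi>
    using ft_lincomb[OF integrable_cutoff[OF L(1)] integrable_cutoff[OF L(2)]] by simp
  then have "(\<lambda>\<xi>. a * g1 \<xi> + b * g2 \<xi> - ft (cutoff R (\<lambda>x. a * f1 x + b * f2 x)) \<xi>)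
     = (\<lambda>\<xi>. a * (g1 \<xi> - ft (cutoff R f1) \<xi>) + b * (g2 \<xi> - ft (cutoff R f2) \<xi>))" for R
    by (auto simp: algebra_simps)
  then have "l2sq (\<lambda>\<xi>. a * g1 \<xi> + b * g2 \<xi> - ft (cutoff R (\<lambda>x. a * f1 x + b * f2 x)) \<xi>) \<le> ?u R" for R
    by (simp add: l2sq_lincomb_le)
  note le = this
  have "(?u \<longlongrightarrow> ennreal (2 * (cmod a)\<^sup>2) * 0 + ennreal (2 * (cmod b)\<^sup>2) * 0) at_top"
    by (intro tendsto_add ennreal_tendsto_cmult has_fourierD assms) simp_all
  then have "(?u \<longlongrightarrow> 0) at_top" by simp
  from ennreal_squeeze_0[OF this le] have "((\<lambda>R. l2sq (\<lambda>\<xi>. a * g1 \<xi> + b * g2 \<xi> - ft (cutoff R (\<lambda>x. a * f1 x + b * f2 x)) \<xi>)) \<longlongrightarrow> 0) at_top"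
    .
  then show ?thesis using L unfolding has_fourier_iff by (auto intro: L2_space_lincomb)
qed

lemma has_fourier_diff:
  assumes "has_fourier f1 g1" "has_fourier f2 g2"
  shows "has_fourier (\<lambda>x. f1 x - f2 x) (\<lambda>\<xi>. g1 \<xi> - g2 \<xi>)"
  using has_fourier_lincomb[OF assms, of 1 "-1"] by simp

lemma has_fourier_0: "has_fourier (\<lambda>_. 0) (\<lambda>_. 0)"
  by (auto simp: has_fourier_iff L2_space_iff l2sq_def ft_def)

lemma has_fourier_sum:
  assumes "finite A" "\<And>i. i \<in> A \<Longrightarrow> has_fourier (f i) (g i)"
  shows "has_fourier (\<lambda>x. \<Sum>i\<in>A. c i * f i x) (\<lambda>\<xi>. \<Sum>i\<in>A. c i * g i \<xi>)"
  using assms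
proof (induction A rule: finite_induct)
  case empty then show ?case by (simp add: has_fourier_0)
next
  case (insert i A)
  then show ?case using has_fourier_lincomb[of "f i" "g i" _ _ "c i" 1] by simp
qed

lemma l2sq_cutoff_error_tendsto:
  assumes "f \<in> L2_space"
  shows "((\<lambda>R. l2sq (\<lambda>x. f x - cutoff R f x)) \<longlongrightarrow> 0) at_top"
proof -
  have [measurable]: "f \<in> borel_measurable borel" and i: "integrable lborel (\<lambda>x. (cmod (f x))\<^sup>2)"
    using assms by (auto simp: L2_space_def)
  have ev: "eventually (\<lambda>R. indicator {-R..R} x = (1::complex)) at_top" for x :: real
    using eventually_ge_at_top[of "\<bar>x\<bar>"] by eventually_elim (auto simp: indicator_def)
  have i2: "integrable lborel (\<lambda>x. (cmod (f x - cutoff R f x))\<^sup>2)" for R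
    using L2_space_lincomb[OF assms cutoff_in_L2[OF assms], of 1 "-1"] by (simp add: L2_space_def)
  have "((\<lambda>R. LINT x|lborel. (cmod (f x - cutoff R f x))\<^sup>2) \<longlongrightarrow> (LINT x|(lborel::real measure). 0)) at_top"
  proof (rule integral_dominated_convergence_at_top[OF _ _ i])
    show "AE x in lborel. ((\<lambda>R. (cmod (f x - cutoff R f x))\<^sup>2) \<longlongrightarrow> 0) at_top"
    proof (intro AE_I2 tendsto_eventually)
      fix x
      show "eventually (\<lambda>R. (cmod (f x - cutoff R f x))\<^sup>2 = 0) at_top"
        using ev[of x] by eventually_elim simp
    qed
  qed (auto simp: indicator_def)
  then show "((\<lambda>R. l2sq (\<lambda>x. f x - cutoff R f x)) \<longlongrightarrow> 0) at_top"
    unfolding l2sq_eq_integral[OF i2] using tendsto_ennrealI by fastforce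
qed

text \<open>The difference of the transform and a truncated transform is the transform of the tail,
  whose \<open>L2\<close> norm is controlled by \<open>l2sq_ft_le\<close>.\<close>

lemma has_fourier_ft:
  assumes f: "integrable lborel f" and f2: "f \<in> L2_space"
  shows "has_fourier f (ft f)"
proof -
  have e: "ft f \<xi> - ft (cutoff R f) \<xi> = ft (\<lambda>x. f x - cutoff R f x) \<xi>" for R \<xi>
    using ft_lincomb[OF f integrable_cutoff[OF f2], of 1 "-1"] by simp
  have le: "l2sq (\<lambda>\<xi>. ft f \<xi> - ft (cutoff R f) \<xi>) \<le> ennreal (2 * pi) * l2sq (\<lambda>x. f x - cutoff R f x)" for R
    unfolding e using f integrable_cutoff[OF f2] by (intro l2sq_ft_le) auto
  have "((\<lambda>R. ennreal (2 * pi) * l2sq (\<lambda>x. f x - cutoff R f x)) \<longlongrightarrow> ennreal (2*pi) * 0) at_top"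
    by (intro ennreal_tendsto_cmult l2sq_cutoff_error_tendsto f2) auto
  then have "((\<lambda>R. ennreal (2 * pi) * l2sq (\<lambda>x. f x - cutoff R f x)) \<longlongrightarrow> 0) at_top" by simp
  from ennreal_squeeze_0[OF this le] have "((\<lambda>R. l2sq (\<lambda>\<xi>. ft f \<xi> - ft (cutoff R f) \<xi>)) \<longlongrightarrow> 0) at_top" .
  then show ?thesis unfolding has_fourier_iff using f2 ft_in_L2[OF f f2] by simp
qed

text \<open>The inverse transform \<open>g\<close> is the reflected Fourier integral of \<open>\<phi>\<close>. To see that the truncated transforms of
  \<open>g\<close> converge to \<open>\<phi>\<close>, expand the square of the distance. The square of the truncated transform
  is bounded by \<open>l2sq_ft_le\<close>, and by the multiplication formula the cross term is exactly \<open>2 * pi\<close> times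
  the integral of the square of the truncated \<open>g\<close>. What remains is at most \<open>2 * pi\<close> times \<open>l2sq\<close> of the tail of \<open>g\<close>, once
  the norm of \<open>\<phi>\<close> has been replaced by that of \<open>g\<close> using \<open>plancherel\<close>.\<close>

lemma ex_inverse_fourier:
  assumes f: "integrable lborel \<phi>" and cont: "continuous_on UNIV \<phi>" and B: "\<And>x. cmod (\<phi> x) \<le> B"
  shows "\<exists>g. has_fourier g \<phi>"
proof -
  have f2: "\<phi> \<in> L2_space" by (rule integrable_bounded_imp_L2[OF f B])
  note [measurable] = borel_measurable_integrable[OF f] measurable_ft[OF f]
  define g where "g x = ft \<phi> (- x) / (2 * pi)" for x
  have i\<phi>: "integrable lborel (\<lambda>x. (cmod (\<phi> x))\<^sup>2)" using f2 by (simp add: L2_space_def)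
  have g_meas[measurable]: "g \<in> borel_measurable borel" unfolding g_def by measurable
  have ift: "integrable lborel (\<lambda>x. (cmod (ft \<phi> x))\<^sup>2)" using ft_in_L2[OF f f2] by (simp add: L2_space_def)
  have sq: "(cmod (g x))\<^sup>2 = (cmod (ft \<phi> (0 + (-1) * x)))\<^sup>2 / (2*pi)\<^sup>2" for x
    by (simp add: g_def norm_divide power_divide norm_mult)
  have ig: "integrable lborel (\<lambda>x. (cmod (g x))\<^sup>2)"
    unfolding sq by (intro Bochner_Integration.integrable_divide_zero lborel_integrable_real_affine ift impI) auto
  have g2: "g \<in> L2_space" using ig by (simp add: L2_space_def)
  have norm_g: "(LINT x|lborel. (cmod (g x))\<^sup>2) * (2 * pi) = (LINT x|lborel. (cmod (\<phi> x))\<^sup>2)"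
  proof -
    have "(LINT x|lborel. (cmod (g x))\<^sup>2) = (LINT x|lborel. (cmod (ft \<phi> (0 + (-1) * x)))\<^sup>2) / (2*pi)\<^sup>2"
      unfolding sq by simp
    also have "(LINT x|lborel. (cmod (ft \<phi> (0 + (-1) * x)))\<^sup>2) = (LINT x|lborel. (cmod (ft \<phi> x))\<^sup>2)"
      using lborel_integral_real_affine[of "-1" "\<lambda>x. (cmod (ft \<phi> x))\<^sup>2" 0] by simp
    also have "\<dots> = 2 * pi * (LINT x|lborel. (cmod (\<phi> x))\<^sup>2)" by (rule plancherel[OF f cont B])
    finally show ?thesis by (simp add: power2_eq_square)
  qed
  have bound: "l2sq (\<lambda>\<xi>. \<phi> \<xi> - ft (cutoff R g) \<xi>) \<le> ennreal (2 * pi) * l2sq (\<lambda>x. g x - cutoff R g x)" for R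
  proof -
    let ?g = "cutoff R g"
    have ic: "integrable lborel ?g" and c2: "?g \<in> L2_space"
      by (intro integrable_cutoff g2, intro cutoff_in_L2 g2)
    have t2: "ft ?g \<in> L2_space" by (rule ft_in_L2[OF ic c2])
    note [measurable] = measurable_ft[OF ic]
    define P where "P = (LINT x|lborel. (cmod (\<phi> x))\<^sup>2)"
    define N where "N = (LINT x|lborel. (cmod (?g x))\<^sup>2)"
    have it: "integrable lborel (\<lambda>x. (cmod (ft ?g x))\<^sup>2)" using t2 by (simp add: L2_space_def)
    have ig': "integrable lborel (\<lambda>x. (cmod (?g x))\<^sup>2)" using c2 by (simp add: L2_space_def)
    have T: "(LINT x|lborel. (cmod (ft ?g x))\<^sup>2) \<le> 2 * pi * N"
    proof -
      have "ennreal (LINT x|lborel. (cmod (ft ?g x))\<^sup>2) \<le> ennreal (2 * pi) * ennreal N"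
        using l2sq_ft_le[OF ic] unfolding l2sq_eq_integral[OF it] l2sq_eq_integral[OF ig'] N_def by simp
      then show ?thesis by (subst (asm) ennreal_mult[symmetric]) (auto simp: N_def)
    qed
    have icn: "integrable lborel (\<lambda>\<xi>. cnj (\<phi> \<xi>))" using f by simp
    have ip: "integrable lborel (\<lambda>\<xi>. cnj (\<phi> \<xi>) * ft ?g \<xi>)"
    proof (rule Bochner_Integration.integrable_bound)
      show "integrable lborel (\<lambda>\<xi>. (LINT x|lborel. cmod (?g x)) * cmod (\<phi> \<xi>))" using f by simp
      show "AE x in lborel. cmod (cnj (\<phi> x) * ft ?g x) \<le> norm ((LINT x|lborel. cmod (?g x)) * cmod (\<phi> x))"
        using cmod_ft_le[of ?g] by (auto simp: norm_mult mult.commute[of "cmod (\<phi> _)"]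
            intro!: mult_right_mono intro: order_trans[OF _ abs_ge_self])
    qed measurable
    have ftc: "ft (\<lambda>\<xi>. cnj (\<phi> \<xi>)) x = of_real (2 * pi) * cnj (g x)" for x
    proof -
      have "ft (\<lambda>\<xi>. cnj (\<phi> \<xi>)) x = (LINT \<xi>|lborel. cnj (cis (-(\<xi> * (- x))) * \<phi> \<xi>))"
        unfolding ft_def by (simp add: cis_cnj)
      also have "\<dots> = cnj (ft \<phi> (- x))" unfolding ft_def by (rule Bochner_Integration.integral_cnj)
      finally show ?thesis by (simp add: g_def)
    qed
    have "(LINT \<xi>|lborel. cnj (\<phi> \<xi>) * ft ?g \<xi>) = (LINT x|lborel. ft (\<lambda>\<xi>. cnj (\<phi> \<xi>)) x * ?g x)"
      by (rule ft_mult_formula[OF icn ic, symmetric])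
    also have "\<dots> = (LINT x|lborel. complex_of_real (2 * pi * (cmod (?g x))\<^sup>2))"
      unfolding ftc
      by (intro Bochner_Integration.integral_cong refl)
         (auto simp: indicator_def complex_norm_square simp del: of_real_power)
    also have "\<dots> = of_real (2 * pi * N)"
      unfolding N_def by (subst integral_complex_of_real) simp
    finally have cross: "(LINT \<xi>|lborel. cnj (\<phi> \<xi>) * ft ?g \<xi>) = of_real (2 * pi * N)" .
    define r where "r \<xi> = Re (cnj (\<phi> \<xi>) * ft ?g \<xi>)" for \<xi>
    have ir: "integrable lborel r" unfolding r_def by (rule integrable_Re[OF ip])
    \<comment> \<open>The square of the distance, with \<open>r\<close> as the cross term.\<close>
    have exp: "(cmod (\<phi> \<xi> - ft ?g \<xi>))\<^sup>2 = (cmod (\<phi> \<xi>))\<^sup>2 + (cmod (ft ?g \<xi>))\<^sup>2 - 2 * r \<xi>" for \<xi>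
      unfolding cmod_power2 r_def by (simp add: power2_eq_square algebra_simps)
    have "(LINT \<xi>|lborel. (cmod (\<phi> \<xi> - ft ?g \<xi>))\<^sup>2) = P + (LINT x|lborel. (cmod (ft ?g x))\<^sup>2) - 2 * (LINT \<xi>|lborel. r \<xi>)"
      unfolding exp P_def using i\<phi> it ir by simp
    also have "(LINT \<xi>|lborel. r \<xi>) = 2 * pi * N"
      unfolding r_def by (subst integral_Re[OF ip]) (simp only: cross Re_complex_of_real)
    also have "P + (LINT x|lborel. (cmod (ft ?g x))\<^sup>2) - 2 * (2 * pi * N) \<le> P - 2 * pi * N"
      using T by linarith
    also have "\<dots> = 2 * pi * ((LINT x|lborel. (cmod (g x))\<^sup>2) - N)"
      unfolding P_def norm_g[symmetric] by (simp add: algebra_simps)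
    also have "(LINT x|lborel. (cmod (g x))\<^sup>2) - N = (LINT x|lborel. (cmod (g x))\<^sup>2 - (cmod (?g x))\<^sup>2)"
      unfolding N_def by (rule Bochner_Integration.integral_diff[OF ig ig', symmetric])
    also have "\<dots> = (LINT x|lborel. (cmod (g x - ?g x))\<^sup>2)"
      by (intro Bochner_Integration.integral_cong refl) (auto simp: indicator_def)
    finally have le: "(LINT \<xi>|lborel. (cmod (\<phi> \<xi> - ft ?g \<xi>))\<^sup>2) \<le> 2 * pi * (LINT x|lborel. (cmod (g x - ?g x))\<^sup>2)" .
    have d1: "(\<lambda>\<xi>. \<phi> \<xi> - ft ?g \<xi>) \<in> L2_space" using L2_space_lincomb[OF f2 t2, of 1 "-1"] by simp
    have d2: "(\<lambda>\<xi>. g \<xi> - ?g \<xi>) \<in> L2_space" using L2_space_lincomb[OF g2 c2, of 1 "-1"] by simp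
    have "l2sq (\<lambda>\<xi>. \<phi> \<xi> - ft ?g \<xi>) = ennreal (LINT \<xi>|lborel. (cmod (\<phi> \<xi> - ft ?g \<xi>))\<^sup>2)"
      by (rule l2sq_eq_integral) (use d1 in \<open>simp add: L2_space_def\<close>)
    also have "\<dots> \<le> ennreal (2 * pi * (LINT x|lborel. (cmod (g x - ?g x))\<^sup>2))" by (rule ennreal_leI[OF le])
    also have "\<dots> = ennreal (2 * pi) * ennreal (LINT x|lborel. (cmod (g x - ?g x))\<^sup>2)"
      by (rule ennreal_mult) simp_all
    also have "ennreal (LINT x|lborel. (cmod (g x - ?g x))\<^sup>2) = l2sq (\<lambda>x. g x - ?g x)"
      by (rule l2sq_eq_integral[symmetric]) (use d2 in \<open>simp add: L2_space_def\<close>)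
    finally show ?thesis .
  qed
  have "((\<lambda>R. ennreal (2 * pi) * l2sq (\<lambda>x. g x - cutoff R g x)) \<longlongrightarrow> ennreal (2*pi) * 0) at_top"
    by (intro ennreal_tendsto_cmult l2sq_cutoff_error_tendsto g2) auto
  then have "((\<lambda>R. ennreal (2 * pi) * l2sq (\<lambda>x. g x - cutoff R g x)) \<longlongrightarrow> 0) at_top" by simp
  then have "((\<lambda>R. l2sq (\<lambda>\<xi>. \<phi> \<xi> - ft (cutoff R g) \<xi>)) \<longlongrightarrow> 0) at_top"
    by (rule ennreal_squeeze_0) (rule bound)
  then have "has_fourier g \<phi>" unfolding has_fourier_iff using f2 g2 by simp
  then show ?thesis by (rule exI[of _ g])
qed

section \<open>Sobolev norms and functions dominated by a Lorentzian\<close>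

text \<open>Membership in the Sobolev space and its norm may be computed from any representative of the
  transform, in particular from an explicit one.\<close>

lemma Hs_iff:
  assumes "has_fourier f g"
  shows "f \<in> Hs s \<longleftrightarrow> integrable lborel (\<lambda>\<xi>. (1 + \<xi>\<^sup>2) powr s * (cmod (g \<xi>))\<^sup>2)"
proof -
  have "AE \<xi> in lborel. fourier f \<xi> = g \<xi>" by (rule has_fourier_AE_fourier[OF assms])
  moreover have [measurable]: "g \<in> borel_measurable borel" "fourier f \<in> borel_measurable borel"
    using assms has_fourier_fourier[OF assms] by (auto simp: has_fourier_iff L2_space_iff)
  ultimately have "integrable lborel (\<lambda>\<xi>. (1 + \<xi>\<^sup>2) powr s * (cmod (fourier f \<xi>))\<^sup>2)
     \<longleftrightarrow> integrable lborel (\<lambda>\<xi>. (1 + \<xi>\<^sup>2) powr s * (cmod (g \<xi>))\<^sup>2)"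
    by (intro integrable_cong_AE) auto
  then show ?thesis using assms by (simp add: Hs_def has_fourier_iff)
qed

lemma Hs_norm_eq:
  assumes "has_fourier f g"
  shows "Hs_norm s f = sqrt (1 / (2 * pi) * (LINT \<xi>|lborel. (1 + \<xi>\<^sup>2) powr s * (cmod (g \<xi>))\<^sup>2))"
proof -
  have "AE \<xi> in lborel. fourier f \<xi> = g \<xi>" by (rule has_fourier_AE_fourier[OF assms])
  moreover have [measurable]: "g \<in> borel_measurable borel" "fourier f \<in> borel_measurable borel"
    using assms has_fourier_fourier[OF assms] by (auto simp: has_fourier_iff L2_space_iff)
  ultimately have "(LINT \<xi>|lborel. (1 + \<xi>\<^sup>2) powr s * (cmod (fourier f \<xi>))\<^sup>2)
     = (LINT \<xi>|lborel. (1 + \<xi>\<^sup>2) powr s * (cmod (g \<xi>))\<^sup>2)"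
    by (intro integral_cong_AE) auto
  then show ?thesis by (simp add: Hs_norm_def)
qed

lemma Hs_norm_nonneg: "0 \<le> Hs_norm s f"
  unfolding Hs_norm_def by (intro real_sqrt_ge_zero mult_nonneg_nonneg integral_nonneg_AE) auto

lemma lorentzian:
  shows integrable_lorentzian: "integrable lborel (\<lambda>x::real. K / (1 + x\<^sup>2))"
    and integral_lorentzian: "(LINT x|lborel. K / (1 + x\<^sup>2)) = K * pi"
proof -
  have u: "einterval (-\<infinity>) \<infinity> = (UNIV::real set)" by (auto simp: einterval_def)
  have 1: "integrable lborel (\<lambda>x::real. inverse (1 + x\<^sup>2))"
    using integrable_inverse_1_plus_square by (simp add: u set_integrable_def)
  have 2: "(LINT x|lborel. inverse (1 + x\<^sup>2)) = (pi::real)"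
    using LBINT_inverse_1_plus_square by (simp add: interval_lebesgue_integral_def u set_lebesgue_integral_def)
  show "integrable lborel (\<lambda>x::real. K / (1 + x\<^sup>2))" "(LINT x|lborel. K / (1 + x\<^sup>2)) = K * pi"
    using 1 2 by (simp_all add: divide_inverse)
qed

lemma one_plus_sq_pos: "0 < 1 + (x::real)\<^sup>2" "1 + x\<^sup>2 \<noteq> 0" "1 \<le> 1 + x\<^sup>2"
  by (smt (verit) zero_le_power2)+

text \<open>Decay of order \<open>N\<close> with \<open>2 * N \<ge> s + 1\<close> absorbs the Sobolev weight and still leaves an
  integrable Lorentzian.\<close>

lemma Hs_weight_le:
  assumes "cmod z \<le> K / (1 + \<xi>\<^sup>2) ^ N" and N: "s + 1 \<le> 2 * real N"
  shows "(1 + \<xi>\<^sup>2) powr s * (cmod z)\<^sup>2 \<le> K\<^sup>2 / (1 + \<xi>\<^sup>2)"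
proof -
  let ?m = "1 + \<xi>\<^sup>2"
  note m = one_plus_sq_pos[of \<xi>]
  have "(cmod z)\<^sup>2 \<le> (K / ?m ^ N)\<^sup>2" using assms by (intro power_mono) auto
  also have "\<dots> = K\<^sup>2 / ?m powr (2 * real N)"
    using m powr_realpow[OF m(1), of "2 * N"] by (simp add: power_divide power_mult[symmetric] mult.commute)
  finally have 1: "(cmod z)\<^sup>2 \<le> K\<^sup>2 / ?m powr (2 * real N)" .
  have "?m powr s \<le> ?m powr (2 * real N - 1)" using m N by (intro powr_mono) auto
  also have "\<dots> = ?m powr (2 * real N) / ?m" using m by (simp add: powr_diff)
  finally have 2: "?m powr s \<le> ?m powr (2 * real N) / ?m" .
  have "?m powr s * (cmod z)\<^sup>2 \<le> (?m powr (2 * real N) / ?m) * (K\<^sup>2 / ?m powr (2 * real N))"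
    using 1 2 m by (intro mult_mono) auto
  also have "\<dots> = K\<^sup>2 / ?m" using m by (simp add: field_simps)
  finally show ?thesis .
qed

text \<open>The link from estimates at each frequency to the Sobolev norm: a pointwise bound on the transform by
  \<open>K / (1 + \<xi>\<^sup>2) ^ N\<close> is a bound by \<open>K\<close> on the norm, because the total mass \<open>pi\<close> of the Lorentzian is below the
  normalisation \<open>2 * pi\<close>.\<close>

lemma Hs_bound:
  assumes g: "has_fourier f g" and le: "\<And>\<xi>. cmod (g \<xi>) \<le> K / (1 + \<xi>\<^sup>2) ^ N"
    and N: "s + 1 \<le> 2 * real N"
  shows "f \<in> Hs s" and "Hs_norm s f \<le> K"
proof -
  have [measurable]: "g \<in> borel_measurable borel" using g by (auto simp: has_fourier_iff L2_space_iff)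
  have K: "0 \<le> K" using order_trans[OF norm_ge_zero le[of 0]] by simp
  have w: "(1 + \<xi>\<^sup>2) powr s * (cmod (g \<xi>))\<^sup>2 \<le> K\<^sup>2 / (1 + \<xi>\<^sup>2)" for \<xi>
    by (rule Hs_weight_le[OF le N])
  have i: "integrable lborel (\<lambda>\<xi>. (1 + \<xi>\<^sup>2) powr s * (cmod (g \<xi>))\<^sup>2)"
  proof (rule Bochner_Integration.integrable_bound[OF integrable_lorentzian[of "K\<^sup>2"]])
    show "AE x in lborel. norm ((1 + x\<^sup>2) powr s * (cmod (g x))\<^sup>2) \<le> norm (K\<^sup>2 / (1 + x\<^sup>2))"
    proof (rule AE_I2)
      fix x show "norm ((1 + x\<^sup>2) powr s * (cmod (g x))\<^sup>2) \<le> norm (K\<^sup>2 / (1 + x\<^sup>2))"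
        using w[of x] by (simp add: abs_of_nonneg)
    qed
  qed measurable
  then show "f \<in> Hs s" by (simp add: Hs_iff[OF g])
  have "(LINT \<xi>|lborel. (1 + \<xi>\<^sup>2) powr s * (cmod (g \<xi>))\<^sup>2) \<le> (LINT \<xi>|lborel. K\<^sup>2 / (1 + \<xi>\<^sup>2))"
    using w by (intro Bochner_Integration.integral_mono i integrable_lorentzian)
  also have "\<dots> = K\<^sup>2 * pi" by (rule integral_lorentzian)
  finally have "1 / (2 * pi) * (LINT \<xi>|lborel. (1 + \<xi>\<^sup>2) powr s * (cmod (g \<xi>))\<^sup>2) \<le> 1 / (2 * pi) * (K\<^sup>2 * pi)"
    by (intro mult_left_mono) auto
  also have "\<dots> \<le> K\<^sup>2" by simp
  finally have "sqrt (1 / (2 * pi) * (LINT \<xi>|lborel. (1 + \<xi>\<^sup>2) powr s * (cmod (g \<xi>))\<^sup>2)) \<le> sqrt (K\<^sup>2)"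
    by (rule real_sqrt_le_mono)
  then show "Hs_norm s f \<le> K" unfolding Hs_norm_eq[OF g] using K by simp
qed

lemma lorentz_dominated:
  fixes f :: "real \<Rightarrow> complex"
  assumes "continuous_on UNIV f" and le: "\<And>x. cmod (f x) \<le> K / (1 + x\<^sup>2)"
  shows "integrable lborel f" and "cmod (f x) \<le> K" and "f \<in> L2_space" and "cmod (ft f \<xi>) \<le> K * pi"
proof -
  have [measurable]: "f \<in> borel_measurable borel" using assms(1) by (rule borel_measurable_continuous_onI)
  have K: "0 \<le> K" using order_trans[OF norm_ge_zero le[of 0]] by simp
  show i: "integrable lborel f"
  proof (rule Bochner_Integration.integrable_bound[OF integrable_lorentzian[of K]])
    show "AE x in lborel. cmod (f x) \<le> norm (K / (1 + x\<^sup>2))"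
      using order_trans[OF le abs_ge_self] by auto
  qed measurable
  show B: "cmod (f x) \<le> K" for x
    using order_trans[OF le[of x]] K one_plus_sq_pos[of x] by (simp add: divide_le_eq_1 field_simps)
  show "f \<in> L2_space" by (rule integrable_bounded_imp_L2[OF i B])
  have "cmod (ft f \<xi>) \<le> (LINT x|lborel. cmod (f x))" by (rule cmod_ft_le)
  also have "\<dots> \<le> (LINT x|lborel. K / (1 + x\<^sup>2))"
    using i le by (intro Bochner_Integration.integral_mono integrable_lorentzian) auto
  finally show "cmod (ft f \<xi>) \<le> K * pi" by (simp add: integral_lorentzian)
qed

lemma lorentz_tendsto_0:
  fixes f :: "real \<Rightarrow> complex"
  assumes le: "\<And>x. cmod (f x) \<le> K / (1 + x\<^sup>2)"
  shows "(f \<longlongrightarrow> 0) at_top" "(f \<longlongrightarrow> 0) at_bot"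
proof -
  have "((\<lambda>x::real. K / (1 + x\<^sup>2)) \<longlongrightarrow> 0) at_top" "((\<lambda>x::real. K / (1 + x\<^sup>2)) \<longlongrightarrow> 0) at_bot"
    by real_asymp+
  note lims = this
  show "(f \<longlongrightarrow> 0) at_top" by (rule Lim_null_comparison[OF always_eventually lims(1)]) (simp add: le)
  show "(f \<longlongrightarrow> 0) at_bot" by (rule Lim_null_comparison[OF always_eventually lims(2)]) (simp add: le)
qed

text \<open>Integration by parts; the boundary terms vanish by the Lorentzian bound on \<open>f\<close>.\<close>

lemma ft_derivative:
  fixes f f' :: "real \<Rightarrow> complex"
  assumes d: "\<And>x. (f has_vector_derivative f' x) (at x)" and c: "continuous_on UNIV f'"
    and le: "\<And>x. cmod (f x) \<le> K / (1 + x\<^sup>2)" and le': "\<And>x. cmod (f' x) \<le> K' / (1 + x\<^sup>2)"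
  shows "ft f' \<xi> = \<i> * \<xi> * ft f \<xi>"
proof -
  have cf: "continuous_on UNIV f"
    using d by (auto simp: continuous_on_eq_continuous_at intro: has_vector_derivative_continuous)
  have i: "integrable lborel f" and i': "integrable lborel f'"
    using lorentz_dominated[OF cf le] lorentz_dominated[OF c le'] by auto
  let ?F = "\<lambda>x. cis (-(x * \<xi>)) * f x"
  let ?f = "\<lambda>x. cis (-(x * \<xi>)) * f' x - \<i> * \<xi> * (cis (-(x * \<xi>)) * f x)"
  have u: "einterval (-\<infinity>) \<infinity> = (UNIV::real set)" by (auto simp: einterval_def)
  have ic: "integrable lborel (\<lambda>x. cis (-(x * \<xi>)) * f x)" "integrable lborel (\<lambda>x. cis (-(x * \<xi>)) * f' x)"
    by (intro integrable_cis_mult i i'; simp)+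
  have "(LBINT x=-\<infinity>..\<infinity>. ?f x) = 0 - 0"
  proof (rule interval_integral_FTC_integrable)
    show "(?F has_vector_derivative ?f x) (at x)" for x
      unfolding cis_conv_exp
      by (rule derivative_eq_intros d refl has_vector_derivative_real_field | simp add: algebra_simps)+
    have "continuous_on UNIV ?f" by (intro continuous_intros cf c)
    then show "isCont ?f x" for x by (simp add: continuous_on_eq_continuous_at)
    show "set_integrable lborel (einterval (-\<infinity>) \<infinity>) ?f"
      unfolding u set_integrable_def using ic by auto
    have F: "cmod (?F x) \<le> K / (1 + x\<^sup>2)" for x using le[of x] by (simp add: norm_mult)
    show "((?F \<circ> real_of_ereal) \<longlongrightarrow> 0) (at_right (-\<infinity>))"
      using lorentz_tendsto_0(2)[OF F] by (simp add: ereal_tendsto_simps1)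
    show "((?F \<circ> real_of_ereal) \<longlongrightarrow> 0) (at_left \<infinity>)"
      using lorentz_tendsto_0(1)[OF F] by (simp add: ereal_tendsto_simps1)
  qed auto
  then have "(LINT x|lborel. ?f x) = 0"
    by (simp add: interval_lebesgue_integral_def u set_lebesgue_integral_def)
  moreover have "(LINT x|lborel. ?f x) = ft f' \<xi> - \<i> * \<xi> * ft f \<xi>"
    unfolding ft_def using ic by (subst Bochner_Integration.integral_diff) auto
  ultimately show ?thesis by simp
qed

text \<open>The Sobolev weight is at least \<open>1\<close> when \<open>s \<ge> 0\<close>, so this is the Plancherel identity. It transfers
  lower bounds from physical space to the Sobolev norm.\<close>

lemma L2_norm_le_Hs_norm:
  assumes cont: "continuous_on UNIV f" and le: "\<And>x. cmod (f x) \<le> K / (1 + x\<^sup>2)"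
    and dec: "\<And>\<xi>. cmod (ft f \<xi>) \<le> K' / (1 + \<xi>\<^sup>2) ^ N" and N: "s + 1 \<le> 2 * real N" and s: "0 \<le> s"
  shows "sqrt (LINT x|lborel. (cmod (f x))\<^sup>2) \<le> Hs_norm s f"
proof -
  note L = lorentz_dominated[OF cont le]
  have hf: "has_fourier f (ft f)" by (rule has_fourier_ft[OF L(1,3)])
  have "f \<in> Hs s" by (rule Hs_bound(1)[OF hf dec N])
  then have i: "integrable lborel (\<lambda>\<xi>. (1 + \<xi>\<^sup>2) powr s * (cmod (ft f \<xi>))\<^sup>2)" by (simp add: Hs_iff[OF hf])
  have i0: "integrable lborel (\<lambda>\<xi>. (cmod (ft f \<xi>))\<^sup>2)" using ft_in_L2[OF L(1,3)] by (simp add: L2_space_def)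
  have "2 * pi * (LINT x|lborel. (cmod (f x))\<^sup>2) = (LINT \<xi>|lborel. (cmod (ft f \<xi>))\<^sup>2)"
    by (rule plancherel[OF L(1) cont L(2), symmetric])
  also have "\<dots> \<le> (LINT \<xi>|lborel. (1 + \<xi>\<^sup>2) powr s * (cmod (ft f \<xi>))\<^sup>2)"
  proof (rule Bochner_Integration.integral_mono[OF i0 i])
    fix \<xi> :: real
    have "1 \<le> (1 + \<xi>\<^sup>2) powr s" using one_plus_sq_pos[of \<xi>] s by (intro ge_one_powr_ge_zero)
    from mult_right_mono[OF this, of "(cmod (ft f \<xi>))\<^sup>2"]
    show "(cmod (ft f \<xi>))\<^sup>2 \<le> (1 + \<xi>\<^sup>2) powr s * (cmod (ft f \<xi>))\<^sup>2" by simp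
  qed
  finally have "(LINT x|lborel. (cmod (f x))\<^sup>2) \<le> 1 / (2 * pi) * (LINT \<xi>|lborel. (1 + \<xi>\<^sup>2) powr s * (cmod (ft f \<xi>))\<^sup>2)"
    by (simp add: field_simps)
  then show ?thesis unfolding Hs_norm_eq[OF hf] by (rule real_sqrt_le_mono)
qed

section \<open>Two criteria for curves in normed spaces\<close>

lemma vector_derivative_quadratic_remainder:
  fixes f :: "real \<Rightarrow> 'a::real_normed_vector"
  assumes "open S" "x \<in> S" and le: "\<And>y. y \<in> S \<Longrightarrow> norm (f y - f x - (y - x) *\<^sub>R D) \<le> M * (y - x)\<^sup>2"
  shows "(f has_vector_derivative D) (at x)"
  unfolding has_vector_derivative_def has_derivative_at_alt
proof (intro conjI allI impI)
  show "bounded_linear (\<lambda>h. h *\<^sub>R D)" by (rule bounded_linear_scaleR_left)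
  fix e :: real assume e: "0 < e"
  obtain d0 where d0: "d0 > 0" "ball x d0 \<subseteq> S" using assms(1,2) openE by blast
  define d where "d = min d0 (e / (\<bar>M\<bar> + 1))"
  show "\<exists>d>0. \<forall>y. norm (y - x) < d \<longrightarrow> norm (f y - f x - (y - x) *\<^sub>R D) \<le> e * norm (y - x)"
  proof (intro exI[of _ d] conjI allI impI)
    show "0 < d" using d0 e by (simp add: d_def)
    fix y assume y: "norm (y - x) < d"
    then have "y \<in> S" using d0 by (auto simp: d_def dist_norm norm_minus_commute)
    then have "norm (f y - f x - (y - x) *\<^sub>R D) \<le> M * (y - x)\<^sup>2" by (rule le)
    also have "\<dots> \<le> (\<bar>M\<bar> + 1) * \<bar>y - x\<bar> * \<bar>y - x\<bar>"
      unfolding mult.assoc by (simp add: power2_eq_square) (intro mult_right_mono, auto)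
    also have "\<dots> \<le> e * \<bar>y - x\<bar>"
    proof (rule mult_right_mono)
      have "\<bar>y - x\<bar> \<le> e / (\<bar>M\<bar> + 1)" using y by (simp add: d_def)
      then show "(\<bar>M\<bar> + 1) * \<bar>y - x\<bar> \<le> e" by (simp add: field_simps)
    qed simp
    finally show "norm (f y - f x - (y - x) *\<^sub>R D) \<le> e * norm (y - x)" by simp
  qed
qed

lemma vector_derivative_lipschitz:
  fixes f :: "real \<Rightarrow> 'a::real_normed_vector"
  assumes "convex S" and d: "\<And>x. x \<in> S \<Longrightarrow> (f has_vector_derivative f' x) (at x)"
    and B: "\<And>x. x \<in> S \<Longrightarrow> norm (f' x) \<le> B" and xy: "x \<in> S" "y \<in> S"
  shows "norm (f x - f y) \<le> B * \<bar>x - y\<bar>"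
proof -
  have "norm (f x - f y) \<le> B * norm (x - y)"
  proof (rule differentiable_bound[OF assms(1)])
    show "(f has_derivative (\<lambda>h. h *\<^sub>R f' z)) (at z within S)" if "z \<in> S" for z
      using d[OF that] unfolding has_vector_derivative_def by (rule has_derivative_at_withinI)
    show "onorm (\<lambda>h. h *\<^sub>R f' z) \<le> B" if "z \<in> S" for z
    proof (rule onorm_le)
      fix h :: real
      show "norm (h *\<^sub>R f' z) \<le> B * norm h"
        using mult_left_mono[OF B[OF that], of "\<bar>h\<bar>"] by (simp add: mult.commute)
    qed
  qed (use xy in auto)
  then show ?thesis by simp
qed

section \<open>The breather profile and the Fourier transforms of its powers\<close>

text \<open>The spatial shape of a breather at a fixed time; \<open>c\<close> will be a function of time that stays in a compact
  subset of the open interval from \<open>-1\<close> to \<open>1\<close>.\<close>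

definition profile :: "real \<Rightarrow> real \<Rightarrow> real \<Rightarrow> real" where
  "profile b c x = 1 / (cosh (b * x) - c)"

text \<open>Quadratic growth already gives integrability, so a Lorentzian can replace the
  exponential bound on the profile throughout.\<close>

lemma cosh_ge_quadratic: "1 + x\<^sup>2 / 4 \<le> cosh (x::real)"
proof -
  have "1 + x\<^sup>2 / 4 \<le> cosh x" if "0 \<le> x" for x :: real
    using exp_lower_Taylor_quadratic[OF that] exp_ge_add_one_self[of "-x"]
    by (simp add: cosh_field_def field_simps)
  from this[of "\<bar>x\<bar>"] show ?thesis by (simp add: cosh_real_abs)
qed

lemma profile_denominator_ge:
  assumes "\<bar>c\<bar> \<le> r" "r < 1"
  shows "(1 - r) * cosh y \<le> cosh y - (c::real)" "0 < cosh y - c"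
proof -
  have y: "1 \<le> cosh y" by (rule cosh_real_ge_1)
  then have "r * 1 \<le> r * cosh y" using assms by (intro mult_left_mono) auto
  then show "(1 - r) * cosh y \<le> cosh y - c" using assms by (simp add: algebra_simps)
  show "0 < cosh y - c" using y assms by linarith
qed

text \<open>The constant in the Lorentzian bound on the profile. It depends only on the lower bound \<open>b1\<close> for \<open>b\<close> and
  the upper bound \<open>r\<close> for \<open>\<bar>c\<bar>\<close>, so that the estimates are uniform over neighbouring breathers.\<close>

definition profile_bound :: "real \<Rightarrow> real \<Rightarrow> real" where
  "profile_bound b1 r = 1 / ((1 - r) * min 1 (b1\<^sup>2 / 4))"

context
  fixes b1 r b :: real
  assumes b1: "0 < b1" and r: "0 \<le> r" "r < 1" and b: "b1 \<le> b"
begin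

lemma profile_bound_ge_1: "1 \<le> profile_bound b1 r"
proof -
  have "0 < (1 - r) * min 1 (b1\<^sup>2 / 4)" using b1 r by simp
  moreover have "(1 - r) * min 1 (b1\<^sup>2 / 4) \<le> 1 * 1" using r b1 by (intro mult_mono) auto
  ultimately show ?thesis by (simp add: profile_bound_def)
qed

lemma profile_pos: "\<bar>c\<bar> \<le> r \<Longrightarrow> 0 < profile b c x"
  using profile_denominator_ge(2)[of c r] r by (simp add: profile_def)

lemma profile_le:
  assumes "\<bar>c\<bar> \<le> r"
  shows "profile b c x \<le> profile_bound b1 r / (1 + x\<^sup>2)"
proof -
  let ?m = "min 1 (b1\<^sup>2 / 4)"
  have m: "0 < ?m" using b1 by simp
  have "b1\<^sup>2 \<le> b\<^sup>2" using b b1 by (intro power_mono) auto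
  then have "?m * x\<^sup>2 \<le> b\<^sup>2 / 4 * x\<^sup>2" by (intro mult_right_mono) auto
  then have "?m * (1 + x\<^sup>2) \<le> 1 + (b * x)\<^sup>2 / 4" by (simp add: power_mult_distrib algebra_simps)
  also have "\<dots> \<le> cosh (b * x)" by (rule cosh_ge_quadratic)
  finally have "(1 - r) * (?m * (1 + x\<^sup>2)) \<le> (1 - r) * cosh (b * x)" using r by (intro mult_left_mono) auto
  also have "\<dots> \<le> cosh (b * x) - c" by (rule profile_denominator_ge(1)[OF assms r(2)])
  finally have "1 / (cosh (b * x) - c) \<le> 1 / ((1 - r) * (?m * (1 + x\<^sup>2)))"
    using r m one_plus_sq_pos(1)[of x] profile_denominator_ge(2)[OF assms r(2)] by (intro divide_left_mono mult_pos_pos) simp_all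
  then show ?thesis by (simp add: profile_def profile_bound_def mult.assoc)
qed

lemma profile_le_const: "\<bar>c\<bar> \<le> r \<Longrightarrow> profile b c x \<le> profile_bound b1 r"
  using order_trans[OF profile_le[of c x], of "profile_bound b1 r"] profile_bound_ge_1 one_plus_sq_pos[of x]
  by (simp add: field_simps)

lemma profile_power_le:
  assumes "\<bar>c\<bar> \<le> r" "1 \<le> k"
  shows "profile b c x ^ k \<le> profile_bound b1 r ^ k / (1 + x\<^sup>2)"
proof -
  obtain j where k: "k = Suc j" using assms(2) by (cases k) auto
  have "profile b c x ^ k = profile b c x * profile b c x ^ j" by (simp add: k)
  also have "\<dots> \<le> profile_bound b1 r / (1 + x\<^sup>2) * profile_bound b1 r ^ j"
    using profile_le[OF assms(1)] profile_le_const[OF assms(1)] profile_pos[OF assms(1)] profile_bound_ge_1 one_plus_sq_pos[of x]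
    by (intro mult_mono power_mono) (auto simp: less_imp_le intro!: divide_nonneg_pos)
  finally show ?thesis by (simp add: k)
qed

lemma profile_deriv:
  assumes "\<bar>c\<bar> \<le> r"
  shows "((\<lambda>x. profile b c x ^ k) has_real_derivative - (real k * b * sinh (b * x) * profile b c x ^ (k + 1))) (at x)"
proof -
  have n: "cosh (b * x) - c \<noteq> 0" using profile_denominator_ge(2)[OF assms r(2), of "b * x"] by simp
  have "(profile b c has_real_derivative - (b * sinh (b * x) * (profile b c x)\<^sup>2)) (at x)"
    unfolding profile_def[abs_def] using n
    by (auto intro!: derivative_eq_intros simp: power2_eq_square)
  note d = this
  show ?thesis
  proof (cases k)
    case (Suc j)
    show ?thesis unfolding Suc using DERIV_power_Suc[OF d, of j] by (simp add: power2_eq_square algebra_simps)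
  qed simp
qed

text \<open>The second derivative stays in the span of the powers of the profile: since
  \<open>cosh (b * x) = 1 / P + c\<close>, both \<open>cosh\<close> and the square of \<open>sinh\<close> can be eliminated in favour of \<open>P\<close>.\<close>

lemma profile_deriv2:
  assumes "\<bar>c\<bar> \<le> r"
  shows "((\<lambda>x. - (real k * b * sinh (b * x) * profile b c x ^ (k + 1))) has_real_derivative
     b\<^sup>2 * (real k ^ 2 * profile b c x ^ k + real k * (2 * real k + 1) * c * profile b c x ^ (k + 1)
        + real k * (real k + 1) * (c\<^sup>2 - 1) * profile b c x ^ (k + 2))) (at x)"
proof -
  let ?P = "profile b c x"
  have n: "cosh (b * x) - c \<noteq> 0" using profile_denominator_ge(2)[OF assms r(2), of "b * x"] by simp
  then have ch: "cosh (b * x) * ?P = 1 + c * ?P" by (simp add: profile_def field_simps)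
  have "sinh (b * x) ^ 2 * ?P ^ 2 = (cosh (b * x) * ?P)\<^sup>2 - ?P\<^sup>2"
    by (simp add: power_mult_distrib cosh_square_eq algebra_simps)
  then have sh: "sinh (b * x) ^ 2 * ?P ^ 2 = (1 + c * ?P)\<^sup>2 - ?P\<^sup>2" unfolding ch .
  have e: "?P ^ k * (b\<^sup>2 * (- real k * (cosh (b * x) * ?P) + real k * (real k + 1) * (sinh (b * x) ^ 2 * ?P ^ 2)))
    = b\<^sup>2 * (real k ^ 2 * ?P ^ k + real k * (2 * real k + 1) * c * ?P ^ (k + 1)
        + real k * (real k + 1) * (c\<^sup>2 - 1) * ?P ^ (k + 2))"
    unfolding ch sh by (simp add: power2_eq_square algebra_simps)
  have "((\<lambda>x. - (real k * b * sinh (b * x) * profile b c x ^ (k + 1))) has_real_derivative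
     - (real k * b * (b * cosh (b * x) * ?P ^ (k + 1) + sinh (b * x) * - (real (k + 1) * b * sinh (b * x) * ?P ^ (k + 1 + 1))))) (at x)"
    by (rule derivative_eq_intros profile_deriv[OF assms] refl | simp add: algebra_simps)+
  moreover have "- (real k * b * (b * cosh (b * x) * ?P ^ (k + 1) + sinh (b * x) * - (real (k + 1) * b * sinh (b * x) * ?P ^ (k + 1 + 1))))
     = ?P ^ k * (b\<^sup>2 * (- real k * (cosh (b * x) * ?P) + real k * (real k + 1) * (sinh (b * x) ^ 2 * ?P ^ 2)))"
    by (simp add: power2_eq_square algebra_simps)
  ultimately show ?thesis unfolding e by simp
qed

lemma continuous_profile: "\<bar>c\<bar> \<le> r \<Longrightarrow> continuous_on A (profile b c)"
  unfolding profile_def[abs_def] using profile_denominator_ge(2)[of c r, OF _ r(2)]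
  by (intro continuous_intros) (auto simp: less_imp_neq[symmetric])

end

definition profile_ft :: "nat \<Rightarrow> real \<Rightarrow> real \<Rightarrow> real \<Rightarrow> complex" where
  "profile_ft k b c = ft (\<lambda>x. of_real (profile b c x ^ k))"

context
  fixes b1 r b :: real
  assumes b1: "0 < b1" and r: "0 \<le> r" "r < 1" and b: "b1 \<le> b"
begin

lemma cmod_profile_power_le:
  assumes "\<bar>c\<bar> \<le> r" "1 \<le> k"
  shows "cmod (complex_of_real (profile b c x ^ k)) \<le> profile_bound b1 r ^ k / (1 + x\<^sup>2)"
  unfolding norm_of_real
  using profile_power_le[OF b1 r b assms] profile_pos[OF b1 r b assms(1)] by (simp add: less_imp_le)

lemma continuous_profile_power:
  assumes "\<bar>c\<bar> \<le> r"
  shows "continuous_on A (\<lambda>x. complex_of_real (profile b c x ^ k))"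
  by (intro continuous_intros continuous_profile[OF b1 r b assms])

lemma profile_power_fourier:
  assumes "\<bar>c\<bar> \<le> r" "1 \<le> k"
  shows "integrable lborel (\<lambda>x. complex_of_real (profile b c x ^ k))"
    and "(\<lambda>x. complex_of_real (profile b c x ^ k)) \<in> L2_space"
    and "has_fourier (\<lambda>x. complex_of_real (profile b c x ^ k)) (profile_ft k b c)"
    and "cmod (profile_ft k b c \<xi>) \<le> profile_bound b1 r ^ k * pi"
  using lorentz_dominated[OF continuous_profile_power[OF assms(1)] cmod_profile_power_le[OF assms]]
  by (auto simp: profile_ft_def intro: has_fourier_ft)

text \<open>The Fourier transform of \<open>profile_deriv2\<close>.\<close>

lemma profile_ft_recursion:
  assumes c: "\<bar>c\<bar> \<le> r" and k: "1 \<le> k"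
  shows "- (of_real (\<xi>\<^sup>2) * profile_ft k b c \<xi>) = of_real (b\<^sup>2) * (of_nat (k\<^sup>2) * profile_ft k b c \<xi>
     + of_nat (k * (2 * k + 1)) * of_real c * profile_ft (k + 1) b c \<xi> + of_nat (k * (k + 1)) * of_real (c\<^sup>2 - 1) * profile_ft (k + 2) b c \<xi>)"
proof -
  let ?P = "profile b c"
  let ?f1 = "\<lambda>x. - (real k * b * sinh (b * x) * ?P x ^ (k + 1))"
  let ?f2 = "\<lambda>x. b\<^sup>2 * (real k ^ 2 * ?P x ^ k + real k * (2 * real k + 1) * c * ?P x ^ (k + 1)
        + real k * (real k + 1) * (c\<^sup>2 - 1) * ?P x ^ (k + 2))"
  let ?p = "\<lambda>j x. complex_of_real (?P x ^ j)"
  have d1: "((\<lambda>x. complex_of_real (?P x ^ k)) has_vector_derivative complex_of_real (?f1 x)) (at x)" for x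
    by (intro has_vector_derivative_of_real profile_deriv[OF b1 r b c])
  have d2: "((\<lambda>x. complex_of_real (?f1 x)) has_vector_derivative complex_of_real (?f2 x)) (at x)" for x
    by (intro has_vector_derivative_of_real profile_deriv2[OF b1 r b c])
  note cp = continuous_profile[OF b1 r b c]
  have c1: "continuous_on UNIV (\<lambda>x. complex_of_real (?f1 x))"
    using d2 by (auto simp: continuous_on_eq_continuous_at intro: has_vector_derivative_continuous)
  have c2: "continuous_on UNIV (\<lambda>x. complex_of_real (?f2 x))"
    by (intro continuous_intros cp)
  have l1: "cmod (complex_of_real (?f1 x)) \<le> (real k * b / (1 - r) * profile_bound b1 r ^ k) / (1 + x\<^sup>2)" for x
  proof -
    have "(1 - r) * \<bar>sinh (b * x)\<bar> \<le> (1 - r) * cosh (b * x)"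
    proof -
      have "\<bar>sinh (b * x)\<bar> \<le> cosh (b * x)"
        by (rule power2_le_imp_le) (simp_all add: sinh_square_eq)
      then show ?thesis using r by (intro mult_left_mono) auto
    qed
    also have "\<dots> \<le> cosh (b * x) - c" by (rule profile_denominator_ge(1)[OF c r(2)])
    finally have s: "\<bar>sinh (b * x)\<bar> * ?P x \<le> 1 / (1 - r)"
      using profile_denominator_ge(2)[OF c r(2), of "b * x"] r by (simp add: profile_def field_simps)
    have "cmod (complex_of_real (?f1 x)) = real k * b * (\<bar>sinh (b * x)\<bar> * ?P x) * ?P x ^ k"
      unfolding norm_of_real using profile_pos[OF b1 r b c, of x] b1 b by (simp add: abs_mult)
    also have "\<dots> \<le> real k * b * (1 / (1 - r)) * (profile_bound b1 r ^ k / (1 + x\<^sup>2))"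
      using s profile_power_le[OF b1 r b c k] profile_pos[OF b1 r b c, of x] b1 b r
      by (intro mult_mono) (auto simp: less_imp_le)
    finally show ?thesis by simp
  qed
  let ?L = "b\<^sup>2 * ((real k)\<^sup>2 * profile_bound b1 r ^ k + real k * (2 * real k + 1) * \<bar>c\<bar> * profile_bound b1 r ^ (k + 1) + real k * (real k + 1) * \<bar>c\<^sup>2 - 1\<bar> * profile_bound b1 r ^ (k + 2))"
  have l2: "cmod (complex_of_real (?f2 x)) \<le> ?L / (1 + x\<^sup>2)" for x
  proof -
    note P = profile_pos[OF b1 r b c, of x]
    have "cmod (complex_of_real (?f2 x)) \<le> b\<^sup>2 * ((real k)\<^sup>2 * ?P x ^ k + real k * (2 * real k + 1) * \<bar>c\<bar> * ?P x ^ (k + 1)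
        + real k * (real k + 1) * \<bar>c\<^sup>2 - 1\<bar> * ?P x ^ (k + 2))"
      unfolding norm_of_real abs_mult[of "b\<^sup>2"] using P
      by (intro mult_mono order_trans[OF abs_triangle_ineq] add_mono) (auto simp: abs_mult)
    also have "\<dots> \<le> b\<^sup>2 * ((real k)\<^sup>2 * (profile_bound b1 r ^ k / (1 + x\<^sup>2)) + real k * (2 * real k + 1) * \<bar>c\<bar> * (profile_bound b1 r ^ (k + 1) / (1 + x\<^sup>2))
        + real k * (real k + 1) * \<bar>c\<^sup>2 - 1\<bar> * (profile_bound b1 r ^ (k + 2) / (1 + x\<^sup>2)))"
      by (intro mult_left_mono add_mono profile_power_le[OF b1 r b c]) (use k in auto)
    also have "\<dots> = ?L / (1 + x\<^sup>2)" by (simp add: add_divide_distrib distrib_left)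
    finally show ?thesis .
  qed
  have "ft (\<lambda>x. complex_of_real (?f2 x)) \<xi> = \<i> * \<xi> * ft (\<lambda>x. complex_of_real (?f1 x)) \<xi>"
    by (rule ft_derivative[OF d2 c2 l1 l2])
  also have "ft (\<lambda>x. complex_of_real (?f1 x)) \<xi> = \<i> * \<xi> * profile_ft k b c \<xi>"
    unfolding profile_ft_def by (rule ft_derivative[OF d1 c1 cmod_profile_power_le[OF c k] l1])
  also have "\<i> * \<xi> * (\<i> * \<xi> * profile_ft k b c \<xi>) = - (of_real (\<xi>\<^sup>2) * profile_ft k b c \<xi>)"
    using i_squared by (simp add: power2_eq_square algebra_simps)
  finally have 1: "ft (\<lambda>x. complex_of_real (?f2 x)) \<xi> = - (of_real (\<xi>\<^sup>2) * profile_ft k b c \<xi>)" .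
  have ik: "integrable lborel (?p k)" "integrable lborel (?p (k + 1))" "integrable lborel (?p (k + 2))"
    by (rule profile_power_fourier(1)[OF c], use k in simp)+
  have ij: "integrable lborel (\<lambda>x. of_nat (k\<^sup>2) * ?p k x + of_nat (k * (2 * k + 1)) * of_real c * ?p (k + 1) x)"
    by (rule Bochner_Integration.integrable_add; rule integrable_mult_right; rule ik)
  let ?h = "\<lambda>x. of_nat (k\<^sup>2) * ?p k x + of_nat (k * (2 * k + 1)) * of_real c * ?p (k + 1) x"
  have f2: "(\<lambda>x. complex_of_real (?f2 x)) = (\<lambda>x. of_real (b\<^sup>2) * ?h x
     + of_real (b\<^sup>2) * of_nat (k * (k + 1)) * of_real (c\<^sup>2 - 1) * ?p (k + 2) x)"
    by (auto simp: algebra_simps)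
  have 2: "ft (\<lambda>x. complex_of_real (?f2 x)) \<xi> = of_real (b\<^sup>2) * ft ?h \<xi>
      + of_real (b\<^sup>2) * of_nat (k * (k + 1)) * of_real (c\<^sup>2 - 1) * ft (?p (k + 2)) \<xi>"
    unfolding f2 by (rule ft_lincomb[OF ij ik(3)])
  have 3: "ft ?h \<xi> = of_nat (k\<^sup>2) * ft (?p k) \<xi> + of_nat (k * (2 * k + 1)) * of_real c * ft (?p (k + 1)) \<xi>"
    by (rule ft_lincomb[OF ik(1) ik(2)])
  show ?thesis by (subst 1[symmetric], subst 2, subst 3) (simp add: profile_ft_def algebra_simps)
qed

end

text \<open>Induction on \<open>N\<close>, for all powers at once: by the recursion, \<open>1 + \<xi>\<^sup>2\<close> times the transform of a power
  is a bounded combination of transforms of that power and the two following ones.\<close>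

lemma profile_ft_decay:
  assumes b1: "0 < b1" and r: "0 \<le> r" "r < 1"
  shows "\<exists>K. \<forall>b c \<xi>. b1 \<le> b \<longrightarrow> b \<le> b2 \<longrightarrow> \<bar>c\<bar> \<le> r \<longrightarrow> cmod (profile_ft (Suc j) b c \<xi>) \<le> K / (1 + \<xi>\<^sup>2) ^ N"
proof (induction N arbitrary: j)
  case 0
  show ?case using profile_power_fourier(4)[OF b1 r, where k="Suc j"] by (intro exI[of _ "profile_bound b1 r ^ Suc j * pi"]) auto
next
  case (Suc N)
  obtain K0 where K0: "\<And>b c \<xi>. b1 \<le> b \<Longrightarrow> b \<le> b2 \<Longrightarrow> \<bar>c\<bar> \<le> r \<Longrightarrow> cmod (profile_ft (Suc j) b c \<xi>) \<le> K0 / (1 + \<xi>\<^sup>2) ^ N"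
    using Suc.IH[of j] by blast
  obtain K1 where K1: "\<And>b c \<xi>. b1 \<le> b \<Longrightarrow> b \<le> b2 \<Longrightarrow> \<bar>c\<bar> \<le> r \<Longrightarrow> cmod (profile_ft (Suc (Suc j)) b c \<xi>) \<le> K1 / (1 + \<xi>\<^sup>2) ^ N"
    using Suc.IH[of "Suc j"] by blast
  obtain K2 where K2: "\<And>b c \<xi>. b1 \<le> b \<Longrightarrow> b \<le> b2 \<Longrightarrow> \<bar>c\<bar> \<le> r \<Longrightarrow> cmod (profile_ft (Suc (Suc (Suc j))) b c \<xi>) \<le> K2 / (1 + \<xi>\<^sup>2) ^ N"
    using Suc.IH[of "Suc (Suc j)"] by blast
  let ?k = "Suc j"
  define K where "K = K0 + b2\<^sup>2 * (real (?k\<^sup>2) * K0 + real (?k * (2 * ?k + 1)) * K1 + real (?k * (?k + 1)) * K2)"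
  show ?case
  proof (intro exI[of _ K] allI impI)
    fix b c \<xi> :: real assume b: "b1 \<le> b" "b \<le> b2" and c: "\<bar>c\<bar> \<le> r"
    let ?m = "1 + \<xi>\<^sup>2"
    have m: "0 < ?m" by (rule one_plus_sq_pos)
    let ?q = "\<lambda>k. profile_ft k b c \<xi>"
    have c1: "\<bar>c\<bar> \<le> 1" "\<bar>c\<^sup>2 - 1\<bar> \<le> 1"
      using c r abs_le_square_iff[of c 1] zero_le_power2[of c] by auto
    have nn: "0 \<le> K0 / ?m ^ N" "0 \<le> K1 / ?m ^ N" "0 \<le> K2 / ?m ^ N"
      using order_trans[OF norm_ge_zero K0[OF b c]] order_trans[OF norm_ge_zero K1[OF b c]] order_trans[OF norm_ge_zero K2[OF b c]] by auto
    have bb: "b\<^sup>2 \<le> b2\<^sup>2" using b b1 by (intro power_mono) auto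
    let ?S = "of_nat (?k\<^sup>2) * ?q ?k + of_nat (?k * (2 * ?k + 1)) * of_real c * ?q (?k + 1) + of_nat (?k * (?k + 1)) * of_real (c\<^sup>2 - 1) * ?q (?k + 2)"
    have "of_real ?m * ?q ?k = ?q ?k - of_real (b\<^sup>2) * ?S"
      using profile_ft_recursion[OF b1 r b(1) c, of ?k \<xi>] by (simp add: algebra_simps)
    then have "?m * cmod (?q ?k) = cmod (?q ?k - of_real (b\<^sup>2) * ?S)"
      using m by (metis norm_mult norm_of_real abs_of_pos)
    also have "\<dots> \<le> cmod (?q ?k) + b\<^sup>2 * cmod ?S"
      by (rule order_trans[OF norm_triangle_ineq4]) (simp only: norm_mult norm_of_real abs_power2)
    also have "\<dots> \<le> K0 / ?m ^ N + b2\<^sup>2 * (real (?k\<^sup>2) * (K0 / ?m ^ N) + real (?k * (2 * ?k + 1)) * (K1 / ?m ^ N) + real (?k * (?k + 1)) * (K2 / ?m ^ N))"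
    proof (intro add_mono mult_mono bb K0 b c)
      have "cmod ?S \<le> real (?k\<^sup>2) * cmod (?q ?k) + real (?k * (2 * ?k + 1)) * \<bar>c\<bar> * cmod (?q (?k + 1)) + real (?k * (?k + 1)) * \<bar>c\<^sup>2 - 1\<bar> * cmod (?q (?k + 2))"
        by (intro order_trans[OF norm_triangle_ineq] add_mono) (simp_all only: norm_mult norm_of_nat norm_of_real order_refl)
      also have "\<dots> \<le> real (?k\<^sup>2) * (K0 / ?m ^ N) + real (?k * (2 * ?k + 1)) * 1 * (K1 / ?m ^ N) + real (?k * (?k + 1)) * 1 * (K2 / ?m ^ N)"
        using K0[OF b c, of \<xi>] K1[OF b c, of \<xi>] K2[OF b c, of \<xi>] nn c1
        by (intro add_mono mult_mono) auto
      finally show "cmod ?S \<le> real (?k\<^sup>2) * (K0 / ?m ^ N) + real (?k * (2 * ?k + 1)) * (K1 / ?m ^ N) + real (?k * (?k + 1)) * (K2 / ?m ^ N)"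
        by simp
    qed auto
    also have "\<dots> = K / ?m ^ N" unfolding K_def by (simp add: add_divide_distrib algebra_simps)
    finally have "cmod (?q ?k) * ?m \<le> K / ?m ^ N" by (simp only: mult.commute)
    then have "cmod (?q ?k) \<le> K / ?m ^ N / ?m" by (simp only: pos_le_divide_eq[OF m])
    then show "cmod (?q ?k) \<le> K / ?m ^ Suc N" by (simp only: divide_divide_eq_left power_Suc2)
  qed
qed

lemma profile_diff:
  assumes "cosh (b * x) \<noteq> c" "cosh (b * x) \<noteq> c'"
  shows "profile b c' x - profile b c x = (c' - c) * profile b c x * profile b c' x"
proof -
  have "1 / Y - 1 / X = (X - Y) * (1 / X) * (1 / Y)" if "X \<noteq> 0" "Y \<noteq> 0" for X Y :: real
    using that by (simp add: field_simps)
  from this[of "cosh (b * x) - c" "cosh (b * x) - c'"] assms show ?thesis by (simp add: profile_def)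
qed

text \<open>The first order Taylor formula in \<open>c\<close>, by induction on \<open>k\<close> from the exact identity \<open>profile_diff\<close>. The
  Lorentzian factor keeps the remainder integrable in \<open>x\<close>, so that it passes to the Fourier transform.\<close>

lemma profile_power_remainder:
  assumes b1: "0 < b1" and r: "0 \<le> r" "r < 1" and b: "b1 \<le> b"
  shows "\<exists>M. \<forall>c c' x. \<bar>c\<bar> \<le> r \<longrightarrow> \<bar>c'\<bar> \<le> r \<longrightarrow>
    \<bar>profile b c' x ^ k - profile b c x ^ k - (c' - c) * (real k * profile b c x ^ (k + 1))\<bar>
      \<le> M * (c' - c)\<^sup>2 / (1 + x\<^sup>2)"
proof (induction k)
  case 0 show ?case by (intro exI[of _ 0]) simp
next
  case (Suc k)
  let ?C = "profile_bound b1 r"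
  obtain M where M: "\<And>c c' x. \<bar>c\<bar> \<le> r \<Longrightarrow> \<bar>c'\<bar> \<le> r \<Longrightarrow>
    \<bar>profile b c' x ^ k - profile b c x ^ k - (c' - c) * (real k * profile b c x ^ (k + 1))\<bar> \<le> M * (c' - c)\<^sup>2 / (1 + x\<^sup>2)"
    using Suc by blast
  show ?case
  proof (intro exI[of _ "?C * M + (real k + 1) * ?C ^ (k + 3)"] allI impI)
    fix c c' x assume c: "\<bar>c\<bar> \<le> r" "\<bar>c'\<bar> \<le> r"
    let ?a = "profile b c x" and ?a' = "profile b c' x" and ?h = "c' - c" and ?m = "1 + x\<^sup>2"
    let ?R = "?a' ^ k - ?a ^ k - ?h * (real k * ?a ^ (k + 1))"
    have n: "cosh (b * x) \<noteq> c" "cosh (b * x) \<noteq> c'"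
      using profile_denominator_ge(2)[OF c(1) r(2), of "b * x"] profile_denominator_ge(2)[OF c(2) r(2), of "b * x"] by auto
    \<comment> \<open>In the next computation every difference of profiles is traded for a factor \<open>?h\<close>.\<close>
    have diff: "?a' - ?a = ?h * ?a * ?a'" by (rule profile_diff[OF n])
    have a: "0 < ?a" "?a \<le> ?C" "0 < ?a'" "?a' \<le> ?C"
      using profile_pos[OF b1 r b] profile_le_const[OF b1 r b] c by auto
    have C: "0 \<le> ?C" using a by linarith
    have collect: "C * (M * h2 / m) + k1 * h2 * (D / m * C) = (C * M + k1 * (D * C)) * h2 / m" for C M h2 m k1 D :: real
      by (simp add: add_divide_distrib algebra_simps)
    have pw: "?C ^ (k + 3) = ?C ^ (k + 2) * ?C" by (simp add: eval_nat_numeral)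
    have "?a' ^ Suc k - ?a ^ Suc k - ?h * (real (Suc k) * ?a ^ (Suc k + 1))
       = ?a' * ?R + (?a' - ?a) * ?a ^ k + ?h * real k * ?a ^ (k + 1) * (?a' - ?a) - ?h * ?a * ?a ^ (k + 1)"
      by (simp add: algebra_simps)
    also note diff
    also have "?a' * ?R + (?h * ?a * ?a') * ?a ^ k + ?h * real k * ?a ^ (k + 1) * (?h * ?a * ?a') - ?h * ?a * ?a ^ (k + 1)
      = ?a' * ?R + ?h * ?a ^ (k + 1) * (?a' - ?a) + ?h * real k * ?a ^ (k + 1) * (?h * ?a * ?a')"
      by (simp add: algebra_simps)
    also note diff
    also have "?a' * ?R + ?h * ?a ^ (k + 1) * (?h * ?a * ?a') + ?h * real k * ?a ^ (k + 1) * (?h * ?a * ?a')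
      = ?a' * ?R + (real k + 1) * ?h\<^sup>2 * (?a ^ (k + 2) * ?a')"
      by (simp add: algebra_simps power2_eq_square)
    finally have e: "?a' ^ Suc k - ?a ^ Suc k - ?h * (real (Suc k) * ?a ^ (Suc k + 1))
       = ?a' * ?R + (real k + 1) * ?h\<^sup>2 * (?a ^ (k + 2) * ?a')" .
    have "\<bar>?a' * ?R + (real k + 1) * ?h\<^sup>2 * (?a ^ (k + 2) * ?a')\<bar> \<le> ?a' * \<bar>?R\<bar> + (real k + 1) * ?h\<^sup>2 * (?a ^ (k + 2) * ?a')"
      using a by (intro order_trans[OF abs_triangle_ineq] add_mono) (auto simp: abs_mult)
    also have "\<dots> \<le> ?C * (M * ?h\<^sup>2 / ?m) + (real k + 1) * ?h\<^sup>2 * (?C ^ (k + 2) / ?m * ?C)"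
      using a C M[OF c] profile_power_le[OF b1 r b c(1), of "k + 2"] one_plus_sq_pos(1)[of x]
      by (intro add_mono mult_mono) auto
    also have "\<dots> = (?C * M + (real k + 1) * ?C ^ (k + 3)) * ?h\<^sup>2 / ?m"
      unfolding pw by (rule collect)
    finally show "\<bar>?a' ^ Suc k - ?a ^ Suc k - ?h * (real (Suc k) * ?a ^ (Suc k + 1))\<bar>
      \<le> (?C * M + (real k + 1) * ?C ^ (k + 3)) * ?h\<^sup>2 / ?m" unfolding e .
  qed
qed

lemma profile_ft_has_vector_derivative:
  assumes b: "0 < b" and c: "\<bar>c\<bar> < 1" and k: "1 \<le> k"
  shows "((\<lambda>c. profile_ft k b c \<xi>) has_vector_derivative of_nat k * profile_ft (k + 1) b c \<xi>) (at c)"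
proof -
  \<comment> \<open>Halfway between \<open>\<bar>c\<bar>\<close> and \<open>1\<close>, to leave room for varying \<open>c\<close>.\<close>
  define r where "r = (1 + \<bar>c\<bar>) / 2"
  have r: "0 \<le> r" "r < 1" and cr: "\<bar>c\<bar> < r" using c by (auto simp: r_def)
  note bb = b r order_refl[of b]
  obtain M where M: "\<And>c c' x. \<bar>c\<bar> \<le> r \<Longrightarrow> \<bar>c'\<bar> \<le> r \<Longrightarrow>
    \<bar>profile b c' x ^ k - profile b c x ^ k - (c' - c) * (real k * profile b c x ^ (k + 1))\<bar> \<le> M * (c' - c)\<^sup>2 / (1 + x\<^sup>2)"
    using profile_power_remainder[OF bb] by blast
  show ?thesis
  proof (rule vector_derivative_quadratic_remainder[of "{-r<..<r}"])
    show "open {-r<..<r}" "c \<in> {-r<..<r}" using cr by auto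
    fix c' assume "c' \<in> {-r<..<r}"
    then have c': "\<bar>c'\<bar> \<le> r" by auto
    have c0: "\<bar>c\<bar> \<le> r" using cr by simp
    let ?p = "\<lambda>c j x. complex_of_real (profile b c x ^ j)"
    \<comment> \<open>The Taylor remainder, written as a nested linear combination of two functions at a time to fit \<open>ft_lincomb\<close>.\<close>
    let ?g = "\<lambda>x. 1 * (1 * ?p c' k x + (-1) * ?p c k x) + (- (of_real (c' - c) * of_nat k)) * ?p c (k + 1) x"
    have i: "integrable lborel (?p c' k)" "integrable lborel (?p c k)" "integrable lborel (?p c (k + 1))"
      by (rule profile_power_fourier(1)[OF bb c' k], rule profile_power_fourier(1)[OF bb c0 k],
          rule profile_power_fourier(1)[OF bb c0], simp)
    have i2: "integrable lborel (\<lambda>x. 1 * ?p c' k x + (-1) * ?p c k x)"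
      using i by simp
    have g: "?g x = complex_of_real (profile b c' x ^ k - profile b c x ^ k - (c' - c) * (real k * profile b c x ^ (k + 1)))" for x
      by (simp add: algebra_simps)
    have "ft ?g \<xi> = 1 * (1 * profile_ft k b c' \<xi> + (-1) * profile_ft k b c \<xi>) + (- (of_real (c' - c) * of_nat k)) * profile_ft (k + 1) b c \<xi>"
      unfolding ft_lincomb[OF i2 i(3)] ft_lincomb[OF i(1,2)] profile_ft_def ..
    then have e: "profile_ft k b c' \<xi> - profile_ft k b c \<xi> - (c' - c) *\<^sub>R (of_nat k * profile_ft (k + 1) b c \<xi>) = ft ?g \<xi>"
      by (simp add: scaleR_conv_of_real algebra_simps)
    have "cmod (ft ?g \<xi>) \<le> (M * (c' - c)\<^sup>2) * pi"
    proof (rule lorentz_dominated(4))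
      show "continuous_on UNIV ?g"
        using cr c' by (intro continuous_intros continuous_profile[OF bb]) auto
      show "cmod (?g x) \<le> M * (c' - c)\<^sup>2 / (1 + x\<^sup>2)" for x
        unfolding g norm_of_real using M[of c c' x] cr c' by simp
    qed
    then show "cmod (profile_ft k b c' \<xi> - profile_ft k b c \<xi> - (c' - c) *\<^sub>R (of_nat k * profile_ft (k + 1) b c \<xi>)) \<le> (M * pi) * (c' - c)\<^sup>2"
      unfolding e by (simp add: mult_ac)
  qed
qed

text \<open>The derivative in \<open>c\<close> is again a transform of a power, so it has the same decay in \<open>\<xi>\<close>.\<close>

lemma profile_ft_lipschitz:
  assumes b: "0 < b" and r: "0 \<le> r" "r < 1"
  shows "\<exists>L. \<forall>c c' \<xi>. \<bar>c\<bar> \<le> r \<longrightarrow> \<bar>c'\<bar> \<le> r \<longrightarrow>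
    cmod (profile_ft (Suc j) b c \<xi> - profile_ft (Suc j) b c' \<xi>) \<le> L * \<bar>c - c'\<bar> / (1 + \<xi>\<^sup>2) ^ N"
proof -
  obtain K where K: "\<And>c \<xi>. \<bar>c\<bar> \<le> r \<Longrightarrow> cmod (profile_ft (Suc (Suc j)) b c \<xi>) \<le> K / (1 + \<xi>\<^sup>2) ^ N"
    using profile_ft_decay[OF b r, of b "Suc j" N] by blast
  show ?thesis
  proof (intro exI[of _ "real (Suc j) * K"] allI impI)
    fix c c' \<xi> :: real assume c: "\<bar>c\<bar> \<le> r" "\<bar>c'\<bar> \<le> r"
    have "cmod (profile_ft (Suc j) b c \<xi> - profile_ft (Suc j) b c' \<xi>) \<le> (real (Suc j) * (K / (1 + \<xi>\<^sup>2) ^ N)) * \<bar>c - c'\<bar>"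
    proof (rule vector_derivative_lipschitz[of "{-r..r}"])
      show "((\<lambda>c. profile_ft (Suc j) b c \<xi>) has_vector_derivative of_nat (Suc j) * profile_ft (Suc j + 1) b x \<xi>) (at x)"
        if "x \<in> {-r..r}" for x
        using that r by (intro profile_ft_has_vector_derivative b) auto
      show "cmod (of_nat (Suc j) * profile_ft (Suc j + 1) b x \<xi>) \<le> real (Suc j) * (K / (1 + \<xi>\<^sup>2) ^ N)" if "x \<in> {-r..r}" for x
        unfolding norm_mult norm_of_nat using K[of x \<xi>] that by (intro mult_left_mono) auto
    qed (use c in auto)
    then show "cmod (profile_ft (Suc j) b c \<xi> - profile_ft (Suc j) b c' \<xi>) \<le> real (Suc j) * K * \<bar>c - c'\<bar> / (1 + \<xi>\<^sup>2) ^ N"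
      by (simp add: field_simps)
  qed
qed

lemma profile_ft_tendsto:
  assumes b1: "0 < b1" and r: "0 \<le> r" "r < 1" and k: "1 \<le> k"
    and bn: "\<And>n. b1 \<le> b n" "b \<longlonglongrightarrow> b'" and cn: "\<And>n. \<bar>c n\<bar> \<le> r" "c \<longlonglongrightarrow> c'"
  shows "(\<lambda>n. profile_ft k (b n) (c n) \<xi>) \<longlonglongrightarrow> profile_ft k b' c' \<xi>"
proof -
  have b': "b1 \<le> b'" using bn by (auto intro: LIMSEQ_le_const)
  have "(\<lambda>n. \<bar>c n\<bar>) \<longlonglongrightarrow> \<bar>c'\<bar>" using cn(2) by (rule tendsto_rabs)
  then have c': "\<bar>c'\<bar> \<le> r" using cn(1) by (auto intro: LIMSEQ_le_const2)
  have meas: "(\<lambda>x. complex_of_real (profile b c x ^ k)) \<in> borel_measurable lborel"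
    if "b1 \<le> b" "\<bar>c\<bar> \<le> r" for b c
    by (rule borel_measurable_integrable[OF profile_power_fourier(1)[OF b1 r that k]])
  note [measurable] = meas[OF bn(1) cn(1)] meas[OF b' c']
  show ?thesis
    unfolding profile_ft_def ft_def
  proof (rule integral_dominated_convergence[OF _ _ integrable_lorentzian[of "profile_bound b1 r ^ k"]])
    show "AE x in lborel. (\<lambda>n. cis (- (x * \<xi>)) * complex_of_real (profile (b n) (c n) x ^ k)) \<longlonglongrightarrow> cis (- (x * \<xi>)) * complex_of_real (profile b' c' x ^ k)"
    proof (rule AE_I2)
      fix x
      have "cosh (b' * x) - c' \<noteq> 0" using profile_denominator_ge(2)[OF c' r(2), of "b' * x"] by simp
      then show "(\<lambda>n. cis (- (x * \<xi>)) * complex_of_real (profile (b n) (c n) x ^ k)) \<longlonglongrightarrow> cis (- (x * \<xi>)) * complex_of_real (profile b' c' x ^ k)"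
        unfolding profile_def by (intro tendsto_intros bn cn)
    qed
    show "AE x in lborel. cmod (cis (- (x * \<xi>)) * complex_of_real (profile (b n) (c n) x ^ k)) \<le> profile_bound b1 r ^ k / (1 + x\<^sup>2)" for n
      using cmod_profile_power_le[OF b1 r bn(1) cn(1) k] by (simp add: norm_mult norm_power)
  qed measurable
qed

section \<open>Lipschitz families of rapidly decreasing functions\<close>

text \<open>Time-dependent coefficients that may multiply a family of rapidly decreasing functions.\<close>

definition bounded_lip :: "(real \<Rightarrow> complex) \<Rightarrow> bool" where
  "bounded_lip a \<longleftrightarrow> (\<exists>M. \<forall>\<tau> \<sigma>. cmod (a \<tau>) \<le> M \<and> cmod (a \<tau> - a \<sigma>) \<le> M * \<bar>\<tau> - \<sigma>\<bar>)"

text \<open>The time parameter comes first. The Lipschitz constant in time decays in \<open>\<xi>\<close> as fast as the function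
  itself, so that estimates made for each \<open>\<xi>\<close> become estimates in every Sobolev norm.\<close>

definition rapid_lip :: "(real \<Rightarrow> real \<Rightarrow> complex) \<Rightarrow> bool" where
  "rapid_lip F \<longleftrightarrow> (\<forall>N. \<exists>K. \<forall>\<tau> \<sigma> \<xi>. cmod (F \<tau> \<xi>) \<le> K / (1 + \<xi>\<^sup>2) ^ N \<and>
     cmod (F \<tau> \<xi> - F \<sigma> \<xi>) \<le> K * \<bar>\<tau> - \<sigma>\<bar> / (1 + \<xi>\<^sup>2) ^ N)"

lemma norm_mult_diff_le:
  fixes a b c d :: complex
  assumes "cmod a \<le> M" "cmod (a - c) \<le> M * h" "cmod d \<le> K" "cmod (b - d) \<le> K * h"
  shows "cmod (a * b - c * d) \<le> 2 * M * K * h"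
proof -
  have "a * b - c * d = a * (b - d) + (a - c) * d" by (simp add: algebra_simps)
  then have "cmod (a * b - c * d) \<le> cmod a * cmod (b - d) + cmod (a - c) * cmod d"
    by (metis norm_mult norm_triangle_ineq)
  also have "\<dots> \<le> M * (K * h) + (M * h) * K"
    using assms by (intro add_mono mult_mono) (auto intro: order_trans[OF norm_ge_zero])
  finally show ?thesis by (simp add: algebra_simps)
qed

lemma bounded_lip_const: "bounded_lip (\<lambda>_. z)"
  unfolding bounded_lip_def by (intro exI[of _ "cmod z"]) simp

lemma bounded_lip_add:
  assumes "bounded_lip a" "bounded_lip b"
  shows "bounded_lip (\<lambda>t. a t + b t)"
proof -
  from assms obtain M K where "\<And>\<tau> \<sigma>. cmod (a \<tau>) \<le> M \<and> cmod (a \<tau> - a \<sigma>) \<le> M * \<bar>\<tau> - \<sigma>\<bar>"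
    "\<And>\<tau> \<sigma>. cmod (b \<tau>) \<le> K \<and> cmod (b \<tau> - b \<sigma>) \<le> K * \<bar>\<tau> - \<sigma>\<bar>" unfolding bounded_lip_def by blast
  then show ?thesis unfolding bounded_lip_def
    by (intro exI[of _ "M + K"]) (auto simp: distrib_right add_diff_add intro!: norm_triangle_mono)
qed

lemma bounded_lip_mult:
  assumes "bounded_lip a" "bounded_lip b"
  shows "bounded_lip (\<lambda>t. a t * b t)"
proof -
  from assms obtain M K where M: "\<And>\<tau> \<sigma>. cmod (a \<tau>) \<le> M \<and> cmod (a \<tau> - a \<sigma>) \<le> M * \<bar>\<tau> - \<sigma>\<bar>"
    and K: "\<And>\<tau> \<sigma>. cmod (b \<tau>) \<le> K \<and> cmod (b \<tau> - b \<sigma>) \<le> K * \<bar>\<tau> - \<sigma>\<bar>" unfolding bounded_lip_def by blast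
  have "0 \<le> M" "0 \<le> K" using M[of 0 0] K[of 0 0] order_trans[OF norm_ge_zero] by auto
  then have 0: "0 \<le> M * K" by simp
  have "cmod (a \<tau> * b \<tau>) \<le> M * K" for \<tau>
    unfolding norm_mult using M[of \<tau> 0] K[of \<tau> 0] \<open>0 \<le> M\<close> by (intro mult_mono) auto
  moreover have "M * K \<le> 2 * M * K" using 0 by linarith
  ultimately have 1: "cmod (a \<tau> * b \<tau>) \<le> 2 * M * K" for \<tau> by (rule order_trans)
  have "cmod (a \<tau> * b \<tau> - a \<sigma> * b \<sigma>) \<le> 2 * M * K * \<bar>\<tau> - \<sigma>\<bar>" for \<tau> \<sigma>
    using norm_mult_diff_le[of "a \<tau>" M "a \<sigma>" "\<bar>\<tau> - \<sigma>\<bar>" "b \<sigma>" K "b \<tau>"] M[of \<tau> \<sigma>] K[of \<tau> \<sigma>] K[of \<sigma> \<tau>] by simp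
  with 1 show ?thesis unfolding bounded_lip_def by (intro exI[of _ "2 * M * K"]) simp
qed

lemma bounded_lip_cnj: "bounded_lip a \<Longrightarrow> bounded_lip (\<lambda>t. cnj (a t))"
  unfolding bounded_lip_def by (simp flip: complex_cnj_diff)

lemma bounded_lip_trig:
  "bounded_lip (\<lambda>t. of_real (cos (w * t)))" "bounded_lip (\<lambda>t. of_real (sin (w * t)))"
proof -
  have dc: "((\<lambda>x. cos (w * x)) has_vector_derivative - sin (w * x) * w) (at x)"
    and ds: "((\<lambda>x. sin (w * x)) has_vector_derivative cos (w * x) * w) (at x)" for x
    by (auto intro!: derivative_eq_intros simp flip: has_real_derivative_iff_has_vector_derivative)
  have b: "norm (- sin (w * x) * w) \<le> \<bar>w\<bar>" "norm (cos (w * x) * w) \<le> \<bar>w\<bar>" for x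
    by (auto simp: abs_mult intro!: mult_left_le_one_le)
  have 1: "\<bar>cos (w * x) - cos (w * y)\<bar> \<le> \<bar>w\<bar> * \<bar>x - y\<bar>" for x y
    using vector_derivative_lipschitz[OF convex_UNIV dc b(1), of x y] by simp
  have 2: "\<bar>sin (w * x) - sin (w * y)\<bar> \<le> \<bar>w\<bar> * \<bar>x - y\<bar>" for x y
    using vector_derivative_lipschitz[OF convex_UNIV ds b(2), of x y] by simp
  have 3: "\<bar>w\<bar> * \<bar>x - y\<bar> \<le> (1 + \<bar>w\<bar>) * \<bar>x - y\<bar>" for x y by (intro mult_right_mono) auto
  have 4: "\<bar>cos (w * x)\<bar> \<le> 1 + \<bar>w\<bar>" "\<bar>sin (w * x)\<bar> \<le> 1 + \<bar>w\<bar>" for x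
    using abs_cos_le_one[of "w * x"] abs_sin_le_one[of "w * x"] abs_ge_zero[of w] by linarith+
  show "bounded_lip (\<lambda>t. of_real (cos (w * t)))" "bounded_lip (\<lambda>t. of_real (sin (w * t)))"
    unfolding bounded_lip_def using order_trans[OF 1 3] order_trans[OF 2 3] 4
    by (intro exI[of _ "1 + \<bar>w\<bar>"]; simp flip: of_real_diff)+
qed

lemma rapid_lip_add:
  assumes "rapid_lip F" "rapid_lip H"
  shows "rapid_lip (\<lambda>t \<xi>. F t \<xi> + H t \<xi>)"
  unfolding rapid_lip_def
proof
  fix N
  from assms obtain M K where M: "\<And>\<tau> \<sigma> \<xi>. cmod (F \<tau> \<xi>) \<le> M / (1 + \<xi>\<^sup>2) ^ N \<and> cmod (F \<tau> \<xi> - F \<sigma> \<xi>) \<le> M * \<bar>\<tau> - \<sigma>\<bar> / (1 + \<xi>\<^sup>2) ^ N"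
    and K: "\<And>\<tau> \<sigma> \<xi>. cmod (H \<tau> \<xi>) \<le> K / (1 + \<xi>\<^sup>2) ^ N \<and> cmod (H \<tau> \<xi> - H \<sigma> \<xi>) \<le> K * \<bar>\<tau> - \<sigma>\<bar> / (1 + \<xi>\<^sup>2) ^ N"
    unfolding rapid_lip_def by meson
  show "\<exists>K. \<forall>\<tau> \<sigma> \<xi>. cmod (F \<tau> \<xi> + H \<tau> \<xi>) \<le> K / (1 + \<xi>\<^sup>2) ^ N \<and>
     cmod (F \<tau> \<xi> + H \<tau> \<xi> - (F \<sigma> \<xi> + H \<sigma> \<xi>)) \<le> K * \<bar>\<tau> - \<sigma>\<bar> / (1 + \<xi>\<^sup>2) ^ N"
    by (intro exI[of _ "M + K"] allI conjI; simp only: distrib_right add_divide_distrib add_diff_add)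
      (intro norm_triangle_mono; use M K in blast)+
qed

lemma rapid_lip_mult:
  assumes a: "bounded_lip a" and F: "rapid_lip F"
  shows "rapid_lip (\<lambda>t \<xi>. a t * F t \<xi>)"
  unfolding rapid_lip_def
proof
  fix N
  from F obtain K where K: "\<And>\<tau> \<sigma> \<xi>. cmod (F \<tau> \<xi>) \<le> K / (1 + \<xi>\<^sup>2) ^ N \<and> cmod (F \<tau> \<xi> - F \<sigma> \<xi>) \<le> K * \<bar>\<tau> - \<sigma>\<bar> / (1 + \<xi>\<^sup>2) ^ N"
    unfolding rapid_lip_def by meson
  from a obtain M where M: "\<And>\<tau> \<sigma>. cmod (a \<tau>) \<le> M \<and> cmod (a \<tau> - a \<sigma>) \<le> M * \<bar>\<tau> - \<sigma>\<bar>"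
    unfolding bounded_lip_def by blast
  have dbl: "X \<le> 2 * X" if "0 \<le> X" for X :: real using that by simp
  have M0: "0 \<le> M" using M[of 0 0] order_trans[OF norm_ge_zero] by auto
  have K0: "0 \<le> K / (1 + \<xi>\<^sup>2) ^ N" for \<xi> using K[of 0 \<xi> 0] order_trans[OF norm_ge_zero] by blast
  show "\<exists>K. \<forall>\<tau> \<sigma> \<xi>. cmod (a \<tau> * F \<tau> \<xi>) \<le> K / (1 + \<xi>\<^sup>2) ^ N \<and>
     cmod (a \<tau> * F \<tau> \<xi> - a \<sigma> * F \<sigma> \<xi>) \<le> K * \<bar>\<tau> - \<sigma>\<bar> / (1 + \<xi>\<^sup>2) ^ N"
  proof (intro exI[of _ "2 * M * K"] allI conjI)
    fix \<tau> \<sigma> \<xi> :: real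
    have "cmod (a \<tau> * F \<tau> \<xi>) \<le> M * (K / (1 + \<xi>\<^sup>2) ^ N)"
      unfolding norm_mult using M[of \<tau> 0] K[of \<tau> \<xi> 0] M0 by (intro mult_mono) auto
    also have "\<dots> \<le> 2 * (M * (K / (1 + \<xi>\<^sup>2) ^ N))" using dbl[OF mult_nonneg_nonneg[OF M0 K0[of \<xi>]]] .
    finally show "cmod (a \<tau> * F \<tau> \<xi>) \<le> 2 * M * K / (1 + \<xi>\<^sup>2) ^ N" by (simp add: mult_ac)
    have "cmod (a \<tau> * F \<tau> \<xi> - a \<sigma> * F \<sigma> \<xi>) \<le> 2 * M * (K / (1 + \<xi>\<^sup>2) ^ N) * \<bar>\<tau> - \<sigma>\<bar>"
      by (rule norm_mult_diff_le) (use M K in \<open>auto simp: mult_ac\<close>)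
    then show "cmod (a \<tau> * F \<tau> \<xi> - a \<sigma> * F \<sigma> \<xi>) \<le> 2 * M * K * \<bar>\<tau> - \<sigma>\<bar> / (1 + \<xi>\<^sup>2) ^ N"
      by (simp add: mult_ac)
  qed
qed

text \<open>The Lipschitz constant of the propagator grows like \<open>\<xi>\<^sup>2\<close>; this costs one power of \<open>1 + \<xi>\<^sup>2\<close>, which
  rapid decay affords.\<close>

lemma rapid_lip_propagator:
  assumes F: "rapid_lip F"
  shows "rapid_lip (\<lambda>\<tau> \<xi>. cis ((\<tau> - t) * \<xi>\<^sup>2) * F \<tau> \<xi>)"
  unfolding rapid_lip_def
proof
  fix N
  from F obtain K where K: "\<And>\<tau> \<sigma> \<xi>. cmod (F \<tau> \<xi>) \<le> K / (1 + \<xi>\<^sup>2) ^ Suc N \<and> cmod (F \<tau> \<xi> - F \<sigma> \<xi>) \<le> K * \<bar>\<tau> - \<sigma>\<bar> / (1 + \<xi>\<^sup>2) ^ Suc N"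
    unfolding rapid_lip_def by meson
  have K0: "0 \<le> K" using order_trans[OF norm_ge_zero, of "F 0 0" "K / (1 + 0\<^sup>2) ^ Suc N"] K[of 0 0 0] by simp
  have c: "cmod (cis ((\<tau> - t) * \<xi>\<^sup>2) - cis ((\<sigma> - t) * \<xi>\<^sup>2)) \<le> (1 + \<xi>\<^sup>2) * \<bar>\<tau> - \<sigma>\<bar>" for \<tau> \<sigma> \<xi>
  proof (rule vector_derivative_lipschitz[of UNIV])
    show "((\<lambda>\<tau>. cis ((\<tau> - t) * \<xi>\<^sup>2)) has_vector_derivative (\<i> * of_real (\<xi>\<^sup>2)) * cis ((x - t) * \<xi>\<^sup>2)) (at x)" for x
      unfolding cis_conv_exp
      by (rule derivative_eq_intros refl has_vector_derivative_real_field | simp add: algebra_simps)+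
  qed (auto simp: norm_mult norm_power)
  show "\<exists>K. \<forall>\<tau> \<sigma> \<xi>. cmod (cis ((\<tau> - t) * \<xi>\<^sup>2) * F \<tau> \<xi>) \<le> K / (1 + \<xi>\<^sup>2) ^ N \<and>
     cmod (cis ((\<tau> - t) * \<xi>\<^sup>2) * F \<tau> \<xi> - cis ((\<sigma> - t) * \<xi>\<^sup>2) * F \<sigma> \<xi>) \<le> K * \<bar>\<tau> - \<sigma>\<bar> / (1 + \<xi>\<^sup>2) ^ N"
  proof (intro exI[of _ "2 * K"] allI conjI)
    fix \<tau> \<sigma> \<xi> :: real
    let ?m = "1 + \<xi>\<^sup>2"
    note m = one_plus_sq_pos[of \<xi>]
    have "K / y ^ Suc N * y = K / y ^ N" if "y \<noteq> 0" for y :: real using that by simp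
    from this[OF m(2)] have e: "K / ?m ^ Suc N * ?m = K / ?m ^ N" .
    have le: "K / ?m ^ Suc N \<le> K / ?m ^ N"
      using m(3) K0 by (intro divide_left_mono power_increasing mult_pos_pos zero_less_power m(1)) auto
    have "cmod (cis ((\<tau> - t) * \<xi>\<^sup>2) * F \<tau> \<xi>) \<le> K / ?m ^ N"
      using K[of \<tau> \<xi> 0] le by (simp add: norm_mult)
    also have "\<dots> \<le> 2 * K / ?m ^ N" using K0 m by (intro divide_right_mono) auto
    finally show "cmod (cis ((\<tau> - t) * \<xi>\<^sup>2) * F \<tau> \<xi>) \<le> 2 * K / ?m ^ N" .
    have "cmod (cis ((\<tau> - t) * \<xi>\<^sup>2) * F \<tau> \<xi> - cis ((\<sigma> - t) * \<xi>\<^sup>2) * F \<sigma> \<xi>) \<le> 2 * ?m * (K / ?m ^ Suc N) * \<bar>\<tau> - \<sigma>\<bar>"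
      by (rule norm_mult_diff_le) (use K c[of \<tau> \<xi> \<sigma>] m in \<open>auto simp: mult_ac\<close>)
    also have "\<dots> = 2 * (K / ?m ^ Suc N * ?m) * \<bar>\<tau> - \<sigma>\<bar>" by (simp only: mult_ac)
    also have "\<dots> = 2 * K * \<bar>\<tau> - \<sigma>\<bar> / ?m ^ N" unfolding e by simp
    finally show "cmod (cis ((\<tau> - t) * \<xi>\<^sup>2) * F \<tau> \<xi> - cis ((\<sigma> - t) * \<xi>\<^sup>2) * F \<sigma> \<xi>) \<le> 2 * K * \<bar>\<tau> - \<sigma>\<bar> / ?m ^ N" .
  qed
qed

lemma rapid_lip_profile_ft:
  assumes b: "0 < b" and r: "0 \<le> r" "r < 1" and c: "\<And>t. \<bar>c t\<bar> \<le> r" "\<And>t u. \<bar>c t - c u\<bar> \<le> M * \<bar>t - u\<bar>" and k: "1 \<le> k"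
  shows "rapid_lip (\<lambda>t. profile_ft k b (c t))"
  unfolding rapid_lip_def
proof
  fix N
  obtain j where k': "k = Suc j" using k by (cases k) auto
  obtain K where K: "\<And>c \<xi>. \<bar>c\<bar> \<le> r \<Longrightarrow> cmod (profile_ft k b c \<xi>) \<le> K / (1 + \<xi>\<^sup>2) ^ N"
    using profile_ft_decay[OF b r, of b j N] unfolding k' by blast
  obtain L where L: "\<And>c c' \<xi>. \<bar>c\<bar> \<le> r \<Longrightarrow> \<bar>c'\<bar> \<le> r \<Longrightarrow> cmod (profile_ft k b c \<xi> - profile_ft k b c' \<xi>) \<le> L * \<bar>c - c'\<bar> / (1 + \<xi>\<^sup>2) ^ N"
    using profile_ft_lipschitz[OF b r, of j N] unfolding k' by blast
  show "\<exists>K. \<forall>\<tau> \<sigma> \<xi>. cmod (profile_ft k b (c \<tau>) \<xi>) \<le> K / (1 + \<xi>\<^sup>2) ^ N \<and>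
     cmod (profile_ft k b (c \<tau>) \<xi> - profile_ft k b (c \<sigma>) \<xi>) \<le> K * \<bar>\<tau> - \<sigma>\<bar> / (1 + \<xi>\<^sup>2) ^ N"
  proof (intro exI[of _ "\<bar>K\<bar> + \<bar>L\<bar> * \<bar>M\<bar>"] allI conjI)
    fix \<tau> \<sigma> \<xi> :: real
    let ?m = "1 + \<xi>\<^sup>2"
    have m: "0 < ?m ^ N" by (rule zero_less_power[OF one_plus_sq_pos(1)])
    show "cmod (profile_ft k b (c \<tau>) \<xi>) \<le> (\<bar>K\<bar> + \<bar>L\<bar> * \<bar>M\<bar>) / ?m ^ N"
      using m by (intro order_trans[OF K[OF c(1)]] divide_right_mono) (auto intro: order_trans[OF abs_ge_self])
    have "L * \<bar>c \<tau> - c \<sigma>\<bar> \<le> \<bar>L\<bar> * (\<bar>M\<bar> * \<bar>\<tau> - \<sigma>\<bar>)"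
      using c(2)[of \<tau> \<sigma>] by (intro mult_mono order_trans[OF c(2)] mult_right_mono) auto
    also have "\<dots> \<le> (\<bar>K\<bar> + \<bar>L\<bar> * \<bar>M\<bar>) * \<bar>\<tau> - \<sigma>\<bar>" unfolding mult.assoc[symmetric] by (intro mult_right_mono) auto
    finally show "cmod (profile_ft k b (c \<tau>) \<xi> - profile_ft k b (c \<sigma>) \<xi>) \<le> (\<bar>K\<bar> + \<bar>L\<bar> * \<bar>M\<bar>) * \<bar>\<tau> - \<sigma>\<bar> / ?m ^ N"
      using m by (intro order_trans[OF L[OF c(1) c(1)]] divide_right_mono) auto
  qed
qed

section \<open>Duhamel solutions from an evolution equation on the Fourier side\<close>

text \<open>The choice in \<open>free_schrodinger\<close> picks a function with the expected transform as soon as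
  one exists, and \<open>ex_inverse_fourier\<close> provides one.\<close>

lemma has_fourier_free_schrodinger:
  assumes f: "has_fourier f g" and cont: "continuous_on UNIV g" and le: "\<And>\<xi>. cmod (g \<xi>) \<le> K / (1 + \<xi>\<^sup>2)"
  shows "has_fourier (free_schrodinger t f) (\<lambda>\<xi>. cis (-(t * \<xi>\<^sup>2)) * g \<xi>)"
proof -
  let ?\<phi> = "\<lambda>\<xi>. cis (-(t * \<xi>\<^sup>2)) * g \<xi>"
  have [measurable]: "g \<in> borel_measurable borel" "fourier f \<in> borel_measurable borel"
    using f has_fourier_fourier[OF f] by (auto simp: has_fourier_iff L2_space_iff)
  have c: "continuous_on UNIV ?\<phi>" by (intro continuous_intros cont)
  have l: "cmod (?\<phi> \<xi>) \<le> K / (1 + \<xi>\<^sup>2)" for \<xi> using le by (simp add: norm_mult)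
  obtain h where h: "has_fourier h ?\<phi>"
    using ex_inverse_fourier[OF lorentz_dominated(1)[OF c l] c lorentz_dominated(2)[OF c l]] by blast
  have ae: "AE \<xi> in lborel. fourier f \<xi> = g \<xi>" by (rule has_fourier_AE_fourier[OF f])
  have "has_fourier h (\<lambda>\<xi>. cis (-(t * \<xi>\<^sup>2)) * fourier f \<xi>)"
    by (rule has_fourier_cong_AE[OF h]) (use ae in auto)
  then have "has_fourier (free_schrodinger t f) (\<lambda>\<xi>. cis (-(t * \<xi>\<^sup>2)) * fourier f \<xi>)"
    unfolding free_schrodinger_def by (rule someI[of "\<lambda>h. has_fourier h (\<lambda>\<xi>. cis (-(t * \<xi>\<^sup>2)) * fourier f \<xi>)"])
  then show ?thesis by (rule has_fourier_cong_AE) (use ae in auto)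
qed

text \<open>On each interval of the division, \<open>F\<close> differs from its linear approximation at the tag by the oscillation of
  the derivative; the increments of \<open>F\<close> telescope over the division.\<close>

lemma Riemann_sum_error_le:
  fixes F f :: "real \<Rightarrow> 'a::real_normed_vector"
  assumes d: "\<And>\<tau>. (F has_vector_derivative f \<tau>) (at \<tau>)" and L: "\<And>\<tau> \<sigma>. norm (f \<tau> - f \<sigma>) \<le> L * \<bar>\<tau> - \<sigma>\<bar>"
    and ab: "a \<le> b" and p: "p tagged_division_of {a..b}" and fine: "(\<lambda>\<tau>. ball \<tau> \<delta>) fine p"
  shows "norm ((\<Sum>(\<tau>, K)\<in>p. measure lborel K *\<^sub>R f \<tau>) - (F b - F a)) \<le> L * \<delta> * (b - a)"
proof -
  have L0: "0 \<le> L" using L[of 1 0] order_trans[OF norm_ge_zero] by auto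
  have piece: "norm (measure lborel K *\<^sub>R f \<tau> - (F (Sup K) - F (Inf K))) \<le> L * \<delta> * (Sup K - Inf K)" if mem: "(\<tau>, K) \<in> p" for \<tau> K
  proof -
    obtain u v where "K = cbox u v" using tagged_division_ofD(4)[OF p mem] by auto
    then have K: "K = {u..v}" by simp
    have \<tau>: "\<tau> \<in> {u..v}" using tagged_division_ofD(2)[OF p mem] unfolding K .
    then have uv: "u \<le> v" by auto
    have sub: "{u..v} \<subseteq> ball \<tau> \<delta>" using fine mem K by (auto simp: fine_def)
    have "norm ((F v - v *\<^sub>R f \<tau>) - (F u - u *\<^sub>R f \<tau>)) \<le> (L * \<delta>) * \<bar>v - u\<bar>"
    proof (rule vector_derivative_lipschitz[of "{u..v}"])
      show "((\<lambda>\<sigma>. F \<sigma> - \<sigma> *\<^sub>R f \<tau>) has_vector_derivative f x - f \<tau>) (at x)" for x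
        by (rule derivative_eq_intros d refl | simp)+
      show "norm (f x - f \<tau>) \<le> L * \<delta>" if "x \<in> {u..v}" for x
      proof -
        have "\<bar>x - \<tau>\<bar> \<le> \<delta>" using sub that by (auto simp: dist_real_def abs_minus_commute subset_iff less_imp_le)
        then show ?thesis using order_trans[OF L[of x \<tau>]] L0 mult_left_mono by blast
      qed
    qed (use uv in auto)
    note bnd = this
    have e: "measure lborel K *\<^sub>R f \<tau> - (F (Sup K) - F (Inf K)) = - ((F v - v *\<^sub>R f \<tau>) - (F u - u *\<^sub>R f \<tau>))"
      using uv by (simp add: K algebra_simps)
    show ?thesis unfolding e norm_minus_cancel using bnd uv by (simp only: K cSup_atLeastAtMost cInf_atLeastAtMost abs_of_nonneg diff_ge_0_iff_ge)
  qed
  have "(\<Sum>(\<tau>, K)\<in>p. measure lborel K *\<^sub>R f \<tau>) - (F b - F a)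
    = (\<Sum>(\<tau>, K)\<in>p. measure lborel K *\<^sub>R f \<tau> - (F (Sup K) - F (Inf K)))"
    unfolding additive_tagged_division_1[OF ab p, of F, symmetric] sum_subtractf[symmetric]
    by (intro sum.cong) auto
  also have "norm \<dots> \<le> (\<Sum>(\<tau>, K)\<in>p. L * \<delta> * (Sup K - Inf K))"
    by (intro sum_norm_le) (use piece in auto)
  also have "\<dots> = L * \<delta> * (\<Sum>(\<tau>, K)\<in>p. Sup K - Inf K)"
    unfolding sum_distrib_left by (intro sum.cong) auto
  also have "(\<Sum>(\<tau>, K)\<in>p. Sup K - Inf K) = b - a"
    using additive_tagged_division_1[OF ab p, of "\<lambda>x. x"] by simp
  finally show ?thesis .
qed

lemma oriented_Riemann_sum_error_le:
  fixes F f :: "real \<Rightarrow> 'a::real_normed_vector"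
  assumes d: "\<And>\<tau>. (F has_vector_derivative f \<tau>) (at \<tau>)" and L: "\<And>\<tau> \<sigma>. norm (f \<tau> - f \<sigma>) \<le> L * \<bar>\<tau> - \<sigma>\<bar>"
    and p: "p tagged_division_of (closed_segment a b)" and fine: "(\<lambda>\<tau>. ball \<tau> \<delta>) fine p"
  shows "norm ((\<Sum>(\<tau>, K)\<in>p. (sgn (b - a) * measure lborel K) *\<^sub>R f \<tau>) - (F b - F a)) \<le> L * \<delta> * \<bar>b - a\<bar>"
proof -
  have s: "(\<Sum>(\<tau>, K)\<in>p. (sgn (b - a) * measure lborel K) *\<^sub>R f \<tau>) = sgn (b - a) *\<^sub>R (\<Sum>(\<tau>, K)\<in>p. measure lborel K *\<^sub>R f \<tau>)"
    unfolding scaleR_sum_right by (intro sum.cong) auto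
  consider "a < b" | "a = b" | "b < a" by linarith
  then show ?thesis
  proof cases
    case 1
    with p have "p tagged_division_of {a..b}" by (simp add: closed_segment_eq_real_ivl)
    from Riemann_sum_error_le[OF d L _ this fine] 1 show ?thesis unfolding s by simp
  next
    case 2 then show ?thesis unfolding s by simp
  next
    case 3
    with p have "p tagged_division_of {b..a}" by (simp add: closed_segment_eq_real_ivl)
    from Riemann_sum_error_le[OF d L _ this fine] 3
    have "norm ((\<Sum>(\<tau>, K)\<in>p. measure lborel K *\<^sub>R f \<tau>) - (F a - F b)) \<le> L * \<delta> * (a - b)" by simp
    moreover have "(- (\<Sum>(\<tau>, K)\<in>p. measure lborel K *\<^sub>R f \<tau>)) - (F b - F a) = - ((\<Sum>(\<tau>, K)\<in>p. measure lborel K *\<^sub>R f \<tau>) - (F a - F b))"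
      by simp
    ultimately have "norm ((- (\<Sum>(\<tau>, K)\<in>p. measure lborel K *\<^sub>R f \<tau>)) - (F b - F a)) \<le> L * \<delta> * (a - b)"
      by (simp only: norm_minus_cancel)
    moreover have "sgn (b - a) = -1" "\<bar>b - a\<bar> = a - b" using 3 by auto
    ultimately show ?thesis unfolding s by (simp only: scaleR_minus_left scaleR_one)
  qed
qed

text \<open>Duhamel's formula becomes the fundamental theorem of calculus: for each \<open>\<xi>\<close>, the transformed integrand
  \<open>H \<tau> \<xi> = cis ((\<tau> - t) * \<xi>\<^sup>2) * Nh \<tau> \<xi>\<close> is the derivative in \<open>\<tau>\<close> of
  \<open>V \<tau> \<xi> = \<i> * cis ((\<tau> - t) * \<xi>\<^sup>2) * Wh \<tau> \<xi>\<close>. The value of the integral is therefore prescribed as the function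
  \<open>v\<close> that solves Duhamel's formula, its transform is the increment of \<open>V\<close>, and only the convergence of the
  Riemann sums to it has to be checked, which is done separately for each \<open>\<xi>\<close>.\<close>

lemma pert_solution_from_fourier:
  assumes W: "\<And>t. has_fourier (W t) (Wh t)"
    and NL: "\<And>t. has_fourier (\<lambda>x. G (W t x) - 2 * of_real (Re (W t x))) (Nh t)"
    and rW: "rapid_lip Wh" and rN: "rapid_lip Nh"
    and cW: "\<And>t. continuous_on UNIV (Wh t)" and cN: "\<And>t. continuous_on UNIV (Nh t)"
    and ev: "\<And>t \<xi>. \<exists>D. ((\<lambda>t. Wh t \<xi>) has_vector_derivative D) (at t) \<and> \<i> * D - of_real (\<xi>\<^sup>2) * Wh t \<xi> = Nh t \<xi>"
  shows "pert_solution s t0 (W t0) UNIV W"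
proof -
  obtain N :: nat where "(s + 1) / 2 \<le> real N" using real_arch_simple by blast
  then have N: "s + 1 \<le> 2 * real N" by simp
  obtain K where K: "\<And>\<tau> \<sigma> \<xi>. cmod (Wh \<tau> \<xi>) \<le> K / (1 + \<xi>\<^sup>2) ^ N \<and> cmod (Wh \<tau> \<xi> - Wh \<sigma> \<xi>) \<le> K * \<bar>\<tau> - \<sigma>\<bar> / (1 + \<xi>\<^sup>2) ^ N"
    using rW unfolding rapid_lip_def by meson
  obtain K1 where K1: "\<And>\<tau> \<xi>. cmod (Wh \<tau> \<xi>) \<le> K1 / (1 + \<xi>\<^sup>2) ^ 1"
    using rW unfolding rapid_lip_def by meson
  obtain K2 where K2: "\<And>\<tau> \<xi>. cmod (Nh \<tau> \<xi>) \<le> K2 / (1 + \<xi>\<^sup>2) ^ 1"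
    using rN unfolding rapid_lip_def by meson
  have WH: "W t \<in> Hs s" for t by (rule Hs_bound(1)[OF W _ N]) (use K in blast)
  have cont: "((\<lambda>\<tau>. Hs_norm s (\<lambda>x. W \<tau> x - W t x)) \<longlongrightarrow> 0) (at t within UNIV)" for t
  proof -
    have le: "Hs_norm s (\<lambda>x. W \<tau> x - W t x) \<le> K * \<bar>\<tau> - t\<bar>" for \<tau>
      using has_fourier_lincomb[OF W[of \<tau>] W[of t], of 1 "-1"] K
      by (intro Hs_bound(2)[OF _ _ N, where g="\<lambda>\<xi>. Wh \<tau> \<xi> - Wh t \<xi>"]) auto
    have "((\<lambda>\<tau>. K * \<bar>\<tau> - t\<bar>) \<longlongrightarrow> K * \<bar>t - t\<bar>) (at t within UNIV)" by (intro tendsto_intros)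
    then have lim: "((\<lambda>\<tau>. K * \<bar>\<tau> - t\<bar>) \<longlongrightarrow> 0) (at t within UNIV)" by simp
    show ?thesis
      by (rule tendsto_sandwich[OF always_eventually always_eventually tendsto_const lim]) (simp_all add: le Hs_norm_nonneg)
  qed
  have duh: "\<exists>v. has_Hs_integral s (\<lambda>\<tau>. free_schrodinger (t - \<tau>) (\<lambda>x. G (W \<tau> x) - 2 * of_real (Re (W \<tau> x)))) t0 t v \<and>
        (AE x in lborel. W t x = free_schrodinger (t - t0) (W t0) x - \<i> * v x)" for t
  proof -
    define h where "h \<tau> = free_schrodinger (t - \<tau>) (\<lambda>x. G (W \<tau> x) - 2 * of_real (Re (W \<tau> x)))" for \<tau>
    define H where "H \<tau> \<xi> = cis ((\<tau> - t) * \<xi>\<^sup>2) * Nh \<tau> \<xi>" for \<tau> \<xi>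
    define V where "V \<tau> \<xi> = \<i> * (cis ((\<tau> - t) * \<xi>\<^sup>2) * Wh \<tau> \<xi>)" for \<tau> \<xi>
    define v where "v x = \<i> * W t x + (- \<i>) * free_schrodinger (t - t0) (W t0) x" for x
    have m: "- ((t - \<tau>) * \<xi>\<^sup>2) = (\<tau> - t) * \<xi>\<^sup>2" for \<tau> \<xi> :: real by (simp add: algebra_simps)
    have hH: "has_fourier (h \<tau>) (H \<tau>)" for \<tau>
      using has_fourier_free_schrodinger[OF NL cN, of \<tau> K2 "t - \<tau>"] K2 unfolding h_def H_def m by simp
    have "has_fourier (free_schrodinger (t - t0) (W t0)) (\<lambda>\<xi>. cis ((t0 - t) * \<xi>\<^sup>2) * Wh t0 \<xi>)"
      using has_fourier_free_schrodinger[OF W cW, of t0 K1 "t - t0"] K1 unfolding m by simp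
    from has_fourier_lincomb[OF W[of t] this, of \<i> "- \<i>"]
    have vV: "has_fourier v (\<lambda>\<xi>. V t \<xi> - V t0 \<xi>)" unfolding v_def[abs_def] V_def by simp
    have rH: "rapid_lip H" unfolding H_def[abs_def] by (rule rapid_lip_propagator[OF rN])
    have rV: "rapid_lip V"
      unfolding V_def[abs_def] by (intro rapid_lip_mult bounded_lip_const rapid_lip_propagator rW)
    obtain A where A: "\<And>\<tau> \<sigma> \<xi>. cmod (H \<tau> \<xi>) \<le> A / (1 + \<xi>\<^sup>2) ^ N \<and> cmod (H \<tau> \<xi> - H \<sigma> \<xi>) \<le> A * \<bar>\<tau> - \<sigma>\<bar> / (1 + \<xi>\<^sup>2) ^ N"
      using rH unfolding rapid_lip_def by meson
    have A0: "0 \<le> A" using order_trans[OF norm_ge_zero, of "H 0 0" "A / (1 + 0\<^sup>2) ^ N"] A[of 0 0 0] by simp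
    obtain B where B: "\<And>\<tau> \<sigma> \<xi>. cmod (V \<tau> \<xi> - V \<sigma> \<xi>) \<le> B * \<bar>\<tau> - \<sigma>\<bar> / (1 + \<xi>\<^sup>2) ^ N"
      using rV unfolding rapid_lip_def by meson
    have dV: "((\<lambda>\<tau>. V \<tau> \<xi>) has_vector_derivative H \<tau> \<xi>) (at \<tau>)" for \<tau> \<xi>
    proof -
      obtain D where D: "((\<lambda>t. Wh t \<xi>) has_vector_derivative D) (at \<tau>)" "\<i> * D - of_real (\<xi>\<^sup>2) * Wh \<tau> \<xi> = Nh \<tau> \<xi>"
        using ev by blast
      have "((\<lambda>\<tau>. V \<tau> \<xi>) has_vector_derivative
          \<i> * (cis ((\<tau> - t) * \<xi>\<^sup>2) * D + \<i> * of_real (\<xi>\<^sup>2) * cis ((\<tau> - t) * \<xi>\<^sup>2) * Wh \<tau> \<xi>)) (at \<tau>)"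
        unfolding V_def cis_conv_exp
        by (rule derivative_eq_intros refl has_vector_derivative_real_field D(1) | simp add: algebra_simps)+
      moreover have "\<i> * (cis ((\<tau> - t) * \<xi>\<^sup>2) * D + \<i> * of_real (\<xi>\<^sup>2) * cis ((\<tau> - t) * \<xi>\<^sup>2) * Wh \<tau> \<xi>)
         = cis ((\<tau> - t) * \<xi>\<^sup>2) * (\<i> * D + (\<i> * \<i>) * of_real (\<xi>\<^sup>2) * Wh \<tau> \<xi>)" by (simp only: algebra_simps)
      ultimately show ?thesis unfolding H_def D(2)[symmetric] by simp
    qed
    have int: "has_Hs_integral s h t0 t v"
      unfolding has_Hs_integral_def
    proof (intro conjI ballI allI impI)
      show "h \<tau> \<in> Hs s" for \<tau> by (rule Hs_bound(1)[OF hH _ N]) (use A in blast)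
      show "v \<in> Hs s" by (rule Hs_bound(1)[OF vV _ N]) (use B in blast)
      fix e :: real assume e: "0 < e"
      \<comment> \<open>Riemann sums of mesh \<open>\<delta>\<close> are off by at most \<open>A * \<delta> * \<bar>t - t0\<bar>\<close>; the summand \<open>1\<close> covers \<open>t = t0\<close>.\<close>
      define \<delta> where "\<delta> = e / (2 * (A * \<bar>t - t0\<bar> + 1))"
      have den: "0 < A * \<bar>t - t0\<bar> + 1" using A0 by (simp add: add_nonneg_pos)
      have \<delta>: "0 < \<delta>" "A * \<delta> * \<bar>t - t0\<bar> < e"
      proof -
        have cancel: "Z * (e / (2 * Z)) = e / 2" if "0 < Z" for Z using that by (simp add: field_simps)
        show "0 < \<delta>" using e den by (simp add: \<delta>_def)
        have "(A * \<bar>t - t0\<bar>) * \<delta> \<le> (A * \<bar>t - t0\<bar> + 1) * \<delta>" using \<open>0 < \<delta>\<close> by (intro mult_right_mono) auto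
        also have "\<dots> = e / 2" using cancel[OF den] unfolding \<delta>_def .
        finally show "A * \<delta> * \<bar>t - t0\<bar> < e" using e by (simp add: mult_ac)
      qed
      show "\<exists>d>0. \<forall>p. p tagged_division_of closed_segment t0 t \<and> (\<lambda>\<tau>. ball \<tau> d) fine p \<longrightarrow>
        Hs_norm s (\<lambda>x. (\<Sum>(\<tau>, K)\<in>p. of_real (sgn (t - t0) * measure lborel K) * h \<tau> x) - v x) < e"
      proof (intro exI[of _ \<delta>] conjI allI impI \<delta>(1))
        fix p assume p: "p tagged_division_of closed_segment t0 t \<and> (\<lambda>\<tau>. ball \<tau> \<delta>) fine p"
        then have fin: "finite p" by blast
        let ?c = "\<lambda>i. complex_of_real (sgn (t - t0) * measure lborel (snd i))"
        have "has_fourier (\<lambda>x. \<Sum>i\<in>p. ?c i * h (fst i) x) (\<lambda>\<xi>. \<Sum>i\<in>p. ?c i * H (fst i) \<xi>)"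
          by (rule has_fourier_sum[OF fin hH])
        from has_fourier_diff[OF this vV]
        have F: "has_fourier (\<lambda>x. (\<Sum>(\<tau>, K)\<in>p. of_real (sgn (t - t0) * measure lborel K) * h \<tau> x) - v x)
           (\<lambda>\<xi>. (\<Sum>(\<tau>, K)\<in>p. (sgn (t - t0) * measure lborel K) *\<^sub>R H \<tau> \<xi>) - (V t \<xi> - V t0 \<xi>))"
          by (simp only: case_prod_unfold scaleR_conv_of_real)
        have "Hs_norm s (\<lambda>x. (\<Sum>(\<tau>, K)\<in>p. of_real (sgn (t - t0) * measure lborel K) * h \<tau> x) - v x) \<le> A * \<delta> * \<bar>t - t0\<bar>"
        proof (rule Hs_bound(2)[OF F _ N])
          fix \<xi>
          have "cmod ((\<Sum>(\<tau>, K)\<in>p. (sgn (t - t0) * measure lborel K) *\<^sub>R H \<tau> \<xi>) - (V t \<xi> - V t0 \<xi>)) \<le> A / (1 + \<xi>\<^sup>2) ^ N * \<delta> * \<bar>t - t0\<bar>"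
          proof (rule oriented_Riemann_sum_error_le[OF dV])
            show "cmod (H \<tau> \<xi> - H \<sigma> \<xi>) \<le> A / (1 + \<xi>\<^sup>2) ^ N * \<bar>\<tau> - \<sigma>\<bar>" for \<tau> \<sigma> using A[of \<tau> \<xi> \<sigma>] by simp
          qed (use p in auto)
          then show "cmod ((\<Sum>(\<tau>, K)\<in>p. (sgn (t - t0) * measure lborel K) *\<^sub>R H \<tau> \<xi>) - (V t \<xi> - V t0 \<xi>)) \<le> A * \<delta> * \<bar>t - t0\<bar> / (1 + \<xi>\<^sup>2) ^ N"
            by (simp add: mult_ac)
        qed
        then show "Hs_norm s (\<lambda>x. (\<Sum>(\<tau>, K)\<in>p. of_real (sgn (t - t0) * measure lborel K) * h \<tau> x) - v x) < e"
          using \<delta>(2) by simp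
      qed
    qed
    have "W t x = free_schrodinger (t - t0) (W t0) x - \<i> * v x" for x
    proof -
      have "\<i> * v x = (\<i> * \<i>) * (W t x - free_schrodinger (t - t0) (W t0) x)" unfolding v_def by (simp add: algebra_simps)
      then show ?thesis by simp
    qed
    with int show ?thesis unfolding h_def[abs_def] by blast
  qed
  show ?thesis unfolding pert_solution_def using WH cont duh by auto
qed

section \<open>The breather of frequency w\<close>

text \<open>The inverse width \<open>b\<close> as a function of the frequency; it solves \<open>w\<^sup>2 = b\<^sup>2 * (b\<^sup>2 + 2)\<close>. In terms of the
  parameter \<open>a\<close> of the breather, \<open>sqrt (1 + w\<^sup>2) = 4 * a - 1\<close>.\<close>

definition width :: "real \<Rightarrow> real" where
  "width w = sqrt (sqrt (1 + w\<^sup>2) - 1)"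

text \<open>The amplitude of the oscillation of the coefficient \<open>c\<close> in the profile.\<close>

definition depth :: "real \<Rightarrow> real" where
  "depth w = sqrt 2 * width w / w"

definition amp :: "real \<Rightarrow> real \<Rightarrow> complex" where
  "amp w t = - of_real (depth w) * (of_real ((width w)\<^sup>2 * cos (w * t)) + \<i> * of_real (w * sin (w * t)))"

definition osc :: "real \<Rightarrow> real \<Rightarrow> real" where
  "osc w t = depth w * cos (w * t)"

definition breather :: "real \<Rightarrow> real \<Rightarrow> real \<Rightarrow> complex" where
  "breather w t x = amp w t * of_real (profile (width w) (osc w t) x)"

lemma width_sq: "(width w)\<^sup>2 = sqrt (1 + w\<^sup>2) - 1"
  unfolding width_def by (simp add: real_le_rsqrt)

lemma dispersion: "w\<^sup>2 = (width w)\<^sup>2 * ((width w)\<^sup>2 + 2)"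
  by (simp add: width_sq algebra_simps flip: power2_eq_square)

lemma width_pos: "0 < w \<Longrightarrow> 0 < width w"
  unfolding width_def by (simp add: real_less_rsqrt)

lemma width_mono: "0 \<le> v \<Longrightarrow> v \<le> w \<Longrightarrow> width v \<le> width w"
  unfolding width_def by (simp add: power_mono)

lemma depth_pos: "0 < w \<Longrightarrow> 0 < depth w"
  unfolding depth_def using width_pos by simp

lemma depth_sq:
  assumes "0 < w"
  shows "(depth w)\<^sup>2 = 2 / ((width w)\<^sup>2 + 2)"
proof -
  have "0 < (width w)\<^sup>2" using width_pos[OF assms] by simp
  then have "2 * (width w)\<^sup>2 / ((width w)\<^sup>2 * ((width w)\<^sup>2 + 2)) = 2 / ((width w)\<^sup>2 + 2)" by simp
  then show ?thesis
    unfolding depth_def power_divide power_mult_distrib dispersion[of w] by simp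
qed

lemma depth_antimono:
  assumes "0 < v" "v \<le> w"
  shows "depth w \<le> depth v"
proof (rule power2_le_imp_le)
  have "(width v)\<^sup>2 \<le> (width w)\<^sup>2" using width_mono[of v w] width_pos[of v] assms by (intro power_mono) auto
  moreover have "0 \<le> (width v)\<^sup>2" by simp
  ultimately show "(depth w)\<^sup>2 \<le> (depth v)\<^sup>2"
    using assms by (simp only: depth_sq) (intro divide_left_mono mult_pos_pos add_nonneg_pos; simp)
  show "0 \<le> depth v" using depth_pos assms by (simp add: less_imp_le)
qed

lemma depth_less_1: "0 < w \<Longrightarrow> depth w < 1"
  using width_pos[of w] by (intro power2_less_imp_less[of "depth w" 1]) (simp_all add: depth_sq divide_less_eq add_pos_pos)

lemma osc_le: "0 < w \<Longrightarrow> \<bar>osc w t\<bar> \<le> depth w"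
  unfolding osc_def abs_mult using depth_pos[of w] abs_cos_le_one[of "w * t"]
  by (simp add: mult_left_le)

lemma osc_deriv: "(osc w has_real_derivative - depth w * w * sin (w * t)) (at t)"
  unfolding osc_def[abs_def] by (auto intro!: derivative_eq_intros)

text \<open>The time derivative of \<open>amp\<close>.\<close>

definition amp' :: "real \<Rightarrow> real \<Rightarrow> complex" where
  "amp' w t = - of_real (depth w) * (of_real (- (width w)\<^sup>2 * w * sin (w * t)) + \<i> * of_real (w\<^sup>2 * cos (w * t)))"

lemma amp_deriv: "(amp w has_vector_derivative amp' w t) (at t)"
proof -
  have 1: "((\<lambda>t. complex_of_real ((width w)\<^sup>2 * cos (w * t))) has_vector_derivative of_real (- (width w)\<^sup>2 * w * sin (w * t))) (at t)"
    by (rule has_vector_derivative_of_real) (auto intro!: derivative_eq_intros)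
  have 2: "((\<lambda>t. complex_of_real (w * sin (w * t))) has_vector_derivative of_real (w\<^sup>2 * cos (w * t))) (at t)"
    by (rule has_vector_derivative_of_real) (auto intro!: derivative_eq_intros simp: power2_eq_square)
  show ?thesis
    unfolding amp_def[abs_def] amp'_def
    by (intro has_vector_derivative_mult_right has_vector_derivative_add 1 2)
qed

lemma amp_Re_Im:
  "Re (amp w t) = - depth w * ((width w)\<^sup>2 * cos (w * t))" "Im (amp w t) = - depth w * (w * sin (w * t))"
  by (simp_all add: amp_def)

lemma amp'_Re_Im:
  "Re (amp' w t) = depth w * ((width w)\<^sup>2 * w * sin (w * t))" "Im (amp' w t) = - depth w * (w\<^sup>2 * cos (w * t))"
  by (simp_all add: amp'_def)

text \<open>The coefficients of \<open>p\<close>, \<open>p\<^sup>2\<close> and \<open>p ^ 3\<close> in \<open>G (z * p) - 2 * Re (z * p)\<close> for real \<open>p\<close>, see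
  \<open>nonlinearity_expand\<close>.\<close>

definition nl1 :: "complex \<Rightarrow> complex" where "nl1 z = - (z + cnj z)"
definition nl2 :: "complex \<Rightarrow> complex" where "nl2 z = - (2 * (z * cnj z) + z * z)"
definition nl3 :: "complex \<Rightarrow> complex" where "nl3 z = - ((z * cnj z) * z)"

lemma of_real_cmod_sq: "(complex_of_real (cmod z))\<^sup>2 = z * cnj z"
  by (simp add: complex_norm_square del: of_real_power flip: of_real_power)

lemma nonlinearity_expand:
  "G (z * of_real p) - 2 * of_real (Re (z * of_real p)) = nl1 z * of_real p + nl2 z * of_real (p ^ 2) + nl3 z * of_real (p ^ 3)"
proof -
  have "2 * complex_of_real (Re (z * of_real p)) = z * of_real p + cnj (z * of_real p)"
    by (simp only: complex_add_cnj of_real_mult of_real_numeral)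
  then show ?thesis
    unfolding G_def of_real_cmod_sq nl1_def nl2_def nl3_def by (simp add: power2_eq_square power3_eq_cube algebra_simps)
qed

text \<open>The equation for the perturbation, sorted by powers of the profile. The first and the third identity use
  the dispersion relation; the third one amounts to \<open>cmod (amp w t) ^ 2 = 2 * (width w)\<^sup>2 * (1 - (osc w t)\<^sup>2)\<close>.\<close>

lemma amp_evolution:
  assumes w: "0 < w"
  shows "\<i> * amp' w t + of_real ((width w)\<^sup>2) * amp w t = nl1 (amp w t)"
    and "\<i> * amp w t * of_real (- depth w * w * sin (w * t)) + 3 * of_real ((width w)\<^sup>2 * osc w t) * amp w t = nl2 (amp w t)"
    and "2 * of_real ((width w)\<^sup>2 * ((osc w t)\<^sup>2 - 1)) * amp w t = nl3 (amp w t)"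
proof -
  let ?b = "width w" and ?k = "depth w" and ?C = "cos (w * t)" and ?S = "sin (w * t)"
  note d = dispersion[of w]
  show "\<i> * amp' w t + of_real (?b\<^sup>2) * amp w t = nl1 (amp w t)"
    by (simp add: complex_eq_iff amp_Re_Im amp'_Re_Im nl1_def d) (simp add: power2_eq_square algebra_simps)
  show "\<i> * amp w t * of_real (- ?k * w * ?S) + 3 * of_real (?b\<^sup>2 * osc w t) * amp w t = nl2 (amp w t)"
    by (simp add: complex_eq_iff amp_Re_Im nl2_def osc_def)
  have "amp w t * cnj (amp w t) = of_real ((Re (amp w t))\<^sup>2 + (Im (amp w t))\<^sup>2)" by (rule complex_mult_cnj)
  also have "(Re (amp w t))\<^sup>2 + (Im (amp w t))\<^sup>2 = ?k\<^sup>2 * ((?b\<^sup>2)\<^sup>2 * ?C\<^sup>2 + w\<^sup>2 * ?S\<^sup>2)"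
    unfolding amp_Re_Im by (simp add: power_mult_distrib algebra_simps)
  also have "\<dots> = ?k\<^sup>2 * (?b\<^sup>2 * (?b\<^sup>2 + 2) - 2 * ?b\<^sup>2 * ?C\<^sup>2)"
    unfolding d sin_squared_eq by (simp add: algebra_simps power2_eq_square)
  also have "\<dots> = 2 * (?b\<^sup>2 * (1 - (osc w t)\<^sup>2))"
  proof -
    have "?b\<^sup>2 + 2 \<noteq> 0" using zero_le_power2[of ?b] by linarith
    from nonzero_eq_divide_eq[OF this] have "?k\<^sup>2 * (?b\<^sup>2 + 2) = 2" using depth_sq[OF w] by blast
    then have "?b\<^sup>2 * (?k\<^sup>2 * (?b\<^sup>2 + 2)) = ?b\<^sup>2 * 2" by simp
    then show ?thesis by (simp add: osc_def power_mult_distrib algebra_simps)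
  qed
  finally have modulus: "amp w t * cnj (amp w t) = of_real (2 * (?b\<^sup>2 * (1 - (osc w t)\<^sup>2)))" .
  show "2 * of_real (?b\<^sup>2 * ((osc w t)\<^sup>2 - 1)) * amp w t = nl3 (amp w t)"
    unfolding nl3_def modulus by (simp add: algebra_simps)
qed

lemma bounded_lip_amp: "bounded_lip (amp w)"
  unfolding amp_def[abs_def] of_real_mult
  by (intro bounded_lip_mult bounded_lip_add bounded_lip_const bounded_lip_trig)

lemma bounded_lip_nl:
  "bounded_lip (\<lambda>t. nl1 (amp w t))" "bounded_lip (\<lambda>t. nl2 (amp w t))" "bounded_lip (\<lambda>t. nl3 (amp w t))"
proof -
  have m: "- z = (-1) * z" for z :: complex by simp
  note i = bounded_lip_mult bounded_lip_add bounded_lip_const bounded_lip_amp bounded_lip_cnj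
  show "bounded_lip (\<lambda>t. nl1 (amp w t))" unfolding nl1_def m[of "_ + _"] by (intro i)
  show "bounded_lip (\<lambda>t. nl2 (amp w t))" unfolding nl2_def m[of "_ + _"] by (intro i)
  show "bounded_lip (\<lambda>t. nl3 (amp w t))" unfolding nl3_def m[of "_ * _"] by (intro i)
qed

text \<open>The time derivative of the transform and the recursion for \<open>\<xi>\<^sup>2\<close> times it produce only the
  transforms of the first three powers of the profile; \<open>amp_evolution\<close> matches their coefficients with those of the
  nonlinearity.\<close>

lemma breather_pert_solution:
  assumes w: "0 < w"
  shows "pert_solution s t0 (breather w t0) UNIV (breather w)"
proof -
  note b = width_pos[OF w]
  have r: "0 \<le> depth w" "depth w < 1" using depth_pos[OF w] depth_less_1[OF w] by auto
  note o = osc_le[OF w]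
  note bb = b r order_refl[of "width w"]
  let ?q = "\<lambda>k t. profile_ft k (width w) (osc w t)"
  let ?p = "\<lambda>k t x. complex_of_real (profile (width w) (osc w t) x ^ k)"
  have hf: "has_fourier (?p k t) (?q k t)" if "1 \<le> k" for k t
    by (rule profile_power_fourier(3)[OF bb o that])
  have cq: "continuous_on UNIV (?q k t)" if "1 \<le> k" for k t
    unfolding profile_ft_def by (rule continuous_ft[OF profile_power_fourier(1)[OF bb o that]])
  have ol: "\<bar>osc w t - osc w u\<bar> \<le> depth w * w * \<bar>t - u\<bar>" for t u
  proof -
    have "norm (osc w t - osc w u) \<le> (depth w * w) * \<bar>t - u\<bar>"
    proof (rule vector_derivative_lipschitz[OF convex_UNIV])
      show "(osc w has_vector_derivative - depth w * w * sin (w * x)) (at x)" for x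
        using osc_deriv by (simp add: has_real_derivative_iff_has_vector_derivative)
      show "norm (- depth w * w * sin (w * x)) \<le> depth w * w" for x
        using r w by (simp add: abs_mult mult_left_le)
    qed auto
    then show ?thesis by simp
  qed
  have rl: "rapid_lip (?q k)" if "1 \<le> k" for k
    by (rule rapid_lip_profile_ft[OF b r o ol that])
  show ?thesis
  proof (rule pert_solution_from_fourier[where Wh="\<lambda>t \<xi>. amp w t * ?q 1 t \<xi>" and
        Nh="\<lambda>t \<xi>. nl1 (amp w t) * ?q 1 t \<xi> + nl2 (amp w t) * ?q 2 t \<xi> + nl3 (amp w t) * ?q 3 t \<xi>"])
    fix t
    show "has_fourier (breather w t) (\<lambda>\<xi>. amp w t * ?q 1 t \<xi>)"
      using has_fourier_lincomb[OF hf[of 1 t] has_fourier_0, of "amp w t" 0] by (simp add: breather_def[abs_def])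
    have "has_fourier (\<lambda>x. nl1 (amp w t) * ?p 1 t x + nl2 (amp w t) * ?p 2 t x)
       (\<lambda>\<xi>. nl1 (amp w t) * ?q 1 t \<xi> + nl2 (amp w t) * ?q 2 t \<xi>)"
      by (intro has_fourier_lincomb hf) simp_all
    from has_fourier_lincomb[OF this hf[of 3 t], of 1 "nl3 (amp w t)"]
    show "has_fourier (\<lambda>x. G (breather w t x) - 2 * of_real (Re (breather w t x)))
      (\<lambda>\<xi>. nl1 (amp w t) * ?q 1 t \<xi> + nl2 (amp w t) * ?q 2 t \<xi> + nl3 (amp w t) * ?q 3 t \<xi>)"
      unfolding breather_def nonlinearity_expand by simp
    show "continuous_on UNIV (\<lambda>\<xi>. amp w t * ?q 1 t \<xi>)"
      by (intro continuous_intros cq) simp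
    show "continuous_on UNIV (\<lambda>\<xi>. nl1 (amp w t) * ?q 1 t \<xi> + nl2 (amp w t) * ?q 2 t \<xi> + nl3 (amp w t) * ?q 3 t \<xi>)"
      by (intro continuous_intros cq) simp_all
  next
    show "rapid_lip (\<lambda>t \<xi>. amp w t * ?q 1 t \<xi>)"
      by (intro rapid_lip_mult bounded_lip_amp rl) simp
    show "rapid_lip (\<lambda>t \<xi>. nl1 (amp w t) * ?q 1 t \<xi> + nl2 (amp w t) * ?q 2 t \<xi> + nl3 (amp w t) * ?q 3 t \<xi>)"
      by (intro rapid_lip_add rapid_lip_mult bounded_lip_nl rl) simp_all
  next
    fix t \<xi>
    let ?o' = "- depth w * w * sin (w * t)"
    have "((\<lambda>t. ?q 1 t \<xi>) has_vector_derivative ?o' *\<^sub>R (of_nat 1 * ?q (1 + 1) t \<xi>)) (at t)"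
      using vector_diff_chain_at[OF osc_deriv[of w t, unfolded has_real_derivative_iff_has_vector_derivative]
          profile_ft_has_vector_derivative[OF b, of "osc w t" 1 \<xi>]] o[of t] r
      by (simp add: o_def)
    from has_vector_derivative_mult[OF amp_deriv[of w t] this]
    have D: "((\<lambda>t. amp w t * ?q 1 t \<xi>) has_vector_derivative
       (amp w t * (of_real ?o' * ?q 2 t \<xi>) + amp' w t * ?q 1 t \<xi>)) (at t)"
      by (simp add: scaleR_conv_of_real numeral_2_eq_2)
    have rec: "- (of_real (\<xi>\<^sup>2) * ?q 1 t \<xi>) = of_real ((width w)\<^sup>2) * (?q 1 t \<xi> + 3 * of_real (osc w t) * ?q 2 t \<xi>
        + 2 * of_real ((osc w t)\<^sup>2 - 1) * ?q 3 t \<xi>)"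
      using profile_ft_recursion[OF bb o, of 1 \<xi> t] by (simp add: numeral_2_eq_2 numeral_3_eq_3)
    have "\<i> * (amp w t * (of_real ?o' * ?q 2 t \<xi>) + amp' w t * ?q 1 t \<xi>) - of_real (\<xi>\<^sup>2) * (amp w t * ?q 1 t \<xi>)
       = \<i> * (amp w t * (of_real ?o' * ?q 2 t \<xi>) + amp' w t * ?q 1 t \<xi>) + amp w t * (- (of_real (\<xi>\<^sup>2) * ?q 1 t \<xi>))"
      by (simp add: algebra_simps)
    also have "\<dots> = (\<i> * amp' w t + of_real ((width w)\<^sup>2) * amp w t) * ?q 1 t \<xi>
       + (\<i> * amp w t * of_real ?o' + 3 * of_real ((width w)\<^sup>2 * osc w t) * amp w t) * ?q 2 t \<xi>
       + (2 * of_real ((width w)\<^sup>2 * ((osc w t)\<^sup>2 - 1)) * amp w t) * ?q 3 t \<xi>"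
      unfolding rec of_real_mult by (simp add: algebra_simps)
    also have "\<dots> = nl1 (amp w t) * ?q 1 t \<xi> + nl2 (amp w t) * ?q 2 t \<xi> + nl3 (amp w t) * ?q 3 t \<xi>"
      unfolding amp_evolution[OF w] ..
    finally show "\<exists>D. ((\<lambda>t. amp w t * ?q 1 t \<xi>) has_vector_derivative D) (at t) \<and>
        \<i> * D - of_real (\<xi>\<^sup>2) * (amp w t * ?q 1 t \<xi>) = nl1 (amp w t) * ?q 1 t \<xi> + nl2 (amp w t) * ?q 2 t \<xi> + nl3 (amp w t) * ?q 3 t \<xi>"
      using D by blast
  qed
qed

text \<open>The same matching of coefficients, now with the profile itself in place of its transform.\<close>

lemma breather_classical:
  assumes w: "0 < w"
  shows "classical_NLS_solution (\<lambda>t x. cis t * (1 + breather w t x))"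
  unfolding classical_NLS_solution_def
proof (rule exI, rule exI, rule exI, intro allI)
  fix t x
  let ?b = "width w" and ?g = "osc w t" and ?E = "amp w t"
  have r: "0 \<le> depth w" "depth w < 1" using depth_pos[OF w] depth_less_1[OF w] by auto
  note o = osc_le[OF w]
  note bb = width_pos[OF w] r order_refl[of ?b]
  let ?P = "\<lambda>t x. profile ?b (osc w t) x"
  let ?o' = "\<lambda>t. - depth w * w * sin (w * t)"
  let ?Pxx = "\<lambda>t x. ?b\<^sup>2 * (?P t x + 3 * osc w t * ?P t x ^ 2 + 2 * ((osc w t)\<^sup>2 - 1) * ?P t x ^ 3)"
  let ?ut = "\<lambda>t x. \<i> * cis t * (1 + breather w t x) + cis t * (amp' w t * of_real (?P t x) + amp w t * of_real (?o' t * ?P t x ^ 2))"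
  let ?ux = "\<lambda>t x. cis t * amp w t * of_real (- (?b * sinh (?b * x) * ?P t x ^ 2))"
  let ?uxx = "\<lambda>t x. cis t * amp w t * of_real (?Pxx t x)"
  have n: "cosh (?b * x) - osc w t \<noteq> 0" using profile_denominator_ge(2)[OF o[of t] r(2), of "?b * x"] by simp
  have dP: "((\<lambda>t. ?P t x) has_real_derivative ?o' t * ?P t x ^ 2) (at t)"
    unfolding profile_def using n
    by (auto intro!: derivative_eq_intros osc_deriv simp: power2_eq_square)
  have dW: "((\<lambda>t. breather w t x) has_vector_derivative amp' w t * of_real (?P t x) + amp w t * of_real (?o' t * ?P t x ^ 2)) (at t)"
    unfolding breather_def
    using has_vector_derivative_mult[OF amp_deriv[of w t] has_vector_derivative_of_real[OF dP]]
    by (simp add: add.commute)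
  have dc: "(cis has_vector_derivative \<i> * cis t) (at t)"
    unfolding cis_conv_exp[abs_def]
    by (rule derivative_eq_intros refl has_vector_derivative_real_field | simp)+
  have "((\<lambda>\<tau>. cis \<tau> * (1 + breather w \<tau> x)) has_vector_derivative ?ut t x) (at t)"
    using has_vector_derivative_mult[OF dc has_vector_derivative_add[OF has_vector_derivative_const[of 1] dW]]
    by (simp add: algebra_simps)
  moreover have "((\<lambda>y. cis t * (1 + breather w t y)) has_vector_derivative ?ux t x) (at x)"
  proof -
    have "((\<lambda>y. ?P t y) has_real_derivative - (?b * sinh (?b * x) * ?P t x ^ 2)) (at x)"
      using profile_deriv[OF bb o, of t 1 x] by (simp add: power2_eq_square)
    from has_vector_derivative_mult_right[OF has_vector_derivative_of_real[OF this], of "cis t * amp w t"]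
    have "((\<lambda>y. cis t + cis t * amp w t * of_real (?P t y)) has_vector_derivative 0 + ?ux t x) (at x)"
      by (intro has_vector_derivative_add has_vector_derivative_const)
    then show ?thesis unfolding breather_def by (simp add: algebra_simps)
  qed
  moreover have "((\<lambda>y. ?ux t y) has_vector_derivative ?uxx t x) (at x)"
  proof -
    have "((\<lambda>y. - (?b * sinh (?b * y) * ?P t y ^ 2)) has_real_derivative ?Pxx t x) (at x)"
      using profile_deriv2[OF bb o, of 1 t x] by (simp add: power2_eq_square power3_eq_cube mult.assoc)
    from has_vector_derivative_mult_right[OF has_vector_derivative_of_real[OF this], of "cis t * amp w t"]
    show ?thesis .
  qed
  moreover have "\<i> * ?ut t x + ?uxx t x + (of_real (cmod (cis t * (1 + breather w t x))))\<^sup>2 * (cis t * (1 + breather w t x)) = 0"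
  proof -
    let ?W = "breather w t x"
    let ?p = "?P t x"
    have "\<i> * (amp' w t * of_real ?p + amp w t * of_real (?o' t * ?p ^ 2)) + amp w t * of_real (?Pxx t x)
      = (\<i> * amp' w t + of_real (?b\<^sup>2) * amp w t) * of_real ?p
       + (\<i> * amp w t * of_real (?o' t) + 3 * of_real (?b\<^sup>2 * osc w t) * amp w t) * of_real (?p ^ 2)
       + (2 * of_real (?b\<^sup>2 * ((osc w t)\<^sup>2 - 1)) * amp w t) * of_real (?p ^ 3)"
      by (simp add: algebra_simps)
    also have "\<dots> = G ?W - 2 * of_real (Re ?W)"
      unfolding amp_evolution[OF w] breather_def nonlinearity_expand ..
    finally have e: "\<i> * (amp' w t * of_real ?p + amp w t * of_real (?o' t * ?p ^ 2)) + amp w t * of_real (?Pxx t x) = G ?W - 2 * of_real (Re ?W)" .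
    have "2 * complex_of_real (Re ?W) = ?W + cnj ?W" by (simp only: complex_add_cnj of_real_mult of_real_numeral)
    then have g: "G ?W - 2 * of_real (Re ?W) = (1 + ?W) - (1 + ?W) * cnj (1 + ?W) * (1 + ?W)"
      unfolding G_def of_real_cmod_sq by (simp add: algebra_simps power2_eq_square)
    have c: "(complex_of_real (cmod (cis t * (1 + ?W))))\<^sup>2 = (1 + ?W) * cnj (1 + ?W)"
      unfolding norm_mult norm_cis mult_1 by (rule of_real_cmod_sq)
    have "\<i> * ?ut t x + ?uxx t x = cis t * ((\<i> * \<i>) * (1 + ?W) + (\<i> * (amp' w t * of_real ?p + amp w t * of_real (?o' t * ?p ^ 2)) + amp w t * of_real (?Pxx t x)))"
      by (simp only: algebra_simps)
    also have "\<dots> = - (((1 + ?W) * cnj (1 + ?W)) * (cis t * (1 + ?W)))"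
      unfolding e g i_times_eq_iff by (simp add: algebra_simps)
    finally show ?thesis unfolding c by simp
  qed
  ultimately show "((\<lambda>\<tau>. cis \<tau> * (1 + breather w \<tau> x)) has_vector_derivative ?ut t x) (at t) \<and>
       ((\<lambda>y. cis t * (1 + breather w t y)) has_vector_derivative ?ux t x) (at x) \<and>
       ((\<lambda>y. ?ux t y) has_vector_derivative ?uxx t x) (at x) \<and>
       \<i> * ?ut t x + ?uxx t x + (of_real (cmod (cis t * (1 + breather w t x))))\<^sup>2 * (cis t * (1 + breather w t x)) = 0"
    by blast
qed

lemma KM_breather_eq:
  assumes a: "a > 1 / 2"
  defines "w \<equiv> sqrt (8 * a * (2 * a - 1))"
  shows "0 < w" and "KM_breather a = (\<lambda>t x. cis t * (1 + breather w t x))"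
proof -
  show w: "0 < w" using a by (simp add: w_def)
  have "1 + w\<^sup>2 = (4 * a - 1)\<^sup>2" using a by (simp add: w_def power2_eq_square algebra_simps)
  then have "sqrt (1 + w\<^sup>2) = 4 * a - 1" using a by simp
  then have b: "width w = sqrt (2 * (2 * a - 1))" unfolding width_def by (simp add: algebra_simps)
  have r: "depth w < 1" by (rule depth_less_1[OF w])
  show "KM_breather a = (\<lambda>t x. cis t * (1 + breather w t x))"
  proof (intro ext)
    fix t x
    let ?D = "cosh (width w * x) - osc w t"
    have n: "?D \<noteq> 0" using profile_denominator_ge(2)[OF osc_le[OF w, of t] r, of "width w * x"] by simp
    have D: "w * cosh (width w * x) - sqrt 2 * width w * cos (w * t) = w * ?D"
      using w by (simp add: osc_def depth_def field_simps)
    have E: "- (complex_of_real (sqrt 2 * width w) * (of_real ((width w)\<^sup>2 * cos (w * t)) + \<i> * of_real (w * sin (w * t))) / of_real (w * ?D))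
      = breather w t x"
      using n w unfolding breather_def amp_def profile_def depth_def by (simp add: field_simps)
    show "KM_breather a t x = cis t * (1 + breather w t x)"
      unfolding KM_breather_def Let_def w_def[symmetric] b[symmetric] D E[symmetric] by (simp only: add_uminus_conv_diff)
  qed
qed

section \<open>Instability\<close>

lemma amp_le:
  assumes "0 < w"
  shows "cmod (amp w t) \<le> (width w)\<^sup>2 + w"
proof -
  have "cmod (amp w t) \<le> \<bar>Re (amp w t)\<bar> + \<bar>Im (amp w t)\<bar>" by (rule cmod_le)
  also have "\<dots> \<le> 1 * ((width w)\<^sup>2 * 1) + 1 * (w * 1)"
    unfolding amp_Re_Im abs_mult abs_minus_cancel
    using depth_pos[OF assms] depth_less_1[OF assms] assms
    by (intro add_mono mult_mono) auto
  finally show ?thesis by simp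
qed

lemma breather_ft:
  assumes w: "0 < w"
  shows "has_fourier (breather w t) (\<lambda>\<xi>. amp w t * profile_ft 1 (width w) (osc w t) \<xi>)"
    and "ft (breather w t) \<xi> = amp w t * profile_ft 1 (width w) (osc w t) \<xi>"
    and "continuous_on UNIV (breather w t)"
    and "\<exists>K. \<forall>x. cmod (breather w t x) \<le> K / (1 + x\<^sup>2)"
    and "\<exists>K. \<forall>\<xi>. cmod (ft (breather w t) \<xi>) \<le> K / (1 + \<xi>\<^sup>2) ^ N"
proof -
  have r: "0 \<le> depth w" "depth w < 1" using depth_pos[OF w] depth_less_1[OF w] by auto
  note bb = width_pos[OF w] r order_refl[of "width w"]
  note o = osc_le[OF w]
  have p: "(\<lambda>x. complex_of_real (profile (width w) (osc w t) x ^ 1)) = (\<lambda>x. of_real (profile (width w) (osc w t) x))" by simp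
  show hf: "has_fourier (breather w t) (\<lambda>\<xi>. amp w t * profile_ft 1 (width w) (osc w t) \<xi>)"
    using has_fourier_lincomb[OF profile_power_fourier(3)[OF bb o[of t] order_refl] has_fourier_0, of "amp w t" 0]
    by (simp add: breather_def[abs_def])
  show e: "ft (breather w t) \<xi> = amp w t * profile_ft 1 (width w) (osc w t) \<xi>" for \<xi>
    unfolding profile_ft_def p breather_def[abs_def] ft_def by (simp add: mult.left_commute)
  show "continuous_on UNIV (breather w t)"
    unfolding breather_def[abs_def] by (intro continuous_intros continuous_profile[OF bb o])
  have "cmod (breather w t x) \<le> (cmod (amp w t) * profile_bound (width w) (depth w)) / (1 + x\<^sup>2)" for x
    using mult_left_mono[OF cmod_profile_power_le[OF bb o order_refl], of "cmod (amp w t)" t x]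
    by (simp add: breather_def norm_mult)
  then show "\<exists>K. \<forall>x. cmod (breather w t x) \<le> K / (1 + x\<^sup>2)" by blast
  obtain K where K: "\<And>c \<xi>. \<bar>c\<bar> \<le> depth w \<Longrightarrow> cmod (profile_ft (Suc 0) (width w) c \<xi>) \<le> K / (1 + \<xi>\<^sup>2) ^ N"
    using profile_ft_decay[OF width_pos[OF w] r, of "width w" 0 N] by blast
  have "cmod (ft (breather w t) \<xi>) \<le> (cmod (amp w t) * K) / (1 + \<xi>\<^sup>2) ^ N" for \<xi>
    unfolding e norm_mult using mult_left_mono[OF K[OF o, of t \<xi>], of "cmod (amp w t)"] by simp
  then show "\<exists>K. \<forall>\<xi>. cmod (ft (breather w t) \<xi>) \<le> K / (1 + \<xi>\<^sup>2) ^ N" by blast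
qed

lemma breather_in_Hs:
  assumes w: "0 < w"
  shows "breather w t \<in> Hs s"
  using breather_pert_solution[OF w, of s t] by (simp add: pert_solution_def)

text \<open>Dominated convergence on the Fourier side: the transforms converge pointwise, and their rapid decay is
  uniform because widths, depths and amplitudes stay in a compact range.\<close>

lemma breather_tendsto_Hs:
  assumes w: "0 < w" and wn: "\<And>n. w \<le> v n" "\<And>n. v n \<le> 2 * w" "v \<longlonglongrightarrow> w"
  shows "(\<lambda>n. Hs_norm s (\<lambda>x. breather (v n) t x - breather w t x)) \<longlonglongrightarrow> 0"
proof -
  define b1 b2 r where "b1 = width w" and "b2 = width (2 * w)" and "r = depth w"
  have b1: "0 < b1" unfolding b1_def by (rule width_pos[OF w])
  have r: "0 \<le> r" "r < 1" unfolding r_def using depth_pos[OF w] depth_less_1[OF w] by auto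
  have v: "0 < v n" for n using w wn(1)[of n] by linarith
  have bn: "b1 \<le> width (v n)" "width (v n) \<le> b2" for n
    unfolding b1_def b2_def using w wn v by (auto intro!: width_mono simp: less_imp_le)
  have b: "b1 \<le> width w" "width w \<le> b2" unfolding b1_def b2_def using w by (auto intro!: width_mono)
  have cn: "\<bar>osc (v n) t\<bar> \<le> r" for n
    unfolding r_def using osc_le[OF v] depth_antimono[OF w wn(1)] order_trans by blast
  have c: "\<bar>osc w t\<bar> \<le> r" unfolding r_def by (rule osc_le[OF w])
  have lb: "(\<lambda>n. width (v n)) \<longlonglongrightarrow> width w"
    unfolding width_def by (intro tendsto_intros wn)
  have ld: "(\<lambda>n. depth (v n)) \<longlonglongrightarrow> depth w"
    unfolding depth_def using w by (intro tendsto_intros lb wn) auto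
  have lo: "(\<lambda>n. osc (v n) t) \<longlonglongrightarrow> osc w t"
    unfolding osc_def by (intro tendsto_intros ld wn)
  have la: "(\<lambda>n. amp (v n) t) \<longlonglongrightarrow> amp w t"
    unfolding amp_def by (intro tendsto_intros ld lb wn)
  obtain N :: nat where "(s + 1) / 2 \<le> real N" using real_arch_simple by blast
  then have N: "s + 1 \<le> 2 * real N" by simp
  obtain K where K: "\<And>b c \<xi>. b1 \<le> b \<Longrightarrow> b \<le> b2 \<Longrightarrow> \<bar>c\<bar> \<le> r \<Longrightarrow> cmod (profile_ft (Suc 0) b c \<xi>) \<le> K / (1 + \<xi>\<^sup>2) ^ N"
    using profile_ft_decay[OF b1 r, of b2 0 N] by blast
  define M where "M = b2\<^sup>2 + 2 * w"
  have M: "cmod (amp (v n) t) \<le> M" "cmod (amp w t) \<le> M" for n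
  proof -
    have "(width (v n))\<^sup>2 \<le> b2\<^sup>2" "(width w)\<^sup>2 \<le> b2\<^sup>2"
      using bn(2)[of n] b width_pos[OF v[of n]] width_pos[OF w] by (auto intro!: power_mono)
    then show "cmod (amp (v n) t) \<le> M" "cmod (amp w t) \<le> M"
      using amp_le[OF v[of n], of t] amp_le[OF w, of t] wn(2)[of n] w unfolding M_def by linarith+
  qed
  have M0: "0 \<le> M" using M(2) norm_ge_zero order_trans by blast
  define D where "D n \<xi> = amp (v n) t * profile_ft 1 (width (v n)) (osc (v n) t) \<xi> - amp w t * profile_ft 1 (width w) (osc w t) \<xi>" for n \<xi>
  have hD: "has_fourier (\<lambda>x. breather (v n) t x - breather w t x) (D n)" for n
    unfolding D_def[abs_def] by (intro has_fourier_diff breather_ft v w)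
  have [measurable]: "D n \<in> borel_measurable borel" for n
    using hD[of n] by (auto simp: has_fourier_iff L2_space_iff)
  have Db: "cmod (D n \<xi>) \<le> (2 * M * K) / (1 + \<xi>\<^sup>2) ^ N" for n \<xi>
  proof -
    have "cmod (D n \<xi>) \<le> cmod (amp (v n) t) * cmod (profile_ft (Suc 0) (width (v n)) (osc (v n) t) \<xi>) + cmod (amp w t) * cmod (profile_ft (Suc 0) (width w) (osc w t) \<xi>)"
      unfolding D_def One_nat_def by (rule order_trans[OF norm_triangle_ineq4]) (simp only: norm_mult order_refl)
    also have "\<dots> \<le> M * (K / (1 + \<xi>\<^sup>2) ^ N) + M * (K / (1 + \<xi>\<^sup>2) ^ N)"
      using M M0 K[OF bn cn] K[OF b c] by (intro add_mono mult_mono) auto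
    finally show ?thesis by (simp add: mult_ac)
  qed
  have lim: "(\<lambda>n. LINT \<xi>|lborel. (1 + \<xi>\<^sup>2) powr s * (cmod (D n \<xi>))\<^sup>2) \<longlonglongrightarrow> (LINT \<xi>|(lborel :: real measure). 0)"
  proof (rule integral_dominated_convergence[OF _ _ integrable_lorentzian[of "(2 * M * K)\<^sup>2"]])
    show "AE \<xi> in lborel. (\<lambda>n. (1 + \<xi>\<^sup>2) powr s * (cmod (D n \<xi>))\<^sup>2) \<longlonglongrightarrow> 0"
    proof (rule AE_I2)
      fix \<xi> :: real
      have "(\<lambda>n. D n \<xi>) \<longlonglongrightarrow> amp w t * profile_ft 1 (width w) (osc w t) \<xi> - amp w t * profile_ft 1 (width w) (osc w t) \<xi>"
        unfolding D_def by (intro tendsto_intros la profile_ft_tendsto[OF b1 r order_refl bn(1) lb cn lo])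
      then have "(\<lambda>n. (1 + \<xi>\<^sup>2) powr s * (cmod (D n \<xi>))\<^sup>2) \<longlonglongrightarrow> (1 + \<xi>\<^sup>2) powr s * (cmod 0)\<^sup>2"
        by (intro tendsto_mult tendsto_const tendsto_power tendsto_norm) simp
      then show "(\<lambda>n. (1 + \<xi>\<^sup>2) powr s * (cmod (D n \<xi>))\<^sup>2) \<longlonglongrightarrow> 0" by simp
    qed
    show "AE \<xi> in lborel. norm ((1 + \<xi>\<^sup>2) powr s * (cmod (D n \<xi>))\<^sup>2) \<le> (2 * M * K)\<^sup>2 / (1 + \<xi>\<^sup>2)" for n
      using Hs_weight_le[OF Db N] by (intro AE_I2) (simp only: real_norm_def abs_mult abs_power2 abs_norm_cancel powr_ge_zero abs_of_nonneg)
  qed measurable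
  have "(\<lambda>n. sqrt (1 / (2 * pi) * (LINT \<xi>|lborel. (1 + \<xi>\<^sup>2) powr s * (cmod (D n \<xi>))\<^sup>2))) \<longlonglongrightarrow> sqrt (1 / (2 * pi) * (LINT \<xi>|(lborel :: real measure). 0))"
    by (intro tendsto_real_sqrt tendsto_mult tendsto_const lim)
  then show ?thesis unfolding Hs_norm_eq[OF hD] by simp
qed

text \<open>At time \<open>T\<close> the two perturbations are real and have opposite signs, so the modulus of their difference is at
  least that of the first, however the second is translated. On the unit interval the first one is bounded below
  uniformly in \<open>v\<close>.\<close>

lemma breather_antiphase:
  assumes w: "0 < w" and v: "w \<le> v" "v \<le> 2 * w" and s: "0 \<le> s"
    and T: "cos (w * T) = 1" "cos (v * T) = -1"
  shows "sqrt 2 * (width w) ^ 3 / (4 * w * cosh (width (2 * w))) \<le> Hs_norm s (\<lambda>x. breather v T x - breather w T (x - y))"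
proof -
  let ?d = "sqrt 2 * (width w) ^ 3 / (4 * w * cosh (width (2 * w)))"
  have v0: "0 < v" using w v by linarith
  let ?f = "\<lambda>x. breather v T x - breather w T (x - y)"
  have sn: "sin (w * T) = 0" "sin (v * T) = 0"
    using T sin_cos_squared_add[of "w * T"] sin_cos_squared_add[of "v * T"] by auto
  define p where "p u x = depth u * (width u)\<^sup>2 * profile (width u) (osc u T) x" for u x
  have bw: "breather w T x = of_real (- p w x)" for x
    unfolding breather_def amp_def p_def using T sn by simp
  have bv: "breather v T x = of_real (p v x)" for x
    unfolding breather_def amp_def p_def using T sn by simp
  have pw: "0 < p u x" if "0 < u" for u x
    unfolding p_def using that depth_pos[OF that] width_pos[OF that] depth_less_1[OF that]
      profile_pos[OF width_pos[OF that] _ _ order_refl osc_le[OF that]] by simp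
  obtain N :: nat where "(s + 1) / 2 \<le> real N" using real_arch_simple by blast
  then have N: "s + 1 \<le> 2 * real N" by simp
  obtain Kv where Kv: "\<And>x. cmod (breather v T x) \<le> Kv / (1 + x\<^sup>2)" using breather_ft(4)[OF v0] by blast
  obtain Kw where Kw: "\<And>x. cmod (breather w T x) \<le> Kw / (1 + x\<^sup>2)" using breather_ft(4)[OF w] by blast
  obtain Lv where Lv: "\<And>\<xi>. cmod (ft (breather v T) \<xi>) \<le> Lv / (1 + \<xi>\<^sup>2) ^ N" using breather_ft(5)[OF v0] by blast
  obtain Lw where Lw: "\<And>\<xi>. cmod (ft (breather w T) \<xi>) \<le> Lw / (1 + \<xi>\<^sup>2) ^ N" using breather_ft(5)[OF w] by blast
  have Kw0: "0 \<le> Kw" using order_trans[OF norm_ge_zero Kw[of 0]] by simp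
  have cw: "continuous_on UNIV (\<lambda>x. breather w T (x - y))"
    by (rule continuous_on_compose2[OF breather_ft(3)[OF w]]) (auto intro!: continuous_intros)
  have cf: "continuous_on UNIV ?f" by (intro continuous_intros breather_ft(3) v0 cw)
  \<comment> \<open>A translated Lorentzian is dominated by a multiple of the centred one.\<close>
  have shift: "Kw / (1 + (x - y)\<^sup>2) \<le> (Kw * (2 * (1 + y\<^sup>2))) / (1 + x\<^sup>2)" for x
  proof -
    have "x\<^sup>2 \<le> 2 * (x - y)\<^sup>2 + 2 * y\<^sup>2" using zero_le_power2[of "x - 2 * y"] by (simp add: power2_eq_square algebra_simps)
    moreover have "1 + X \<le> 2 * (1 + Y) * (1 + Z)" if "X \<le> 2 * Z + 2 * Y" "0 \<le> Y" "0 \<le> Z" for X Y Z :: real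
    proof -
      have "2 * (1 + Y) * (1 + Z) = 2 + 2 * Y + 2 * Z + 2 * (Y * Z)" by (simp add: algebra_simps)
      with that mult_nonneg_nonneg[OF that(2,3)] show ?thesis by linarith
    qed
    ultimately have "1 + x\<^sup>2 \<le> 2 * (1 + y\<^sup>2) * (1 + (x - y)\<^sup>2)" by simp
    from mult_left_mono[OF this Kw0]
    show ?thesis using one_plus_sq_pos(1)[of x] one_plus_sq_pos(1)[of "x - y"]
      by (subst frac_le_eq) (auto simp: divide_le_0_iff algebra_simps)
  qed
  have fb: "cmod (?f x) \<le> (Kv + Kw * (2 * (1 + y\<^sup>2))) / (1 + x\<^sup>2)" for x
    using norm_triangle_ineq4[of "breather v T x" "breather w T (x - y)"] Kv[of x] Kw[of "x - y"] shift[of x]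
    unfolding add_divide_distrib by linarith
  have iv: "integrable lborel (breather v T)" by (rule lorentz_dominated(1)[OF breather_ft(3)[OF v0] Kv])
  have iw: "integrable lborel (\<lambda>x. breather w T (x - y))"
    by (rule lorentz_dominated(1)[OF cw order_trans[OF Kw shift]])
  have "ft ?f \<xi> = ft (breather v T) \<xi> - cis (- (y * \<xi>)) * ft (breather w T) \<xi>" for \<xi>
    using ft_lincomb[OF iv iw, of 1 "-1" \<xi>] by (simp add: ft_shift)
  then have dec: "cmod (ft ?f \<xi>) \<le> (Lv + Lw) / (1 + \<xi>\<^sup>2) ^ N" for \<xi>
    using norm_triangle_ineq4[of "ft (breather v T) \<xi>" "cis (- (y * \<xi>)) * ft (breather w T) \<xi>"] Lv[of \<xi>] Lw[of \<xi>]
    unfolding add_divide_distrib by (simp add: norm_mult)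
  have d0: "0 \<le> ?d" using w width_pos[OF w] by (simp add: less_imp_le)
  have low: "?d \<le> cmod (?f x)" if "x \<in> {0..1}" for x
  proof -
    have "cmod (?f x) = p v x + p w (x - y)"
      unfolding bw bv using pw[OF v0, of x] pw[OF w, of "x - y"] by (simp flip: of_real_add)
    then have 1: "p v x \<le> cmod (?f x)" using pw[OF w, of "x - y"] by simp
    have "width v * x \<le> width (2 * w) * 1"
      using that width_mono[of v "2 * w"] v v0 width_pos[OF v0] by (intro mult_mono) auto
    moreover have "0 \<le> width v * x" using that width_pos[OF v0] by simp
    ultimately have "cosh (width v * x) \<le> cosh (width (2 * w))" by (simp add: cosh_real_nonneg_le_iff)
    moreover have "osc v T = - depth v" using T by (simp add: osc_def)
    moreover have "depth v < 1" "1 \<le> cosh (width (2 * w))" by (rule depth_less_1[OF v0], rule cosh_real_ge_1)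
    ultimately have "cosh (width v * x) - osc v T \<le> 2 * cosh (width (2 * w))" by linarith
    moreover have "0 < cosh (width v * x) - osc v T" by (rule profile_denominator_ge(2)[OF osc_le[OF v0] depth_less_1[OF v0]])
    ultimately have 2: "1 / (2 * cosh (width (2 * w))) \<le> profile (width v) (osc v T) x"
      unfolding profile_def by (intro divide_left_mono mult_pos_pos) (auto intro: cosh_real_pos)
    have "sqrt 2 * (width w) ^ 3 / (2 * w) \<le> sqrt 2 * (width v) ^ 3 / v"
      using w v v0 width_pos[OF w] width_mono[of w v] by (intro frac_le mult_left_mono power_mono) (auto simp: less_imp_le)
    also have "\<dots> = depth v * (width v)\<^sup>2" by (simp add: depth_def power2_eq_square power3_eq_cube)
    finally have 3: "sqrt 2 * (width w) ^ 3 / (2 * w) \<le> depth v * (width v)\<^sup>2" .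
    have "?d = sqrt 2 * (width w) ^ 3 / (2 * w) * (1 / (2 * cosh (width (2 * w))))" by simp
    also have "\<dots> \<le> depth v * (width v)\<^sup>2 * profile (width v) (osc v T) x"
      using 2 3 w width_pos[OF w] depth_pos[OF v0] by (intro mult_mono) (auto simp: less_imp_le)
    also have "\<dots> = p v x" by (simp add: p_def)
    finally show ?thesis using 1 by simp
  qed
  have "f \<in> L2_space \<Longrightarrow> integrable lborel (\<lambda>x. (cmod (f x))\<^sup>2)" for f by (simp add: L2_space_def)
  then have i2: "integrable lborel (\<lambda>x. (cmod (?f x))\<^sup>2)" using lorentz_dominated(3)[OF cf fb] by blast
  have "?d\<^sup>2 = (LINT x|lborel. indicator {0..1::real} x * ?d\<^sup>2)"
    by (subst integral_mult_left_zero) simp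
  also have "\<dots> \<le> (LINT x|lborel. (cmod (?f x))\<^sup>2)"
  proof (rule Bochner_Integration.integral_mono[OF _ i2])
    show "integrable lborel (\<lambda>x. indicator {0..1::real} x * ?d\<^sup>2)"
      by (intro integrable_mult_left integrable_real_indicator) auto
    show "indicator {0..1::real} x * ?d\<^sup>2 \<le> (cmod (?f x))\<^sup>2" for x
      using power_mono[OF low[of x] d0, of 2] by (auto simp: indicator_def)
  qed
  finally have "sqrt (?d\<^sup>2) \<le> sqrt (LINT x|lborel. (cmod (?f x))\<^sup>2)" by (rule real_sqrt_le_mono)
  then have "?d \<le> sqrt (LINT x|lborel. (cmod (?f x))\<^sup>2)" by (simp only: real_sqrt_abs abs_of_nonneg[OF d0])
  also have "\<dots> \<le> Hs_norm s ?f" by (rule L2_norm_le_Hs_norm[OF cf fb dec N s])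
  finally show ?thesis .
qed

text \<open>A solution on the whole line has no proper extension.\<close>

lemma breather_maximal:
  assumes "0 < w"
  shows "maximal_pert_solution s t0 (breather w t0) UNIV (breather w)"
  unfolding maximal_pert_solution_def using breather_pert_solution[OF assms] by auto

text \<open>The frequencies are \<open>w * (1 + 1 / (2 * m))\<close> with \<open>m = n + 1\<close>: after \<open>m\<close> periods of the given breather the
  other one has completed \<open>m + 1 / 2\<close> periods.\<close>

lemma breather_not_orbitally_stable:
  assumes w: "0 < w" and s: "0 \<le> s" and U: "pert_of U = breather w"
  shows "\<not> orbitally_stable s t0 U"
proof
  assume "orbitally_stable s t0 U"
  then obtain C0 \<epsilon>0 where C: "0 < C0" "0 < \<epsilon>0" and
    stab: "\<And>\<epsilon> w0 I v. 0 < \<epsilon> \<Longrightarrow> \<epsilon> < \<epsilon>0 \<Longrightarrow> w0 \<in> Hs s \<Longrightarrow> Hs_norm s (\<lambda>x. w0 x - breather w t0 x) < \<epsilon>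
       \<Longrightarrow> maximal_pert_solution s t0 w0 I v \<Longrightarrow>
       \<exists>x0 :: real \<Rightarrow> real. (SUP t. ereal (Hs_norm s (\<lambda>x. v t x - breather w t (x - x0 t)))) < ereal (C0 * \<epsilon>)"
    unfolding orbitally_stable_def U by meson
  define d where "d = sqrt 2 * (width w) ^ 3 / (4 * w * cosh (width (2 * w)))"
  have d: "0 < d" unfolding d_def using w width_pos[OF w] by simp
  \<comment> \<open>Small enough for stability to keep the distance below the lower bound \<open>d\<close> at antiphase.\<close>
  define \<epsilon> where "\<epsilon> = min (\<epsilon>0 / 2) (d / C0)"
  have \<epsilon>: "0 < \<epsilon>" "\<epsilon> < \<epsilon>0" "C0 * \<epsilon> \<le> d"
  proof -
    show "0 < \<epsilon>" "\<epsilon> < \<epsilon>0" unfolding \<epsilon>_def using C d by auto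
    have "\<epsilon> \<le> d / C0" by (simp add: \<epsilon>_def)
    then show "C0 * \<epsilon> \<le> d" using C by (simp add: field_simps)
  qed
  define v where "v n = w * (1 + 1 / (2 * real (Suc n)))" for n
  have vn: "w \<le> v n" "v n \<le> 2 * w" for n unfolding v_def using w by (auto simp: field_simps)
  have vl: "v \<longlonglongrightarrow> w"
  proof -
    have "(\<lambda>n. w * (1 + (1 / 2) * inverse (real (Suc n)))) \<longlonglongrightarrow> w * (1 + (1 / 2) * 0)"
      by (intro tendsto_intros LIMSEQ_inverse_real_of_nat)
    then show ?thesis unfolding v_def[abs_def] by (simp add: inverse_eq_divide)
  qed
  have "eventually (\<lambda>n. Hs_norm s (\<lambda>x. breather (v n) t0 x - breather w t0 x) < \<epsilon>) sequentially"
    using breather_tendsto_Hs[OF w vn vl, of s t0] \<epsilon>(1) by (rule order_tendstoD(2))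
  then obtain n where n: "Hs_norm s (\<lambda>x. breather (v n) t0 x - breather w t0 x) < \<epsilon>"
    using eventually_happens' sequentially_bot by blast
  have v0: "0 < v n" using w vn(1)[of n] by linarith
  from stab[OF \<epsilon>(1,2) breather_in_Hs[OF v0] n breather_maximal[OF v0]]
  obtain x0 :: "real \<Rightarrow> real" where x0: "(SUP t. ereal (Hs_norm s (\<lambda>x. breather (v n) t x - breather w t (x - x0 t)))) < ereal (C0 * \<epsilon>)"
    by blast
  define T where "T = 2 * pi * real (Suc n) / w"
  have "w * T = 2 * pi * real (Suc n)" unfolding T_def using w by simp
  then have T1: "cos (w * T) = 1" using cos_2npi[of "Suc n"] by (simp only: mult_ac)
  have "w * (1 + 1 / (2 * m)) * (2 * pi * m / w) = 2 * pi * m + pi" if "0 < m" for m :: real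
    using w that by (simp add: field_simps)
  from this[of "real (Suc n)"] have "v n * T = 2 * pi * real (Suc n) + pi" unfolding T_def v_def by simp
  then have T2: "cos (v n * T) = -1" using cos_2npi[of "Suc n"] by (simp only: cos_periodic_pi mult_ac)
  have "d \<le> Hs_norm s (\<lambda>x. breather (v n) T x - breather w T (x - x0 T))"
    unfolding d_def by (rule breather_antiphase[OF w vn s T1 T2])
  then have "ereal d \<le> (SUP t. ereal (Hs_norm s (\<lambda>x. breather (v n) t x - breather w t (x - x0 t))))"
    by (intro SUP_upper2[of T]) auto
  then have "ereal d < ereal (C0 * \<epsilon>)" using x0 by (rule order_le_less_trans)
  then show False using \<epsilon>(3) by simp
qed

theorem theorem1p3:
  fixes s t0 a :: real
  assumes "s > 1 / 2" and "a > 1 / 2"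
  shows "classical_NLS_solution (KM_breather a) \<and>
         global_Hs_solution s t0 (KM_breather a) \<and>
         \<not> orbitally_stable s t0 (KM_breather a)"
proof -
  define w where "w = sqrt (8 * a * (2 * a - 1))"
  note KM = KM_breather_eq[OF assms(2), folded w_def]
  have P: "pert_of (KM_breather a) = breather w"
    unfolding KM(2) pert_of_def[abs_def] by (simp add: cis_mult flip: mult.assoc)
  show ?thesis
    unfolding global_Hs_solution_def P
    using breather_classical[OF KM(1), folded KM(2)] breather_pert_solution[OF KM(1)]
      breather_not_orbitally_stable[OF KM(1) _ P] assms(1) by simp
qed

end
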